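(* (i) For $6\le n\le 12$: $\mathrm{ex}_3(n;P\mid M)=20+\binom{n-6}{3}$ and $\mathrm{Ex}_3(n;P\mid M)=\{K^3_6\cup K^3_{n-6}\}$. (ii) For $n=13$: $\mathrm{ex}_3(13;P\mid M)=40$ and $\mathrm{Ex}_3(13;P\mid M)=\{K^3_6\cup K^3_6\cup K^3_1,\ \mathrm{Co}(13)\}$. (iii) For $n\ge 14$: $\mathrm{ex}_3(n;P\mid M)=4+\binom{n-4}{2}$ and $\mathrm{Ex}_3(n;P\mid M)=\{\mathrm{Co}(n)\}$.
   Context: All hypergraphs are 3-uniform; containment means containing an isomorphic copy. $P$ is the loose 3-uniform path of length 3: vertices $a,b,c,d,e,f,g$, edges $\{a,b,c\},\{c,d,e\},\{e,f,g\}$. $M$ is the 3-graph consisting of two disjoint edges. $K^3_m$ is the complete 3-graph on $m$ vertices ($K^3_0$ is empty, $K^3_1$ an isolated vertex) and $\cup$ denotes vertex-disjoint union. The comet $\mathrm{Co}(n)$ is the $n$-vertex 3-graph with vertex set $\{c,h_1,h_2,h_3\}\cup R$, $|R|=n-4$, whose edges are the four triples of $\{c,h_1,h_2,h_3\}$ together with all triples $\{c,u,v\}$ with $u,v\in R$. Conditional Turán number: for a family $\mathcal F$ and a family $\mathcal G$ of $\mathcal F$-free 3-graphs, $\mathrm{ex}_3(n;\mathcal F\mid\mathcal G)$ is the maximum number of edges of an $n$-vertex $\mathcal F$-free 3-graph $H$ that contains some $G\in\mathcal G$; $\mathrm{Ex}_3(n;\mathcal F\mid\mathcal G)$ is the family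 (up to isomorphism) of such $H$ attaining this maximum. *)

theory Defs
  imports Main
begin

type_synonym hg = "nat set \<times> nat set set"

definition is_3graph :: "hg \<Rightarrow> bool" where
  "is_3graph H \<longleftrightarrow> finite (fst H) \<and> (\<forall>e\<in>snd H. e \<subseteq> fst H \<and> card e = 3)"

definition contains :: "hg \<Rightarrow> hg \<Rightarrow> bool" where
  "contains H F \<longleftrightarrow> (\<exists>f. inj_on f (fst F) \<and> f ` fst F \<subseteq> fst H \<and> (\<forall>e\<in>snd F. f ` e \<in> snd H))"

definition free :: "hg set \<Rightarrow> hg \<Rightarrow> bool" where
  "free \<F> H \<longleftrightarrow> (\<forall>F\<in>\<F>. \<not> contains H F)"

definition iso :: "hg \<Rightarrow> hg \<Rightarrow> bool" where
  "iso H K \<longleftrightarrow> (\<exists>f. bij_betw f (fst H) (fst K) \<and> (\<lambda>e. f ` e) ` snd H = snd K)"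

text \<open>Admissible graphs for the conditional Turan problem, on vertex set {0..<n}
  (every n-vertex 3-graph is isomorphic to one of these).\<close>
definition admissible :: "nat \<Rightarrow> hg set \<Rightarrow> hg set \<Rightarrow> hg \<Rightarrow> bool" where
  "admissible n \<F> \<G> H \<longleftrightarrow> fst H = {..<n} \<and> is_3graph H \<and> free \<F> H \<and> (\<exists>G\<in>\<G>. contains H G)"

definition ex3 :: "nat \<Rightarrow> hg set \<Rightarrow> hg set \<Rightarrow> nat" where
  "ex3 n \<F> \<G> = Max {card (snd H) | H. admissible n \<F> \<G> H}"

text \<open>Extremal graphs on vertex set {0..<n}; the paper's family Ex is this set up to isomorphism.\<close>
definition Ex3 :: "nat \<Rightarrow> hg set \<Rightarrow> hg set \<Rightarrow> hg set" where
  "Ex3 n \<F> \<G> = {H. admissible n \<F> \<G> H \<and> card (snd H) = ex3 n \<F> \<G>}"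

definition triples :: "nat set \<Rightarrow> nat set set" where
  "triples S = {e. e \<subseteq> S \<and> card e = 3}"

definition P3 :: hg where
  "P3 = ({0..6}, {{0,1,2},{2,3,4},{4,5,6}})"

definition M2 :: hg where
  "M2 = ({0..5}, {{0,1,2},{3,4,5}})"

definition K6_Kn6 :: "nat \<Rightarrow> hg" where
  "K6_Kn6 n = ({..<n}, triples {0..<6} \<union> triples {6..<n})"

definition K6_K6_K1 :: hg where
  "K6_K6_K1 = ({..<13}, triples {0..<6} \<union> triples {6..<12})"

text \<open>Comet Co(n): c = 0, h_i = 1,2,3, R = {4..<n}.\<close>
definition comet :: "nat \<Rightarrow> hg" where
  "comet n = ({..<n}, triples {0..<4} \<union> {{0,u,v} | u v. u \<in> {4..<n} \<and> v \<in> {4..<n} \<and> u \<noteq> v})"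

end

theory Submission
  imports Defs
begin

text \<open>
  A family of triples is free of \<open>P\<close> iff no edge meets each of two disjoint edges in exactly one
  vertex. If no edge meets two disjoint edges at all, the family is a vertex-disjoint union of
  intersecting families and the Erdos-Ko-Rado bound suffices.

  Otherwise there are edges \<open>abc\<close>, \<open>bcd\<close>, \<open>duv\<close>. Let \<open>R\<close> be the set of vertices outside \<open>abcd\<close> and
  \<open>G\<close> the graph of those pairs in \<open>R\<close> that form an edge with \<open>d\<close>. Freeness forces the remaining
  edges to respect \<open>G\<close>: a triple in \<open>R\<close> contains or avoids every pair of \<open>G\<close>, and so does a pair
  joined to \<open>a\<close>. If the pairs of \<open>G\<close> have no common vertex, counting along the components of \<open>G\<close>
  leaves only the comet, where \<open>G\<close> is complete. If \<open>G\<close> is a star with at least two pairs, the count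
  stays below the bound. The configuration is symmetric under exchanging \<open>a\<close> and \<open>d\<close>, so in
  the last case both have at most one pair. Then either \<open>abcduv\<close> is separated from the other vertices
  and the Turan number of \<open>P\<close> on these finishes by induction, or every edge connecting the two parts
  excludes several edges inside \<open>abcduv\<close>.
\<close>

text \<open>Two clique sizes compete with the comet. \<open>K6\<close> beside a second clique is
  free of \<open>P\<close> only while that clique has at most 6 vertices, since a complete graph on
  7 vertices contains \<open>P\<close>; hence the cubic formula stops at 12. At order 13 two copies
  of \<open>K6\<close> and the comet tie, as 20 + 20 = 4 + (9 choose 2). This tie shapes the
  induction. In the separated case the seven outer vertices carry at most 20 edges, and to identify
  the equality case one must know that 20 edges on 7 vertices form a \<open>K6\<close> and an
  isolated vertex. That uniqueness is itself the conditional theorem at order 7, because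
  intersecting families have at most 15 edges there. So the Turan number, its uniqueness at 7 and
  the conditional bound come from one induction on the number of vertices: the conditional bound
  uses Turan numbers of smaller sets, and the Turan number follows from it and from Erdos-Ko-Rado.
  Order 13 is also where the general counts are too weak: the one for links without a common vertex
  can reach 43, the one for a single pair 40. Both are refined there separately.\<close>

definition pfree :: "nat set set \<Rightarrow> bool" where
  "pfree H \<longleftrightarrow> \<not> (\<exists>e\<in>H. \<exists>g\<in>H. \<exists>f\<in>H. e \<inter> f = {} \<and> (\<exists>x. e \<inter> g = {x}) \<and> (\<exists>y. g \<inter> f = {y}))"

lemma pfreeD:
  "\<lbrakk>pfree H; e \<in> H; g \<in> H; f \<in> H; e \<inter> f = {}; e \<inter> g = {x}; g \<inter> f = {y}\<rbrakk> \<Longrightarrow> False"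
  unfolding pfree_def by blast

lemma pfree_subset: "pfree H \<Longrightarrow> H' \<subseteq> H \<Longrightarrow> pfree H'"
  unfolding pfree_def by blast

lemma finite_triples: "finite S \<Longrightarrow> finite (triples S)"
  unfolding triples_def by simp

lemma card_triples: "finite S \<Longrightarrow> card (triples S) = card S choose 3"
  unfolding triples_def by (rule n_subsets)

lemma triples_mono: "S \<subseteq> S' \<Longrightarrow> triples S \<subseteq> triples S'"
  unfolding triples_def by auto

lemma triplesE:
  assumes "e \<in> triples S"
  obtains x y z where "e = {x, y, z}" "x \<noteq> y" "x \<noteq> z" "y \<noteq> z" "x \<in> S" "y \<in> S" "z \<in> S"
  using assms unfolding triples_def card_3_iff by blast

lemma edge_finite: "e \<in> triples S \<Longrightarrow> finite e"
  unfolding triples_def using card.infinite by fastforce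

lemma edge_props:
  assumes "H \<subseteq> triples V" "e \<in> H"
  shows "e \<noteq> {}" "card e = 3" "e \<subseteq> V" "finite e"
proof -
  have "e \<in> triples V" using assms by blast
  then show c: "card e = 3" and "e \<subseteq> V" by (simp_all add: triples_def)
  show "finite e" by (rule edge_finite) fact
  show "e \<noteq> {}" using c by auto
qed

lemma triples_Int: "triples S \<inter> triples S' = triples (S \<inter> S')"
  unfolding triples_def by auto

text \<open>\<open>exP m\<close> is the Turan number of \<open>P\<close> and \<open>bnd n\<close> the one conditional on two
  disjoint edges; \<open>bnd 13\<close> also equals the size of two disjoint copies of \<open>K6\<close>.\<close>

definition exP :: "nat \<Rightarrow> nat" where
  "exP m = (if m \<le> 6 then m choose 3 else if m = 7 then 20 else (m - 1) choose 2)"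

definition bnd :: "nat \<Rightarrow> nat" where
  "bnd n = (if n \<le> 12 then 20 + (n - 6 choose 3) else 4 + (n - 4 choose 2))"

lemma choose2_add: "(x + y) choose 2 = (x choose 2) + (y choose 2) + x * y" for x y :: nat
  by (induction y) (auto simp: numeral_2_eq_2)

lemma choose2_mono: "x \<le> y \<Longrightarrow> x choose 2 \<le> y choose 2" for x y :: nat
  by (rule binomial_right_mono) 

lemma choose_small:
  "(0::nat) choose 2 = 0" "(Suc 0) choose 2 = 0" "(1::nat) choose 2 = 0" "(2::nat) choose 2 = 1" "(3::nat) choose 2 = 3"
  "(4::nat) choose 2 = 6" "(5::nat) choose 2 = 10" "(6::nat) choose 2 = 15" "(7::nat) choose 2 = 21"
  "(8::nat) choose 2 = 28" "(9::nat) choose 2 = 36" "(10::nat) choose 2 = 45"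
  "(0::nat) choose 3 = 0" "(Suc 0) choose 3 = 0" "(1::nat) choose 3 = 0" "(2::nat) choose 3 = 0" "(3::nat) choose 3 = 1"
  "(4::nat) choose 3 = 4" "(5::nat) choose 3 = 10" "(6::nat) choose 3 = 20"
  by (simp_all add: numeral_eq_Suc)

section \<open>Intersecting families\<close>

definition isect :: "nat set set \<Rightarrow> bool" where
  "isect H \<longleftrightarrow> (\<forall>e\<in>H. \<forall>f\<in>H. e \<inter> f \<noteq> {})"

text \<open>The complement of a triple in a 6-set is a triple disjoint from it, so at most one
  triple is taken from each of the ten complementary pairs.\<close>

lemma isect6:
  assumes "finite V" "card V = 6" "H \<subseteq> triples V" "isect H"
  shows "card H \<le> 10"
proof -
  let ?C = "(\<lambda>e. V - e) ` H"
  have fin: "finite H" using assms finite_subset finite_triples by blast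
  have inj: "inj_on (\<lambda>e. V - e) H"
    by (rule inj_onI) (use assms(3) in \<open>auto simp: triples_def\<close>)
  have "H \<inter> ?C = {}"
    using assms(4) unfolding isect_def by fastforce
  moreover have "?C \<subseteq> triples V"
    using assms by (auto simp: triples_def card_Diff_subset finite_subset subset_iff)
  ultimately have "card H + card ?C \<le> card (triples V)"
    by (metis assms(1,3) card_Un_disjoint card_mono fin finite_imageI finite_triples le_sup_iff)
  then show ?thesis
    using card_image[OF inj] card_triples[OF assms(1)] assms(2) by (simp add: choose_small)
qed

lemma card_pairs: "finite S \<Longrightarrow> card {p. p \<subseteq> S \<and> card p = 2} = card S choose 2"
  by (rule n_subsets)

text \<open>Pairwise meeting pairs form a star, with at most \<open>card S - 1\<close> members, or a
  triangle, with three; each lower bound on \<open>card G\<close> rules out one of these.\<close>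

lemma two_disjoint_pairs:
  assumes "finite S" "G \<subseteq> {p. p \<subseteq> S \<and> card p = 2}" "card G \<ge> 4" "card G \<ge> card S"
  shows "\<exists>p\<in>G. \<exists>q\<in>G. p \<inter> q = {}"
proof (rule ccontr)
  assume no: "\<not> ?thesis"
  have finG: "finite G" by (rule finite_subset[OF assms(2)]) (use assms(1) in simp)
  have meet: "p \<inter> q \<noteq> {}" if "p \<in> G" "q \<in> G" for p q using no that by blast
  have "G \<noteq> {}" using assms(3) by auto
  then obtain p where p: "p \<in> G" by blast
  then obtain x y where xy: "p = {x, y}" "x \<noteq> y" using assms(2) by (auto simp: card_2_iff)
  have star: False if z: "\<forall>g\<in>G. z \<in> g" "z \<in> S" for z
  proof -
    have "G \<subseteq> (\<lambda>w. {z, w}) ` (S - {z})"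
    proof
      fix g assume g: "g \<in> G"
      then have "z \<in> g" "g \<subseteq> S" "card g = 2" using z assms(2) by auto
      then obtain w where "g = {z, w}" "w \<noteq> z" by (auto simp: card_2_iff)
      then show "g \<in> (\<lambda>w. {z, w}) ` (S - {z})" using \<open>g \<subseteq> S\<close> by auto
    qed
    then have "card G \<le> card (S - {z})"
      by (rule surj_card_le[rotated]) (use assms(1) in simp)
    then show False using assms(1,4) z(2) card_Diff1_less[OF assms(1) z(2)] by linarith
  qed
  have xyS: "x \<in> S" "y \<in> S" using p xy assms(2) by auto
  then obtain g where g: "g \<in> G" "x \<notin> g" using star by blast
  then have "y \<in> g" using meet[OF p g(1)] xy by auto
  then obtain w where w: "g = {y, w}" "w \<noteq> y" "w \<noteq> x" using g assms(2) by (force simp: card_2_iff)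
  obtain h where h: "h \<in> G" "y \<notin> h" using star xyS by blast
  then have hx: "x \<in> h" "w \<in> h" using meet[OF p h(1)] meet[OF g(1) h(1)] xy w by auto
  then have h': "h = {x, w}" using h assms(2) w(3) by (force simp: card_2_iff)
  \<comment> \<open>A pair that meets all three sides of the triangle on \<open>x\<close>,
    \<open>y\<close>, \<open>w\<close> is itself a side.\<close>
  have "G \<subseteq> {{x, y}, {y, w}, {x, w}}"
  proof
    fix k assume k: "k \<in> G"
    then obtain s t where st: "k = {s, t}" "s \<noteq> t" using assms(2) by (auto simp: card_2_iff)
    show "k \<in> {{x, y}, {y, w}, {x, w}}"
      using meet[OF p k] meet[OF g(1) k] meet[OF h(1) k] st xy w h' by auto
  qed
  then have "card G \<le> card {{x, y}, {y, w}, {x, w}}" by (meson card_mono finite.emptyI finite.insertI)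
  also have "\<dots> \<le> 3" by (simp add: card_insert_if)
  finally show False using assms(3) by simp
qed


definition lk :: "nat set set \<Rightarrow> nat set \<Rightarrow> nat \<Rightarrow> nat set set" where
  "lk H S v = {p. p \<subseteq> S \<and> card p = 2 \<and> insert v p \<in> H}"

lemma lk_subset: "lk H S v \<subseteq> {p. p \<subseteq> S \<and> card p = 2}"
  unfolding lk_def by auto

lemma finite_lk: "finite S \<Longrightarrow> finite (lk H S v)"
  by (rule finite_subset[OF lk_subset]) simp

lemma card_lk_le: "finite S \<Longrightarrow> card (lk H S v) \<le> card S choose 2"
  using card_mono[OF _ lk_subset[of H S v]] card_pairs[of S] by simp

lemma edges_through:
  assumes "H \<subseteq> triples V"
  shows "{e\<in>H. v \<in> e} = insert v ` lk H (V - {v}) v"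
proof -
  have "e \<in> insert v ` lk H (V - {v}) v" if e: "e \<in> H" "v \<in> e" for e
  proof
    have "card e = 3" "e \<subseteq> V" using e assms by (auto simp: triples_def)
    then show "e - {v} \<in> lk H (V - {v}) v"
      using e by (auto simp: lk_def insert_absorb card_Diff_singleton)
    show "e = insert v (e - {v})" using e by auto
  qed
  then show ?thesis by (auto simp: lk_def)
qed

lemma card_insert_image:
  assumes "\<And>p. p \<in> P \<Longrightarrow> v \<notin> p"
  shows "card (insert v ` P) = card P"
  by (rule card_image, rule inj_onI) (metis assms insert_ident)

lemma card_edges_through:
  assumes "H \<subseteq> triples V"
  shows "card {e\<in>H. v \<in> e} = card (lk H (V - {v}) v)"
  unfolding edges_through[OF assms] by (rule card_insert_image) (auto simp: lk_def)

text \<open>The Erdos-Ko-Rado bound for triples. Deleting a vertex of degree at most \<open>n - 2\<close>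
  reduces to a smaller ground set; if all degrees are larger, the edges through any vertex
  contain a two-edge sunflower, which forces most pairs through that vertex to be popular.\<close>

lemma isect_bound:
  assumes "finite V" "card V \<ge> 6" "H \<subseteq> triples V" "isect H"
  shows "card H \<le> (card V - 1) choose 2"
  using assms
proof (induction "card V" arbitrary: V H rule: less_induct)
  case less
  note fV = \<open>finite V\<close> and HV = \<open>H \<subseteq> triples V\<close> and IS = \<open>isect H\<close>
  define n where "n = card V"
  have finH: "finite H" using finite_subset[OF HV finite_triples[OF fV]] .
  show ?case
  proof (cases "n = 6")
    case True
    then show ?thesis using isect6[OF fV _ HV IS] by (simp add: n_def choose_small)
  next
    case False
    then have n7: "n \<ge> 7" using less.prems n_def by simp
    show ?thesis
    proof (rule ccontr)
      assume "\<not> ?thesis"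
      then have big: "card H > (n - 1) choose 2" by (simp add: n_def)
      have ch: "(n - 1) choose 2 = ((n - 2) choose 2) + (n - 2)"
      proof -
        have "n - 1 = (n - 2) + 1" using n7 by simp
        then show ?thesis by (metis choose2_add choose_small(3) add_0_right mult.right_neutral)
      qed
      have deg: "card {e\<in>H. v \<in> e} \<ge> n - 1" if v: "v \<in> V" for v
      proof -
        have c: "card (V - {v}) = n - 1" using v fV n_def by simp
        have "card {e\<in>H. v \<notin> e} \<le> (card (V - {v}) - 1) choose 2"
          by (rule less.hyps) (use v n7 HV IS fV c n_def in \<open>auto simp: triples_def isect_def\<close>)
        then have "card {e\<in>H. v \<notin> e} \<le> (n - 2) choose 2" using c by (simp add: numeral_2_eq_2)
        moreover have "card H = card {e\<in>H. v \<notin> e} + card {e\<in>H. v \<in> e}"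
        proof -
          have "H = {e\<in>H. v \<notin> e} \<union> {e\<in>H. v \<in> e}" by auto
          then show ?thesis
            using card_Un_disjoint[of "{e\<in>H. v \<notin> e}" "{e\<in>H. v \<in> e}"] finH by auto
        qed
        ultimately show ?thesis using big ch n7 by linarith
      qed
      have "V \<noteq> {}" using n7 n_def by auto
      then obtain a where a: "a \<in> V" by blast
      have "card (lk H (V - {a}) a) \<ge> n - 1"
        using deg[OF a] card_edges_through[OF HV] by simp
      moreover have "card (V - {a}) = n - 1" using fV a n_def by simp
      ultimately have "\<exists>p\<in>lk H (V - {a}) a. \<exists>q\<in>lk H (V - {a}) a. p \<inter> q = {}"
        by (intro two_disjoint_pairs[OF _ lk_subset]) (use fV n7 in auto)
      then obtain p q where pq: "p \<in> lk H (V - {a}) a" "q \<in> lk H (V - {a}) a" "p \<inter> q = {}"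
        by blast
      obtain x1 x2 where p: "p = {x1, x2}" "x1 \<noteq> x2" using pq(1) by (auto simp: lk_def card_2_iff)
      obtain y1 y2 where q: "q = {y1, y2}" "y1 \<noteq> y2" using pq(2) by (auto simp: lk_def card_2_iff)
      have E1: "{a, x1, x2} \<in> H" and E2: "{a, y1, y2} \<in> H" using pq p q by (auto simp: lk_def)
      have dist: "x1 \<noteq> y1" "x1 \<noteq> y2" "x2 \<noteq> y1" "x2 \<noteq> y2" "a \<noteq> x1" "a \<noteq> x2" "a \<noteq> y1" "a \<noteq> y2"
        and inV: "x1 \<in> V" "x2 \<in> V" "y1 \<in> V" "y2 \<in> V"
        using pq p q by (auto simp: lk_def)
      define R where "R = V - {a, x1, x2, y1, y2}"
      have cR: "card R = n - 5"
      proof -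
        have "card {a, x1, x2, y1, y2} = 5" using dist p q by simp
        then show ?thesis
          unfolding R_def n_def using a inV card_Diff_subset[of "{a, x1, x2, y1, y2}" V] by simp
      qed
      have finR: "finite R" using fV R_def by simp
      \<comment> \<open>The edges \<open>{a, x1, x2}\<close> and \<open>{a, y1, y2}\<close> are the
        sunflower. An edge through \<open>w\<close> in \<open>R\<close> either contains
        \<open>a\<close>, counted by \<open>N w\<close>, or must meet both petals and is
        \<open>w\<close> with one of the four transversal pairs in \<open>K\<close>, counted by
        \<open>M w\<close>.\<close>
      define N where "N w = {x. x \<noteq> a \<and> x \<noteq> w \<and> {a, w, x} \<in> H}" for w
      define K where "K = {x1, x2} \<times> {y1, y2}"
      define M where "M w = {(i, j). (i, j) \<in> K \<and> {w, i, j} \<in> H}" for w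
      have meet: "e \<inter> f \<noteq> {}" if "e \<in> H" "f \<in> H" for e f using IS that by (auto simp: isect_def)
      have cK: "card K = 4" "finite K" unfolding K_def using p q by (auto simp: card_cartesian_product)
      have MK: "M w \<subseteq> K" for w unfolding M_def by auto
      have NV: "N w \<subseteq> V" for w
      proof
        fix x assume "x \<in> N w"
        then have "{a, w, x} \<in> triples V" using HV by (auto simp: N_def)
        then show "x \<in> V" by (auto simp: triples_def)
      qed
      have degw: "n - 1 \<le> card (N w) + card (M w)" if w: "w \<in> R" for w
      proof -
        have "{e\<in>H. w \<in> e} \<subseteq> (\<lambda>x. {a, w, x}) ` N w \<union> (\<lambda>(i, j). {w, i, j}) ` M w"
        proof
          fix e assume "e \<in> {e\<in>H. w \<in> e}"
          then have e: "e \<in> H" "w \<in> e" by auto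
          have c3: "card e = 3" using e HV by (auto simp: triples_def)
          show "e \<in> (\<lambda>x. {a, w, x}) ` N w \<union> (\<lambda>(i, j). {w, i, j}) ` M w"
          proof (cases "a \<in> e")
            case True
            have "a \<noteq> w" using w R_def by auto
            then obtain x where "e = {a, w, x}" "x \<noteq> a" "x \<noteq> w"
              using True e(2) c3 by (force simp: card_3_iff)
            then show ?thesis using e by (auto simp: N_def)
          next
            case False
            obtain i where i: "i \<in> e" "i \<in> {x1, x2}" using meet[OF e(1) E1] False by auto
            obtain j where j: "j \<in> e" "j \<in> {y1, y2}" using meet[OF e(1) E2] False by auto
            have "i \<noteq> j" "w \<noteq> i" "w \<noteq> j" using i j dist w R_def by auto
            then have "e = {w, i, j}" using i(1) j(1) e(2) c3 by (force simp: card_3_iff)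
            then have "(i, j) \<in> M w" using i j e(1) unfolding M_def K_def by auto
            then show ?thesis using \<open>e = {w, i, j}\<close> by force
          qed
        qed
        then have "card {e\<in>H. w \<in> e} \<le> card ((\<lambda>x. {a, w, x}) ` N w \<union> (\<lambda>(i, j). {w, i, j}) ` M w)"
          by (rule card_mono[rotated]) (use finite_subset[OF NV fV] finite_subset[OF MK cK(2)] in auto)
        also have "\<dots> \<le> card (N w) + card (M w)"
          by (rule order_trans[OF card_Un_le])
             (intro add_mono card_image_le finite_subset[OF NV fV] finite_subset[OF MK cK(2)])
        finally show ?thesis using deg[of w] w R_def by auto
      qed
      \<comment> \<open>\<open>\<sigma>\<close> switches both coordinates, that is, takes a
        transversal pair to the disjoint one. If \<open>w\<close> is joined to \<open>t\<close>,
        then \<open>w'\<close> cannot be joined to \<open>\<sigma> t\<close>, since those edges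
        would be disjoint.\<close>
      have Msum: "card (M w) + card (M w') \<le> 4" if w: "w \<in> R" "w' \<in> R" "w \<noteq> w'" for w w'
      proof -
        define \<sigma> where "\<sigma> = (\<lambda>(i, j). (if i = x1 then x2 else x1, if j = y1 then y2 else y1))"
        have "\<sigma> (\<sigma> t) = t" if "t \<in> K" for t
          using that p(2) q(2) by (auto simp: \<sigma>_def K_def)
        then have inj: "inj_on \<sigma> (M w)" using MK[of w] by (intro inj_on_inverseI[of _ \<sigma>]) auto
        have "\<sigma> ` M w \<inter> M w' = {}"
        proof (rule equals0I)
          fix t assume t: "t \<in> \<sigma> ` M w \<inter> M w'"
          then obtain i j where ij: "(i, j) \<in> M w" "t = \<sigma> (i, j)" by auto
          obtain i' j' where t': "t = (i', j')" by (cases t)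
          have "{w, i, j} \<in> H" "{w', i', j'} \<in> H" using ij t t' by (auto simp: M_def)
          moreover have "{w, i, j} \<inter> {w', i', j'} = {}"
          proof -
            have "i \<in> {x1, x2}" "j \<in> {y1, y2}" using ij MK[of w] by (auto simp: K_def)
            moreover have "i' = (if i = x1 then x2 else x1)" "j' = (if j = y1 then y2 else y1)"
              using ij(2) t' by (auto simp: \<sigma>_def)
            ultimately show ?thesis using p(2) q(2) dist w by (auto simp: R_def)
          qed
          ultimately show False using meet by blast
        qed
        moreover have "\<sigma> t \<in> K" if t: "t \<in> K" for t
        proof -
          obtain i j where "t = (i, j)" "i \<in> {x1, x2}" "j \<in> {y1, y2}" using t unfolding K_def by blast
          then show ?thesis by (simp add: \<sigma>_def K_def)
        qed
        then have "\<sigma> ` M w \<subseteq> K" using MK[of w] by blast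
        ultimately have "card (\<sigma> ` M w) + card (M w') \<le> card K"
          using card_mono[OF cK(2), of "\<sigma> ` M w \<union> M w'"] MK[of w']
            card_Un_disjoint[of "\<sigma> ` M w" "M w'"] finite_subset[OF _ cK(2)] by simp
        then show ?thesis using card_image[OF inj] cK by simp
      qed
      have "\<not> (\<forall>e\<in>H. a \<in> e)"
      proof
        assume "\<forall>e\<in>H. a \<in> e"
        then have "{e\<in>H. a \<in> e} = H" by auto
        then have "card H = card (lk H (V - {a}) a)" using card_edges_through[OF HV, of a] by simp
        also have "\<dots> \<le> (n - 1) choose 2"
          using card_lk_le[of "V - {a}" H a] fV a n_def by simp
        finally show False using big by simp
      qed
      then obtain y where y: "y \<in> H" "a \<notin> y" by blast
      have Ny: "N w \<subseteq> f" if "w \<notin> f" "f \<in> H" "a \<notin> f" for w f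
      proof
        fix x assume "x \<in> N w"
        then have "{a, w, x} \<in> H" by (simp add: N_def)
        then show "x \<in> f" using meet[OF _ that(2)] that by blast
      qed
      have c3: "card f = 3" "finite f" if "f \<in> H" for f
        using edge_props[OF HV that] by simp_all
      \<comment> \<open>\<open>y\<close> spends two of its three vertices on the petals, while
        \<open>R\<close> has \<open>n - 5\<close>, hence at least two, vertices; so some
        \<open>w'\<close> in \<open>R\<close> lies outside \<open>y\<close>.\<close>
      have "card (y \<inter> R) \<le> 1"
      proof -
        obtain i where i: "i \<in> y" "i \<in> {x1, x2}" using meet[OF y(1) E1] y by auto
        obtain j where j: "j \<in> y" "j \<in> {y1, y2}" using meet[OF y(1) E2] y by auto
        have "i \<noteq> j" using i j dist by auto
        have "y \<inter> R \<subseteq> y - {i, j}" using i j by (auto simp: R_def)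
        then have "card (y \<inter> R) \<le> card (y - {i, j})" using c3[OF y(1)] by (intro card_mono) auto
        also have "\<dots> = 1" using \<open>i \<noteq> j\<close> i j c3[OF y(1)] by (subst card_Diff_subset) auto
        finally show ?thesis .
      qed
      moreover have "y \<inter> R = R" if "R - y = {}" using that by auto
      ultimately have "R - y \<noteq> {}" using cR n7 by auto
      then obtain w' where w': "w' \<in> R" "w' \<notin> y" by blast
      have "R - {w'} \<noteq> {}"
      proof
        assume "R - {w'} = {}"
        then have "card R \<le> card {w'}" by (intro card_mono) auto
        then show False using cR n7 by simp
      qed
      then obtain w where w: "w \<in> R" "w \<noteq> w'" by blast
      have N': "card (N w') \<le> 3"
        using card_mono[OF c3(2)[OF y(1)] Ny[OF w'(2) y]] c3(1)[OF y(1)] by simp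
      \<comment> \<open>Two degrees of at least 6, less 4 for both transversal parts and 3 for
        \<open>N w'\<close>, leave 5. An edge avoiding \<open>a\<close> and \<open>w\<close> would
        have to contain all of \<open>N w\<close>, which is too large for a triple.\<close>
      have Nw: "card (N w) \<ge> 5"
        using degw[OF w(1)] degw[OF w'(1)] Msum[OF w(1) w'(1) w(2)] N' n7 by linarith
      have win: "w \<in> f" if f: "f \<in> H" "a \<notin> f" for f
      proof (rule ccontr)
        assume "w \<notin> f"
        then have "card (N w) \<le> 3" using card_mono[OF c3(2)[OF f(1)] Ny[OF _ f]] c3(1)[OF f(1)] by simp
        then show False using Nw by simp
      qed
      \<comment> \<open>Its edges avoid both \<open>a\<close> and \<open>w\<close>, which
        \<open>win\<close> forbids; the degree of \<open>w'\<close> then drops to at most 3.\<close>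
      have "M w' = {}"
      proof (rule equals0I)
        fix t assume "t \<in> M w'"
        then obtain i j where ij: "(i, j) \<in> K" "{w', i, j} \<in> H" by (auto simp: M_def)
        then have "a \<notin> {w', i, j}" using dist w' by (auto simp: K_def R_def)
        then have "w \<in> {w', i, j}" using win ij(2) by blast
        then show False using w ij by (auto simp: K_def R_def)
      qed
      then show False using degw[OF w'(1)] N' n7 by simp
    qed
  qed
qed

text \<open>The Erdos-Ko-Rado maximum for triples on \<open>m\<close> points. Up to 5 points any two
  triples meet, so all of them are allowed.\<close>

definition zb :: "nat \<Rightarrow> nat" where
  "zb m = (if m \<le> 5 then m choose 3 else (m - 1) choose 2)"

lemma isect_zb:
  assumes "finite V" "H \<subseteq> triples V" "isect H"
  shows "card H \<le> zb (card V)"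
  using isect_bound[OF assms(1) _ assms(2,3)] card_mono[OF finite_triples[OF assms(1)] assms(2)]
    card_triples[OF assms(1)] by (auto simp: zb_def)

lemma zb_6: "zb (6 + i) = 10 + (i choose 2) + 5 * i"
  using choose2_add[of 5 i] by (simp add: zb_def choose_small add.commute)

lemma zb_small: "zb 0 = 0" "zb (Suc 0) = 0" "zb 1 = 0" "zb 2 = 0" "zb 3 = 1" "zb 4 = 4" "zb 5 = 10"
  by (simp_all add: zb_def choose_small)

lemma nat_cases6:
  fixes m :: nat
  obtains "m = 0" | "m = 1" | "m = 2" | "m = 3" | "m = 4" | "m = 5" | i where "m = 6 + i"
proof -
  have "m = 0 \<or> m = 1 \<or> m = 2 \<or> m = 3 \<or> m = 4 \<or> m = 5 \<or> (\<exists>i. m = 6 + i)" by presburger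
  then show ?thesis using that by blast
qed

lemma choose2_expand:
  "(8 + k) choose 2 = 28 + (k choose 2) + 8 * k" "(5 + k) choose 2 = 10 + (k choose 2) + 5 * k"
  "(6 + k) choose 2 = 15 + (k choose 2) + 6 * k" "(7 + k) choose 2 = 21 + (k choose 2) + 7 * k" for k :: nat
  using choose2_add[of 8 k] choose2_add[of 5 k] choose2_add[of 6 k] choose2_add[of 7 k]
  by (simp_all add: choose_small)

text \<open>This is what superadditivity requires when the other part has \<open>6 + j\<close>
  points: the increment of \<open>zb\<close> there is
  \<open>(u choose 2) + u * j + 5 * u\<close>.\<close>

lemma zb_le: "zb u \<le> (u choose 2) + 5 * u"
  by (rule nat_cases6[of u]) (simp_all add: zb_6 zb_small choose_small choose2_expand)

lemma zb_add_large: "zb u + zb (6 + j) \<le> zb (u + (6 + j))"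
proof -
  have "zb (u + (6 + j)) = zb (6 + (u + j))" by (simp add: ac_simps)
  also have "\<dots> = 10 + ((u choose 2) + (j choose 2) + u * j) + 5 * (u + j)"
    by (simp only: zb_6 choose2_add)
  finally show ?thesis using zb_le[of u] zb_6[of j] by simp
qed

lemma zb_add: "zb u + zb w \<le> zb (u + w)"
proof -
  consider "u \<ge> 6" | "w \<ge> 6" | "u \<in> {0,1,2,3,4,5}" "w \<in> {0,1,2,3,4,5}" by force
  then show ?thesis
  proof cases
    case 1
    then show ?thesis using zb_add_large[of w "u - 6"] by (simp add: add.commute)
  next
    case 2
    then show ?thesis using zb_add_large[of u "w - 6"] by simp
  next
    case 3
    then show ?thesis by (auto simp: zb_small) (simp_all add: zb_def choose_small)
  qed
qed

lemma bnd_small: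
  "bnd 6 = 20" "bnd 7 = 20" "bnd 8 = 20" "bnd 9 = 21" "bnd 10 = 24" "bnd 11 = 30" "bnd 12 = 40" "bnd 13 = 40"
  by (simp_all add: bnd_def choose_small)

text \<open>Applied to two unions of components that each contain an edge, hence at least three
  vertices. Strictness keeps families without a core away from the extremal ones.\<close>

lemma zb_add_less_bnd:
  assumes "u \<ge> 3" "w \<ge> 3"
  shows "zb u + zb w < bnd (u + w)"
proof -
  have large: "zb u + zb (6 + j) < bnd (u + (6 + j))" if "u \<ge> 3" for u j
  \<comment> \<open>This is the range of at most 12 vertices, where \<open>bnd\<close> is cubic and
    only finitely many pairs of sizes remain.\<close>
  proof (cases "u + j \<le> 6")
    case True
    then have "(u = 3 \<and> (j = 0 \<or> j = 1 \<or> j = 2 \<or> j = 3)) \<or> (u = 4 \<and> (j = 0 \<or> j = 1 \<or> j = 2)) \<or>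
        (u = 5 \<and> (j = 0 \<or> j = 1)) \<or> (u = 6 \<and> j = 0)"
      using that by presburger
    then show ?thesis by (auto simp: zb_small zb_6 bnd_def choose_small) (simp_all add: zb_def choose_small)
  next
    case False
    have "bnd (u + (6 + j)) = 4 + ((2 + (u + j)) choose 2)" using False by (simp add: bnd_def)
    then have b: "bnd (u + (6 + j)) = 4 + (1 + ((u choose 2) + (j choose 2) + u * j) + 2 * (u + j))"
      using choose2_add[of 2 "u + j"] choose2_add[of u j] choose_small(4) by linarith
    have "zb u + 5 + 3 * j < (u choose 2) + u * j + 2 * u"
    proof -
      have "3 * j \<le> u * j" using that by simp
      show ?thesis
      proof (rule nat_cases6[of u])
        assume "u = 3" then show ?thesis using False that by (simp add: zb_small choose_small)
      next
        fix i assume u: "u = 6 + i"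
        define P where "P = u * j"
        have "3 * j \<le> P" using \<open>3 * j \<le> u * j\<close> by (simp add: P_def)
        moreover have "zb u = 10 + (i choose 2) + 5 * i" "u choose 2 = 15 + (i choose 2) + 6 * i"
          unfolding u by (rule zb_6, rule choose2_expand)
        ultimately show ?thesis using u unfolding P_def[symmetric] by linarith
      qed (use that False \<open>3 * j \<le> u * j\<close> in \<open>auto simp: zb_small choose_small\<close>)
    qed
    then show ?thesis unfolding b zb_6 by simp
  qed
  consider "u \<ge> 6" | "w \<ge> 6" | "u \<in> {3,4,5}" "w \<in> {3,4,5}" using assms by force
  then show ?thesis
  proof cases
    case 1
    then show ?thesis using large[of w "u - 6"] assms by (simp add: add.commute)
  next
    case 2
    then show ?thesis using large[of u "w - 6"] assms by simp
  next
    case 3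
    then show ?thesis by (auto simp: zb_small bnd_small)
  qed
qed

section \<open>Families in which no edge meets two disjoint edges\<close>

text \<open>A core is a pair of disjoint edges together with an edge meeting both of them.\<close>

definition nocore :: "nat set set \<Rightarrow> bool" where
  "nocore H \<longleftrightarrow> (\<forall>e\<in>H. \<forall>f\<in>H. \<forall>g\<in>H. e \<inter> f = {} \<longrightarrow> e \<inter> g = {} \<or> g \<inter> f = {})"

lemma nocore_subset: "nocore H \<Longrightarrow> H' \<subseteq> H \<Longrightarrow> nocore H'"
  unfolding nocore_def by blast

text \<open>Without a core, intersecting is an equivalence relation on edges, so the edges meeting
  a given edge form an intersecting family on a union of components.\<close>

lemma nocore_split:
  assumes "finite V" "H \<subseteq> triples V" "nocore H" "e \<in> H"
  obtains U where "U \<subseteq> V" "e \<subseteq> U" "{x\<in>H. x \<inter> e \<noteq> {}} \<subseteq> triples U" "isect {x\<in>H. x \<inter> e \<noteq> {}}"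
    "{x\<in>H. x \<inter> e = {}} \<subseteq> triples (V - U)"
proof
  let ?U = "\<Union>{x\<in>H. x \<inter> e \<noteq> {}}"
  have e: "e \<noteq> {}" using edge_props[OF assms(2,4)] by simp
  show "?U \<subseteq> V" using assms(2) by (auto simp: triples_def)
  show "e \<subseteq> ?U" using assms(4) e by auto
  show "{x\<in>H. x \<inter> e \<noteq> {}} \<subseteq> triples ?U" using assms(2) by (auto simp: triples_def)
  show "isect {x\<in>H. x \<inter> e \<noteq> {}}"
    using assms(3,4) unfolding isect_def nocore_def by blast
  show "{x\<in>H. x \<inter> e = {}} \<subseteq> triples (V - ?U)"
  proof
    fix x assume x: "x \<in> {x\<in>H. x \<inter> e = {}}"
    have "x \<inter> y = {}" if "y \<in> H" "y \<inter> e \<noteq> {}" for y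
      using assms(3,4) x that unfolding nocore_def by blast
    then show "x \<in> triples (V - ?U)" using x assms(2) unfolding triples_def by blast
  qed
qed

lemma nocore_sum:
  assumes "finite V" "H \<subseteq> triples V" "nocore H" "e \<in> H"
  obtains U where "U \<subseteq> V" "e \<subseteq> U" "card H \<le> zb (card U) + card {x\<in>H. x \<inter> e = {}}"
    "{x\<in>H. x \<inter> e = {}} \<subseteq> triples (V - U)"
proof -
  obtain U where U: "U \<subseteq> V" "e \<subseteq> U" "{x\<in>H. x \<inter> e \<noteq> {}} \<subseteq> triples U" "isect {x\<in>H. x \<inter> e \<noteq> {}}"
    "{x\<in>H. x \<inter> e = {}} \<subseteq> triples (V - U)"
    using nocore_split[OF assms] .
  have "H = {x\<in>H. x \<inter> e \<noteq> {}} \<union> {x\<in>H. x \<inter> e = {}}" by auto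
  then have "card H \<le> card {x\<in>H. x \<inter> e \<noteq> {}} + card {x\<in>H. x \<inter> e = {}}"
    by (metis (no_types, lifting) card_Un_le)
  moreover have "card {x\<in>H. x \<inter> e \<noteq> {}} \<le> zb (card U)"
    by (rule isect_zb[OF finite_subset[OF U(1) assms(1)] U(3,4)])
  ultimately show thesis using that U by (meson add_le_mono1 le_trans)
qed

text \<open>Components are peeled off one at a time, and superadditivity of \<open>zb\<close>
  recombines their bounds.\<close>

lemma nocore_zb:
  assumes "finite V" "H \<subseteq> triples V" "nocore H"
  shows "card H \<le> zb (card V)"
  using assms
proof (induction "card V" arbitrary: V H rule: less_induct)
  case less
  show ?case
  proof (cases "H = {}")
    case False
    then obtain e where e: "e \<in> H" by auto
    obtain U where U: "U \<subseteq> V" "e \<subseteq> U" "card H \<le> zb (card U) + card {x\<in>H. x \<inter> e = {}}"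
      "{x\<in>H. x \<inter> e = {}} \<subseteq> triples (V - U)" using nocore_sum[OF less.prems e] .
    have "e \<noteq> {}" using edge_props[OF less.prems(2) e] by simp
    then have "V - U \<subset> V" using U by auto
    then have "card {x\<in>H. x \<inter> e = {}} \<le> zb (card (V - U))"
      using U(4) less.prems(1) nocore_subset[OF less.prems(3), of "{x\<in>H. x \<inter> e = {}}"]
      by (intro less.hyps psubset_card_mono) auto
    moreover have "card V = card U + card (V - U)"
      using U less.prems by (metis card_Diff_subset card_mono finite_subset le_add_diff_inverse)
    moreover have "zb (card U) + zb (card (V - U)) \<le> zb (card V)"
      unfolding calculation(2) by (rule zb_add)
    ultimately show ?thesis using U(3) by linarith
  qed simp
qed

text \<open>The second edge \<open>f\<close> lies outside the component part of \<open>e\<close>, so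
  both parts have at least three vertices and the strict inequality for \<open>zb\<close>
  applies.\<close>

lemma nocore_less_bnd:
  assumes "finite V" "H \<subseteq> triples V" "nocore H" "e \<in> H" "f \<in> H" "e \<inter> f = {}"
  shows "card H < bnd (card V)"
proof -
  obtain U where U: "U \<subseteq> V" "e \<subseteq> U" "card H \<le> zb (card U) + card {x\<in>H. x \<inter> e = {}}"
      "{x\<in>H. x \<inter> e = {}} \<subseteq> triples (V - U)" using nocore_sum[OF assms(1-4)] .
  have "card {x\<in>H. x \<inter> e = {}} \<le> zb (card (V - U))"
    using U(4) assms(1) nocore_subset[OF assms(3), of "{x\<in>H. x \<inter> e = {}}"]
    by (intro nocore_zb) auto
  moreover have c: "card V = card U + card (V - U)"
    using U assms(1) by (metis card_Diff_subset card_mono finite_subset le_add_diff_inverse)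
  moreover have "card U \<ge> 3"
    using card_mono[OF finite_subset[OF U(1) assms(1)] U(2)] edge_props[OF assms(2,4)] by simp
  moreover have "f \<subseteq> V - U" using edge_props[OF U(4), of f] assms(5,6) by blast
  then have "card (V - U) \<ge> 3" using card_mono[of "V - U" f] assms(1) edge_props[OF assms(2,5)] by simp
  ultimately have "zb (card U) + zb (card (V - U)) < bnd (card V)"
    using zb_add_less_bnd[of "card U" "card (V - U)"] by presburger
  then show ?thesis using U(3) \<open>card {x\<in>H. x \<inter> e = {}} \<le> zb (card (V - U))\<close> by linarith
qed

abbreviation prs :: "nat set \<Rightarrow> nat set set" where
  "prs S \<equiv> {p. p \<subseteq> S \<and> card p = 2}"

lemma finite_prs: "finite S \<Longrightarrow> finite (prs S)"
  by simp

section \<open>The configuration abc, bcd\<close>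

text \<open>The third edge \<open>duv\<close> is left out on purpose: it reappears as a member of
  \<open>G\<close>. Without it the configuration is symmetric under exchanging \<open>a\<close> and
  \<open>d\<close>, which exchanges \<open>G\<close> and \<open>G1\<close>.\<close>

locale spike =
  fixes V :: "nat set" and H :: "nat set set" and a b c d :: nat
  assumes finV: "finite V" and HV: "H \<subseteq> triples V" and pf: "pfree H"
    and dist: "distinct [a, b, c, d]" and abc: "{a, b, c} \<in> H" and bcd: "{b, c, d} \<in> H"
begin

lemma neq: "a \<noteq> b" "a \<noteq> c" "a \<noteq> d" "b \<noteq> c" "b \<noteq> d" "c \<noteq> d"
  "b \<noteq> a" "c \<noteq> a" "d \<noteq> a" "c \<noteq> b" "d \<noteq> b" "d \<noteq> c"
  using dist by auto

lemma inV: "a \<in> V" "b \<in> V" "c \<in> V" "d \<in> V"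
  using edge_props(3)[OF HV abc] edge_props(3)[OF HV bcd] by auto

lemma swap: "spike V H d b c a"
proof
  show "distinct [d, b, c, a]" using dist by auto
  show "{d, b, c} \<in> H" "{b, c, a} \<in> H" using abc bcd by (simp_all add: insert_commute)
qed (use finV HV pf in auto)

definition R where "R = V - {a, b, c, d}"
definition G where "G = lk H R d"
definition G1 where "G1 = lk H R a"
definition A where "A = {w\<in>R. {b, c, w} \<in> H}"
definition T where "T = H \<inter> triples R"

lemma finR: "finite R" using finV by (simp add: R_def)

lemma finH: "finite H" by (rule finite_subset[OF HV finite_triples[OF finV]])

lemma finG: "finite G" "finite G1" unfolding G_def G1_def by (rule finite_lk[OF finR])+

lemma finA: "finite A" using finR by (simp add: A_def)

lemma finT: "finite T" using finH by (simp add: T_def)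

lemma cardV: "card V = card R + 4"
proof -
  have "card {a, b, c, d} = 4" using neq by simp
  moreover have "card {a, b, c, d} \<le> card V" by (rule card_mono[OF finV]) (use inV in auto)
  ultimately show ?thesis
    unfolding R_def using inV card_Diff_subset[of "{a, b, c, d}" V] by simp
qed

lemma RD: "w \<in> R \<Longrightarrow> w \<noteq> a \<and> w \<noteq> b \<and> w \<noteq> c \<and> w \<noteq> d \<and> w \<in> V"
  by (simp add: R_def)

lemma lkE:
  assumes "p \<in> lk H R x"
  obtains u v where "p = {u, v}" "u \<noteq> v" "u \<in> R" "v \<in> R" "{x, u, v} \<in> H"
proof -
  have "p \<subseteq> R" "card p = 2" "insert x p \<in> H" using assms by (auto simp: lk_def)
  then show thesis using that by (metis card_2_iff insert_subset)
qed

lemma lk_doubleton_iff: "{u, v} \<in> lk H R x \<longleftrightarrow> u \<noteq> v \<and> u \<in> R \<and> v \<in> R \<and> {x, u, v} \<in> H"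
  by (auto simp: lk_def card_2_iff doubleton_eq_iff)

text \<open>Otherwise \<open>dp\<close>, \<open>diw\<close>, \<open>abc\<close> is a copy of
  \<open>P\<close>.\<close>

lemma pair_with_d:
  assumes "p \<in> G" "w \<in> R" "i \<in> {a, b, c}" "{d, i, w} \<in> H"
  shows "w \<in> p"
proof (rule ccontr)
  assume w: "w \<notin> p"
  obtain u v where p: "p = {u, v}" "u \<noteq> v" "u \<in> R" "v \<in> R" "{d, u, v} \<in> H"
    using assms(1) unfolding G_def by (rule lkE)
  show False
    by (rule pfreeD[OF pf p(5) assms(4) abc, of d i])
       (use w p(1,2) RD[OF p(3)] RD[OF p(4)] RD[OF assms(2)] assms(3) neq in auto)
qed

text \<open>Otherwise \<open>aiw\<close>, \<open>bcd\<close>, \<open>dp\<close> is a copy of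
  \<open>P\<close>.\<close>

lemma pair_with_a:
  assumes "p \<in> G" "w \<in> R" "i \<in> {b, c}" "{a, i, w} \<in> H"
  shows "w \<in> p"
proof (rule ccontr)
  assume w: "w \<notin> p"
  obtain u v where p: "p = {u, v}" "u \<noteq> v" "u \<in> R" "v \<in> R" "{d, u, v} \<in> H"
    using assms(1) unfolding G_def by (rule lkE)
  show False
    by (rule pfreeD[OF pf assms(4) bcd p(5), of i d])
       (use w p(1,2) RD[OF p(3)] RD[OF p(4)] RD[OF assms(2)] assms(3) neq in auto)
qed

text \<open>If \<open>q\<close> misses \<open>p\<close>, the path is \<open>iq\<close>,
  \<open>bcd\<close>, \<open>dp\<close>; if they share one vertex, it is \<open>abc\<close>,
  \<open>iq\<close>, \<open>dp\<close>. Consequently two pairs in \<open>G\<close> already empty the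
  links of \<open>b\<close> and \<open>c\<close> in \<open>R\<close>.\<close>

lemma links_bc:
  assumes "p \<in> G" "i \<in> {b, c}" "q \<in> lk H R i"
  shows "q = p"
proof -
  obtain u v where p: "p = {u, v}" "u \<noteq> v" "u \<in> R" "v \<in> R" "{d, u, v} \<in> H"
    using assms(1) unfolding G_def by (rule lkE)
  obtain x y where q: "q = {x, y}" "x \<noteq> y" "x \<in> R" "y \<in> R" "{i, x, y} \<in> H"
    using assms(3) by (rule lkE)
  note rd = RD[OF p(3)] RD[OF p(4)] RD[OF q(3)] RD[OF q(4)] neq
  have disj: "p \<inter> q \<noteq> {}"
  proof
    assume "p \<inter> q = {}"
    then show False
      by (intro pfreeD[OF pf q(5) bcd p(5), of i d]) (use p(1,2) q(1,2) rd assms(2) in auto)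
  qed
  have one: False if "x' \<in> p" "y' \<notin> p" "{i, x', y'} \<in> H" "y' \<in> R" for x' y'
  proof -
    have "x' \<in> R" using that p by auto
    then show False
      by (intro pfreeD[OF pf abc that(3) p(5), of i x'])
         (use p(1,2) that(1,2) RD[OF that(4)] rd assms(2) RD[of x'] in auto)
  qed
  show ?thesis
    using one[of x y] one[of y x] disj q p(1,2) by (auto simp: insert_commute)
qed

text \<open>Sharing exactly one vertex gives the path \<open>abc\<close>, \<open>aq\<close>,
  \<open>dp\<close>. Unlike for \<open>b\<close> and \<open>c\<close>, a disjoint \<open>q\<close>
  survives, since \<open>bcd\<close> no longer meets \<open>aq\<close>.\<close>

lemma links_a_d:
  assumes "p \<in> G" "q \<in> G1"
  shows "q = p \<or> q \<inter> p = {}"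
proof -
  obtain u v where p: "p = {u, v}" "u \<noteq> v" "u \<in> R" "v \<in> R" "{d, u, v} \<in> H"
    using assms(1) unfolding G_def by (rule lkE)
  obtain x y where q: "q = {x, y}" "x \<noteq> y" "x \<in> R" "y \<in> R" "{a, x, y} \<in> H"
    using assms(2) unfolding G1_def by (rule lkE)
  note rd = RD[OF p(3)] RD[OF p(4)] RD[OF q(3)] RD[OF q(4)] neq
  have one: False if "x' \<in> p" "y' \<notin> p" "{a, x', y'} \<in> H" "y' \<in> R" for x' y'
  proof -
    have "x' \<in> R" using that p by auto
    then show False
      by (intro pfreeD[OF pf abc that(3) p(5), of a x'])
         (use p(1,2) that(1,2) RD[OF that(4)] rd RD[of x'] in auto)
  qed
  show ?thesis
    using one[of x y] one[of y x] q p(1,2) by (auto simp: insert_commute)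
qed

text \<open>If \<open>t\<close> contained just one vertex of \<open>p\<close>, then
  \<open>t\<close>, \<open>dp\<close>, \<open>bcd\<close> would be a copy of \<open>P\<close>. Hence
  such triples respect the components of \<open>G\<close>.\<close>

lemma link_closed:
  assumes "p \<in> G" "t \<in> T"
  shows "p \<subseteq> t \<or> p \<inter> t = {}"
proof -
  obtain u v where p: "p = {u, v}" "u \<noteq> v" "u \<in> R" "v \<in> R" "{d, u, v} \<in> H"
    using assms(1) unfolding G_def by (rule lkE)
  have t: "t \<in> H" "t \<subseteq> R" using assms(2) by (auto simp: T_def triples_def)
  have ab: "a \<notin> t" "b \<notin> t" "c \<notin> t" "d \<notin> t" using t RD by auto
  have one: False if "x' \<in> t" "y' \<notin> t" "{d, x', y'} \<in> H" "y' \<in> R" for x' y'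
  proof -
    have "x' \<in> R" using that t by auto
    then show False
      by (intro pfreeD[OF pf t(1) that(3) bcd, of x' d])
         (use that(1,2) RD[OF that(4)] neq RD[of x'] ab in auto)
  qed
  show ?thesis using one[of u v] one[of v u] p by (auto simp: insert_commute)
qed

text \<open>If \<open>p\<close> and \<open>p'\<close> are disjoint, then \<open>bcw\<close>,
  \<open>dp\<close>, \<open>dp'\<close> is a copy of \<open>P\<close>.\<close>

lemma link_meets_A:
  assumes "p \<in> G" "w \<in> A" "w \<in> p" "p' \<in> G"
  shows "p \<inter> p' \<noteq> {}"
proof
  assume dj: "p \<inter> p' = {}"
  obtain u v where p': "p' = {u, v}" "u \<noteq> v" "u \<in> R" "v \<in> R" "{d, u, v} \<in> H"
    using assms(4) unfolding G_def by (rule lkE)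
  obtain x y where p: "p = {x, y}" "x \<noteq> y" "x \<in> R" "y \<in> R" "{d, x, y} \<in> H"
    using assms(1) unfolding G_def by (rule lkE)
  have w: "w \<in> R" "{b, c, w} \<in> H" using assms(2) by (auto simp: A_def)
  show False
    by (rule pfreeD[OF pf w(2) p(5) p'(5), of w d])
       (use dj assms(3) p p' RD[OF p(3)] RD[OF p(4)] RD[OF p'(3)] RD[OF p'(4)] neq in auto)
qed

text \<open>The edge \<open>aiy\<close> would be the middle of the path \<open>bcw\<close>,
  \<open>aiy\<close>, \<open>dp\<close>.\<close>

lemma A_excludes:
  assumes "p \<in> G" "w \<in> A" "w \<notin> p" "i \<in> {b, c}" "y \<in> insert d p"
  shows "{a, i, y} \<notin> H"
proof
  assume E: "{a, i, y} \<in> H"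
  obtain u v where p: "p = {u, v}" "u \<noteq> v" "u \<in> R" "v \<in> R" "{d, u, v} \<in> H"
    using assms(1) unfolding G_def by (rule lkE)
  have w: "w \<in> R" "{b, c, w} \<in> H" using assms(2) by (auto simp: A_def)
  show False
    by (rule pfreeD[OF pf w(2) E p(5), of i y])
       (use assms p RD[OF p(3)] RD[OF p(4)] RD[OF w(1)] neq in auto)
qed

text \<open>The edge \<open>aiy\<close> would be the middle of the path \<open>aq\<close>,
  \<open>aiy\<close>, \<open>dp\<close>. The excluded edges are the same as in
  \<open>A_excludes\<close>.\<close>

lemma link_a_excludes:
  assumes "p \<in> G" "q \<in> G1" "q \<inter> p = {}" "i \<in> {b, c}" "y \<in> insert d p"
  shows "{a, i, y} \<notin> H"
proof
  assume E: "{a, i, y} \<in> H"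
  obtain u v where p: "p = {u, v}" "u \<noteq> v" "u \<in> R" "v \<in> R" "{d, u, v} \<in> H"
    using assms(1) unfolding G_def by (rule lkE)
  obtain x z where q: "q = {x, z}" "x \<noteq> z" "x \<in> R" "z \<in> R" "{a, x, z} \<in> H"
    using assms(2) unfolding G1_def by (rule lkE)
  show False
    by (rule pfreeD[OF pf q(5) E p(5), of a y])
       (use assms(3-5) p(1,2) q(1,2) RD[OF p(3)] RD[OF p(4)] RD[OF q(3)] RD[OF q(4)] neq in auto)
qed

text \<open>Here \<open>q\<close> misses \<open>p\<close>, so \<open>abc\<close>, \<open>aq\<close>,
  \<open>insert i p\<close> is a copy of \<open>P\<close>.\<close>

lemma triple_avoids_link_a:
  assumes "p \<in> G" "q \<in> G1" "i \<in> q" "i \<notin> p" "insert i p \<in> H"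
  shows False
proof -
  have dj: "q \<inter> p = {}" using links_a_d[OF assms(1,2)] assms(3,4) by auto
  obtain u v where p: "p = {u, v}" "u \<noteq> v" "u \<in> R" "v \<in> R" "{d, u, v} \<in> H"
    using assms(1) unfolding G_def by (rule lkE)
  obtain x z where q: "q = {x, z}" "x \<noteq> z" "x \<in> R" "z \<in> R" "{a, x, z} \<in> H"
    using assms(2) unfolding G1_def by (rule lkE)
  show False
    by (rule pfreeD[OF pf abc q(5) assms(5), of a i])
       (use dj assms(3) p(1,2) q(1,2) RD[OF p(3)] RD[OF p(4)] RD[OF q(3)] RD[OF q(4)] neq in auto)
qed

definition pr where "pr x y = {w\<in>R. {x, y, w} \<in> H}"

lemma fin_pr: "finite (pr x y)" using finR by (simp add: pr_def)

lemma pr_bc: "pr b c = A" by (simp add: pr_def A_def)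

lemma edge_types:
  assumes "e \<in> H"
  shows "e \<in> H \<inter> triples {a, b, c, d} \<or>
    (\<exists>(i, j)\<in>{(a, b), (a, c), (a, d), (b, c), (b, d), (c, d)}. \<exists>w\<in>pr i j. e = {i, j, w}) \<or>
    (\<exists>i\<in>{a, b, c, d}. \<exists>p\<in>lk H R i. e = insert i p) \<or> e \<in> T"
proof -
  let ?X = "{a, b, c, d}"
  have e: "card e = 3" "e \<subseteq> V" "finite e" using edge_props[OF HV assms] by simp_all
  have un: "e = (e \<inter> ?X) \<union> (e \<inter> R)" using e(2) by (auto simp: R_def)
  have dj: "(e \<inter> ?X) \<inter> (e \<inter> R) = {}" by (auto simp: R_def)
  have sum: "card (e \<inter> ?X) + card (e \<inter> R) = 3"
    using card_Un_disjoint[OF _ _ dj] un e by simp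
  then consider "card (e \<inter> R) = 0" | "card (e \<inter> R) = 1" "card (e \<inter> ?X) = 2"
    | "card (e \<inter> R) = 2" "card (e \<inter> ?X) = 1" | "card (e \<inter> ?X) = 0" by linarith
  then show ?thesis
  proof cases
    case 1
    then have "e \<inter> R = {}" using e by simp
    then have "e \<subseteq> ?X" using un by blast
    then show ?thesis using assms e by (simp add: triples_def)
  next
    case 2
    obtain w where w: "e \<inter> R = {w}" using 2 by (auto simp: card_1_singleton_iff)
    obtain i j where ij: "e \<inter> ?X = {i, j}" "i \<noteq> j" using 2 by (auto simp: card_2_iff)
    have eq: "e = {i, j, w}" "e = {j, i, w}" using un w ij by auto
    have "w \<in> R" using w by auto
    then have "w \<in> pr i j" "w \<in> pr j i" using eq assms by (auto simp: pr_def)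
    moreover have "i \<in> ?X" "j \<in> ?X" using ij by auto
    ultimately have "\<exists>(i, j)\<in>{(a, b), (a, c), (a, d), (b, c), (b, d), (c, d)}. \<exists>w\<in>pr i j. e = {i, j, w}"
      using eq ij(2) by (elim insertE emptyE) auto
    then show ?thesis by blast
  next
    case 3
    obtain i where i: "e \<inter> ?X = {i}" using 3 by (auto simp: card_1_singleton_iff)
    have eq: "e = insert i (e \<inter> R)" using un i by auto
    have "e \<inter> R \<in> lk H R i" using 3 eq assms by (simp add: lk_def)
    moreover have "i \<in> ?X" using i by auto
    ultimately show ?thesis using eq by blast
  next
    case 4
    then have "e \<subseteq> R" using un e by auto
    then show ?thesis using assms e by (simp add: triples_def T_def)
  qed
qed

lemma card_core: "card (H \<inter> triples {a, b, c, d}) \<le> 4"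
proof -
  have "card (H \<inter> triples {a, b, c, d}) \<le> card (triples {a, b, c, d})"
    by (rule card_mono) (simp_all add: finite_triples)
  also have "card {a, b, c, d} = 4" using neq by simp
  then have "card (triples {a, b, c, d}) = 4" by (simp only: card_triples finite.intros choose_small)
  finally show ?thesis .
qed

text \<open>The triples in \<open>I\<close> and the pairs of \<open>I\<close> joined to
  \<open>a\<close> together form a \<open>P\<close>-free family on \<open>insert a I\<close>, which
  is smaller than \<open>V\<close>. Counting them jointly costs one Turan number instead of two
  bounds.\<close>

lemma isolated_part:
  assumes "I \<subseteq> R" "\<And>W H'. \<lbrakk>finite W; card W < card V; H' \<subseteq> triples W; pfree H'\<rbrakk> \<Longrightarrow> card H' \<le> exP (card W)"
  shows "card (lk H I a) + card (H \<inter> triples I) \<le> exP (card I + 1)"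
proof -
  have finI: "finite I" using assms(1) finR finite_subset by blast
  have aI: "a \<notin> I" using assms(1) RD by blast
  let ?E = "insert a ` lk H I a \<union> (H \<inter> triples I)"
  have "insert a p \<in> H \<and> card (insert a p) = 3 \<and> insert a p \<subseteq> insert a I" if p: "p \<in> lk H I a" for p
  proof -
    have "insert a p \<in> H" "p \<subseteq> I" using p by (auto simp: lk_def)
    then show ?thesis using edge_props[OF HV] by auto
  qed
  then have E: "?E \<subseteq> triples (insert a I)" "?E \<subseteq> H"
    using triples_mono[of I "insert a I"] by (auto simp: triples_def)
  have "card I \<le> card R" by (rule card_mono[OF finR assms(1)])
  then have "card ?E \<le> exP (card (insert a I))"
    by (intro assms(2) E pfree_subset[OF pf]) (use finI aI cardV in auto)
  moreover have "insert a ` lk H I a \<inter> (H \<inter> triples I) = {}"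
    using aI by (auto simp: triples_def)
  then have "card ?E = card (insert a ` lk H I a) + card (H \<inter> triples I)"
    by (intro card_Un_disjoint) (use finite_lk[OF finI] finH in auto)
  moreover have "card (insert a ` lk H I a) = card (lk H I a)"
    by (rule card_insert_image) (use aI in \<open>auto simp: lk_def\<close>)
  ultimately show ?thesis using aI finI by simp
qed

end

section \<open>Links without a common vertex\<close>

lemma exP_small: "exP 0 = 0" "exP 1 = 0" "exP (Suc 0) = 0" "exP (Suc (Suc 0)) = 0" "exP 2 = 0" "exP 3 = 1" "exP 4 = 4" "exP 5 = 10"
  "exP 6 = 20" "exP 7 = 20" "exP 8 = 21"
  by (simp_all add: exP_def choose_small)

lemma exP_large: "exP (8 + i) = 21 + (i choose 2) + 7 * i"
proof -
  have "exP (8 + i) = (7 + i) choose 2" by (simp add: exP_def)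
  then show ?thesis by (simp only: choose2_expand)
qed

lemma bnd_large: "bnd (13 + i) = 40 + (i choose 2) + 9 * i"
proof -
  have "bnd (13 + i) = 4 + ((9 + i) choose 2)" by (simp add: bnd_def)
  then show ?thesis by (simp only: choose2_add choose_small)
qed

lemma bnd_13: "n \<ge> 13 \<Longrightarrow> bnd n = 4 + ((n - 4) choose 2)"
  by (simp add: bnd_def)

text \<open>\<open>q\<close>, \<open>k\<close>, \<open>s\<close> are the later sizes of
  \<open>Q\<close>, \<open>K\<close>, \<open>I\<close>. The summands count, in order: triples of
  \<open>abcd\<close>; pairs of \<open>G\<close> inside \<open>Q\<close> with the triples inside
  \<open>Q\<close> (the extra 1 occurs when \<open>Q\<close> is a triangle); \<open>A\<close>; the
  pairs of \<open>K\<close>, once for \<open>d\<close> and once for \<open>a\<close>; pairs of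
  \<open>K\<close> extended by a vertex of \<open>I\<close>; and the isolated part with
  \<open>a\<close>. The sum \<open>q + 2 * k + s\<close> below 9 means at most 12 vertices.\<close>

lemma nonstar_arith_small:
  "\<forall>q\<in>set [0..<9]. \<forall>k\<in>set [0..<5]. \<forall>s\<in>set [0..<9].
     (q \<ge> 3 \<or> q = 0 \<and> k \<ge> 2) \<and> (q \<ge> 4 \<longrightarrow> k + s > 0) \<and> q + 2 * k + s \<in> set [3..<9] \<longrightarrow>
     4 + (q choose 2) + (if q = 3 then 1 else 0) + s + 2 * k + k * s + exP (s + 1) < bnd (q + 2 * k + s + 4)"
  by code_simp


lemma choose2_double: "(2 * k) choose 2 = k * (2 * k - 1)" for k :: nat
  by (simp add: choose_two mult.assoc)

lemma exP_Suc_large: "s \<ge> 7 \<Longrightarrow> exP (s + 1) = s choose 2"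
  by (simp add: exP_def)

lemma nonstar_arith_large:
  assumes "q \<ge> 3 \<or> q = 0 \<and> k \<ge> 2" "q \<ge> 4 \<Longrightarrow> k + s > 0" "\<not> (q = 0 \<and> k = 2 \<and> s = 5)"
    "q + 2 * k + s \<ge> 9"
  shows "4 + (q choose 2) + (if q = 3 then 1 else 0) + s + 2 * k + k * s + exP (s + 1) < bnd (q + 2 * k + s + 4)"
proof -
  \<comment> \<open>The binomial coefficient in \<open>bnd\<close> counts the pairs of
    \<open>R\<close>; these names split it along the three blocks, with \<open>D\<close> for the
    pairs inside the \<open>2 * k\<close> vertices of \<open>K\<close>.\<close>
  define D P S U where defs: "D = (2 * k) choose 2" "P = k * q" "S = k * s" "U = q * s"
  have b: "bnd (q + 2 * k + s + 4) = 4 + ((q choose 2) + D + 2 * P + (s choose 2) + U + 2 * S)"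
  proof -
    have "bnd (q + 2 * k + s + 4) = 4 + ((q + 2 * k + s) choose 2)" using assms(4) bnd_13 by simp
    then show ?thesis
      using choose2_add[of "q + 2 * k" s] choose2_add[of q "2 * k"] by (simp add: defs algebra_simps)
  qed
  have D1: "D \<ge> k" unfolding defs choose2_double by (cases k) auto
  have D3: "D \<ge> 3 * k" if "k \<ge> 2"
  proof -
    have "k * 3 \<le> k * (2 * k - 1)" by (rule mult_le_mono2) (use that in simp)
    then show ?thesis by (simp add: defs(1) choose2_double)
  qed
  have D5: "D \<ge> 5 * k" if "k \<ge> 3"
  proof -
    have "k * 5 \<le> k * (2 * k - 1)" by (rule mult_le_mono2) (use that in simp)
    then show ?thesis by (simp add: defs(1) choose2_double)
  qed
  have P3: "P \<ge> 3 * k" if "q \<ge> 3" unfolding defs using that by simp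
  have U3: "U \<ge> 3 * s" if "q \<ge> 3" unfolding defs using that by simp
  have S2: "S \<ge> 2 * s" if "k \<ge> 2" unfolding defs using that by simp
  have "(if q = 3 then 1 else 0) + s + 2 * k + S + exP (s + 1) < D + 2 * P + (s choose 2) + U + 2 * S"
  proof (cases "s \<ge> 7")
    case True
    then show ?thesis using assms(1) D1 D3 P3 U3 S2 exP_Suc_large[OF True] by (cases "q = 0") auto
  next
    case False
    then have "s = 0 \<or> s = 1 \<or> s = 2 \<or> s = 3 \<or> s = 4 \<or> s = 5 \<or> s = 6" by presburger
    moreover have "U = s * q" "S = s * k" by (simp_all add: defs)
    ultimately show ?thesis
      using assms D1 D3 D5 P3 by (elim disjE) (auto simp: exP_small choose_small)
  qed
  then show ?thesis unfolding b by (simp add: defs(3))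
qed

lemma nonstar_arith:
  assumes "q \<ge> 3 \<or> q = 0 \<and> k \<ge> 2" "q \<ge> 4 \<Longrightarrow> k + s > 0" "\<not> (q = 0 \<and> k = 2 \<and> s = 5)"
  shows "4 + (q choose 2) + (if q = 3 then 1 else 0) + s + 2 * k + k * s + exP (s + 1) < bnd (q + 2 * k + s + 4)"
proof (cases "q + 2 * k + s \<ge> 9")
  case True
  then show ?thesis using nonstar_arith_large assms by blast
next
  case False
  then have "q \<in> set [0..<9]" "k \<in> set [0..<5]" "s \<in> set [0..<9]" by auto
  moreover have "q + 2 * k + s \<in> set [3..<9]" using False assms(1) by auto
  ultimately show ?thesis using nonstar_arith_small assms by blast
qed

text \<open>The case where \<open>G\<close> is a triangle and \<open>s = card I\<close>: 4 for the
  triples of \<open>abcd\<close>, \<open>s + 3\<close> for \<open>A\<close>, and 4 for the three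
  pairs and the triangle itself as an edge.\<close>

lemma triangle_arith: "11 + s + exP (s + 1) < bnd (s + 7)"
proof (cases "s \<ge> 7")
  case True
  then obtain i where i: "s = 7 + i" using le_Suc_ex by blast
  have "exP (s + 1) = 21 + (i choose 2) + 7 * i" using exP_large[of i] i by simp
  moreover have "bnd (s + 7) = 40 + (((1 + i) choose 2)) + 9 * (1 + i)"
    using bnd_large[of "1 + i"] i by (simp add: ac_simps)
  moreover have "(1 + i) choose 2 = (i choose 2) + i" using choose2_add[of 1 i] by (simp add: choose_small)
  ultimately show ?thesis using i by simp
next
  case False
  then have "s = 0 \<or> s = 1 \<or> s = 2 \<or> s = 3 \<or> s = 4 \<or> s = 5 \<or> s = 6" by presburger
  then show ?thesis by (elim disjE) (simp_all add: exP_small bnd_small bnd_def choose_small)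
qed

context spike
begin

text \<open>A vertex joined to a pair of \<open>abcd\<close> other than \<open>bc\<close> lies in
  every pair of \<open>G\<close>, and a link pair of \<open>b\<close> or \<open>c\<close> equals
  every pair of \<open>G\<close>. Neither exists when the pairs have no common vertex.\<close>

lemma nonstar_decomp:
  assumes ns: "\<And>w. \<exists>p\<in>G. w \<notin> p"
  shows "H \<subseteq> (H \<inter> triples {a, b, c, d}) \<union> (\<lambda>w. {b, c, w}) ` A \<union> insert d ` G \<union> insert a ` G1 \<union> T"
proof
  fix e assume e: "e \<in> H"
  have "pr i j = {}" if "(i, j) \<in> {(a, b), (a, c), (a, d), (b, d), (c, d)}" for i j
  proof (rule equals0I)
    fix w assume "w \<in> pr i j"
    then have w: "w \<in> R" "{i, j, w} \<in> H" by (auto simp: pr_def)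
    obtain p where p: "p \<in> G" "w \<notin> p" using ns by blast
    show False
      using that pair_with_d[OF p(1) w(1), of i] pair_with_a[OF p(1) w(1), of j] w(2) p(2) by (auto simp: insert_commute)
  qed
  then have pr0: "pr a b = {}" "pr a c = {}" "pr a d = {}" "pr b d = {}" "pr c d = {}" by auto
  have "lk H R i = {}" if "i \<in> {b, c}" for i
  proof (rule equals0I)
    fix q assume q: "q \<in> lk H R i"
    then obtain u v where uv: "q = {u, v}" by (rule lkE)
    obtain p where "p \<in> G" "u \<notin> p" using ns by blast
    then show False using links_bc[OF _ that q] uv by auto
  qed
  then have lk0: "lk H R b = {}" "lk H R c = {}" by auto
  show "e \<in> (H \<inter> triples {a, b, c, d}) \<union> (\<lambda>w. {b, c, w}) ` A \<union> insert d ` G \<union> insert a ` G1 \<union> T"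
    using edge_types[OF e] unfolding G_def G1_def by (simp add: pr0 lk0 pr_bc) blast
qed

lemma card_image_parts:
  "card (insert d ` G) = card G" "card (insert a ` G1) = card G1" "card ((\<lambda>w. {b, c, w}) ` A) = card A"
proof -
  show "card (insert d ` G) = card G" "card (insert a ` G1) = card G1"
    by (rule card_insert_image, use RD in \<open>auto simp: G_def G1_def lk_def\<close>)+
  show "card ((\<lambda>w. {b, c, w}) ` A) = card A"
    by (rule card_image, rule inj_onI) (use RD in \<open>auto simp: A_def doubleton_eq_iff insert_ident\<close>)
qed

lemma nonstar_card:
  assumes ns: "\<And>w. \<exists>p\<in>G. w \<notin> p"
  shows "card H \<le> card (H \<inter> triples {a, b, c, d}) + card A + card G + card G1 + card T"
proof -
  have "card H \<le> card ((H \<inter> triples {a, b, c, d}) \<union> (\<lambda>w. {b, c, w}) ` A \<union> insert d ` G \<union> insert a ` G1 \<union> T)"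
    by (rule card_mono[OF _ nonstar_decomp[OF ns]]) (use finH finA finG finT in simp)
  also have "\<dots> \<le> card (H \<inter> triples {a, b, c, d}) + card ((\<lambda>w. {b, c, w}) ` A) + card (insert d ` G)
      + card (insert a ` G1) + card T"
    by (intro order_trans[OF card_Un_le] add_mono order_refl)
  finally show ?thesis unfolding card_image_parts .
qed

text \<open>\<open>K\<close> consists of the isolated edges of the link graph \<open>G\<close>, \<open>Q\<close> of the vertices of the other
  edges, and \<open>I\<close> of the isolated vertices.\<close>

definition K where "K = {p\<in>G. \<forall>p'\<in>G. p' = p \<or> p' \<inter> p = {}}"
definition Q where "Q = \<Union>(G - K)"
definition I where "I = R - \<Union>G"

lemma G_sub: "p \<in> G \<Longrightarrow> p \<subseteq> R \<and> card p = 2 \<and> finite p \<and> p \<noteq> {}"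
  using finR by (auto simp: G_def lk_def intro: finite_subset)

lemma QK_disj: "Q \<inter> \<Union>K = {}"
  unfolding Q_def K_def by blast

lemma R_split: "card R = card Q + 2 * card K + card I"
proof -
  have sub: "\<Union>G \<subseteq> R" using G_sub by blast
  have "2 * card K = card (\<Union>K)"
  proof (rule card_partition)
    show "finite K" using finG by (simp add: K_def)
    show "finite (\<Union>K)" using sub finR by (rule_tac finite_subset[of _ R]) (auto simp: K_def)
    show "\<And>x. x \<in> K \<Longrightarrow> card x = 2" using G_sub by (simp add: K_def)
    show "\<And>x y. x \<in> K \<Longrightarrow> y \<in> K \<Longrightarrow> x \<noteq> y \<Longrightarrow> x \<inter> y = {}" by (auto simp: K_def)
  qed
  moreover have "\<Union>G = Q \<union> \<Union>K" by (auto simp: Q_def K_def)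
  moreover have "finite (Q \<union> \<Union>K)" using calculation(2) sub finR finite_subset by metis
  ultimately have "card (\<Union>G) = card Q + 2 * card K"
    using card_Un_disjoint[of Q "\<Union>K"] QK_disj by simp
  moreover have "card I = card R - card (\<Union>G)"
    unfolding I_def by (rule card_Diff_subset) (use sub finR finite_subset in auto)
  moreover have "card (\<Union>G) \<le> card R" by (rule card_mono[OF finR sub])
  ultimately show ?thesis by simp
qed

lemma finQI: "finite Q" "finite I" "finite K"
proof -
  have "Q \<subseteq> R" using G_sub by (auto simp: Q_def)
  then show "finite Q" using finR finite_subset by blast
qed (use finR finG in \<open>auto simp: I_def K_def\<close>)

text \<open>A pair of \<open>G1\<close> equals or misses each pair of \<open>G\<close>. If it lies
  in \<open>G\<close> it is isolated there; otherwise it misses \<open>\<Union>G\<close>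
  altogether.\<close>

lemma G1_split: "G1 \<subseteq> K \<union> lk H I a"
proof
  fix q assume q: "q \<in> G1"
  show "q \<in> K \<union> lk H I a"
  proof (cases "q \<in> G")
    case True
    then have "q \<in> K" using links_a_d[OF _ q] by (auto simp: K_def)
    then show ?thesis by simp
  next
    case False
    then have "q \<inter> \<Union>G = {}" using links_a_d[OF _ q] by blast
    then show ?thesis using q by (auto simp: G1_def lk_def I_def)
  qed
qed

definition T3 where "T3 = {t\<in>T. t \<subseteq> Q}"
definition TK where "TK = {(p, i). p \<in> K \<and> i \<in> I \<and> insert i p \<in> T}"

text \<open>A triple meeting a pair \<open>p\<close> of \<open>G\<close> contains it and has one
  further vertex. For \<open>p\<close> in \<open>K\<close> that vertex lies on no pair, since
  another pair would have to fit into the triple beside \<open>p\<close>. Otherwise the triple also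
  contains a neighbouring pair and is the union of the two.\<close>

lemma T_split: "T \<subseteq> (H \<inter> triples I) \<union> (\<lambda>(p, i). insert i p) ` TK \<union> T3"
proof
  fix t assume t: "t \<in> T"
  have tt: "t \<in> H" "t \<subseteq> R" "card t = 3" using t by (auto simp: T_def triples_def)
  show "t \<in> (H \<inter> triples I) \<union> (\<lambda>(p, i). insert i p) ` TK \<union> T3"
  proof (cases "t \<inter> \<Union>G = {}")
    case True
    then have "t \<subseteq> I" using tt by (auto simp: I_def)
    then show ?thesis using tt by (simp add: triples_def)
  next
    case False
    then obtain p where p: "p \<in> G" "p \<subseteq> t" using link_closed[OF _ t] by blast
    have c: "card (t - p) = 1" using G_sub[OF p(1)] p(2) tt(3) by (simp add: card_Diff_subset)
    then obtain i where i: "t - p = {i}" by (auto simp: card_1_singleton_iff)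
    then have ti: "t = insert i p" "i \<notin> p" using p by auto
    show ?thesis
    proof (cases "p \<in> K")
      case True
      have "i \<in> I"
      proof (rule ccontr)
        assume "i \<notin> I"
        then obtain p' where p': "p' \<in> G" "i \<in> p'" using ti tt by (auto simp: I_def)
        then have "p' \<subseteq> t" using link_closed[OF _ t] ti by blast
        moreover have "p' \<inter> p = {}" using True p' ti(2) by (auto simp: K_def)
        ultimately have "p' \<subseteq> {i}" using ti by auto
        then show False using G_sub[OF p'(1)] card_mono[of "{i}" p'] by simp
      qed
      then have "(p, i) \<in> TK" using True ti t by (simp add: TK_def)
      then show ?thesis using ti by force
    next
      case False
      then obtain p' where p': "p' \<in> G" "p' \<noteq> p" "p' \<inter> p \<noteq> {}" using p by (auto simp: K_def)
      then have "p' \<notin> K" using p by (auto simp: K_def)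
      have "p' \<subseteq> t" using link_closed[OF p'(1) t] p' p by blast
      moreover have "\<not> p' \<subseteq> p" using p' G_sub[OF p(1)] G_sub[OF p'(1)] card_subset_eq by metis
      ultimately have "t = p \<union> p'" using ti by auto
      then have "t \<subseteq> Q" using False \<open>p' \<notin> K\<close> p p' by (auto simp: Q_def)
      then show ?thesis using t by (simp add: T3_def)
    qed
  qed
qed

text \<open>A triple of \<open>T3\<close> is a connected component of \<open>G\<close>.\<close>

lemma T3_component:
  assumes "t \<in> T3" "t' \<in> T" "t \<inter> t' \<noteq> {}"
  shows "t \<subseteq> t'"
proof -
  have t: "t \<in> T" "t \<subseteq> Q" "card t = 3" using assms(1) by (auto simp: T3_def T_def triples_def)
  obtain w where w: "w \<in> t" "w \<in> t'" using assms(3) by blast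
  obtain p where p: "p \<in> G" "p \<notin> K" "w \<in> p" using w t by (auto simp: Q_def)
  have pt: "p \<subseteq> t" "p \<subseteq> t'" using link_closed[OF p(1) t(1)] link_closed[OF p(1) assms(2)] w p by blast+
  obtain p' where p': "p' \<in> G" "p' \<noteq> p" "p' \<inter> p \<noteq> {}" using p by (auto simp: K_def)
  have pt': "p' \<subseteq> t" "p' \<subseteq> t'" using link_closed[OF p'(1) t(1)] link_closed[OF p'(1) assms(2)] p' pt by blast+
  have "\<not> p' \<subseteq> p" using p' G_sub[OF p(1)] G_sub[OF p'(1)] card_subset_eq by metis
  moreover have "card (t - p) = 1" using G_sub[OF p(1)] pt t(3) by (simp add: card_Diff_subset)
  then obtain i where i: "t - p = {i}" by (auto simp: card_1_singleton_iff)
  moreover obtain x where "x \<in> p'" "x \<notin> p" using calculation(1) by blast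
  ultimately have "i \<in> p'" using pt' by (metis Diff_iff singletonD subsetD)
  moreover have "t = insert i p" using i pt(1) by auto
  ultimately have "t = p \<union> p'" using pt'(1) by auto
  then show ?thesis using pt pt' by simp
qed

lemma finT3: "finite T3" using finT by (simp add: T3_def)

lemma card_T3: "3 * card T3 \<le> card Q"
proof -
  have "3 * card T3 = card (\<Union>T3)"
  proof (rule card_partition[OF finT3])
    show "finite (\<Union>T3)" by (rule finite_subset[OF _ finQI(1)]) (auto simp: T3_def)
    show "\<And>x. x \<in> T3 \<Longrightarrow> card x = 3" by (auto simp: T3_def T_def triples_def)
    fix x y assume xy: "x \<in> T3" "y \<in> T3" "x \<noteq> y"
    then show "x \<inter> y = {}"
      using T3_component[of x y] T3_component[of y x] by (auto simp: T3_def)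
  qed
  also have "\<dots> \<le> card Q" by (rule card_mono[OF finQI(1)]) (auto simp: T3_def)
  finally show ?thesis .
qed

lemma GK_sub: "G - K \<subseteq> prs Q"
  using G_sub by (auto simp: Q_def)

text \<open>No pair of \<open>G\<close> crosses between a triple \<open>t\<close> of
  \<open>T3\<close> and \<open>Q - t\<close>. This loses \<open>3 * (card Q - 3)\<close> pairs, more
  than the at most \<open>card Q / 3\<close> triples gain.\<close>

lemma card_GK_T3_strict:
  assumes "T3 \<noteq> {}" "card Q \<noteq> 3"
  shows "card (G - K) + card T3 < card Q choose 2"
proof -
  obtain t where t: "t \<in> T3" using assms by auto
  have t': "t \<in> T" "t \<subseteq> Q" "card t = 3" using t by (auto simp: T3_def T_def triples_def)
  have Q4: "card Q \<ge> 4" using assms(2) card_mono[OF finQI(1) t'(2)] t'(3) by simp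
  have "G - K \<subseteq> prs t \<union> prs (Q - t)"
  proof
    fix p assume p: "p \<in> G - K"
    then have "p \<subseteq> t \<or> p \<inter> t = {}" using link_closed[OF _ t'(1)] by blast
    then show "p \<in> prs t \<union> prs (Q - t)" using p GK_sub by auto
  qed
  moreover have ft: "finite t" "finite (Q - t)" using t' finQI finite_subset by auto
  ultimately have "card (G - K) \<le> card (prs t \<union> prs (Q - t))"
    by (intro card_mono) auto
  also have "\<dots> \<le> card (prs t) + card (prs (Q - t))" by (rule card_Un_le)
  also have "\<dots> = 3 + ((card Q - 3) choose 2)"
    unfolding card_pairs[OF ft(1)] card_pairs[OF ft(2)]
    using card_Diff_subset[OF ft(1) t'(2)] t'(3) by (simp add: choose_small)
  finally have "card (G - K) \<le> 3 + ((card Q - 3) choose 2)" .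
  moreover have "card Q choose 2 = 3 + ((card Q - 3) choose 2) + 3 * (card Q - 3)"
    using choose2_add[of 3 "card Q - 3"] Q4 by (simp add: choose_small)
  ultimately show ?thesis using card_T3 Q4 by auto
qed

lemma card_GK_T3: "card (G - K) + card T3 \<le> (card Q choose 2) + (if card Q = 3 then 1 else 0)"
proof -
  have "card (G - K) \<le> card Q choose 2"
    using card_mono[OF finite_prs[OF finQI(1)] GK_sub] card_pairs[OF finQI(1)] by simp
  then show ?thesis using card_GK_T3_strict card_T3 by (cases "T3 = {} \<or> card Q = 3") auto
qed

lemma card_G_split: "card G = card K + card (G - K)"
  using finG card_mono[of G K] by (simp add: K_def card_Diff_subset)

lemma Q_cases: "Q = {} \<or> card Q \<ge> 3"
proof (rule disjCI)
  assume "\<not> 3 \<le> card Q"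
  show "Q = {}"
  proof (rule ccontr)
    assume "Q \<noteq> {}"
    then obtain p where p: "p \<in> G" "p \<notin> K" by (auto simp: Q_def)
    then obtain p' where p': "p' \<in> G" "p' \<noteq> p" "p' \<inter> p \<noteq> {}" by (auto simp: K_def)
    then have "p' \<notin> K" using p by (auto simp: K_def)
    then have "p \<union> p' \<subseteq> Q" using p p' by (auto simp: Q_def)
    moreover have "\<not> p' \<subseteq> p" using p' G_sub[OF p(1)] G_sub[OF p'(1)] card_subset_eq by metis
    then have "card (p \<union> p') > card p"
      using G_sub[OF p(1)] G_sub[OF p'(1)] by (intro psubset_card_mono) auto
    ultimately show False
      using \<open>\<not> 3 \<le> card Q\<close> G_sub[OF p(1)] card_mono[OF finQI(1), of "p \<union> p'"] by simp
  qed
qed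

end

section \<open>Numerical inequalities for clique and star links\<close>

text \<open>The size of a comet with \<open>q\<close> outer vertices stays below \<open>bnd\<close>
  until \<open>q = 9\<close>, order 13, where equality occurs.\<close>

lemma clique_arith_small: "\<forall>q\<in>set [0..<9]. 4 + (q choose 2) < bnd (q + 4) \<or> q \<notin> set [2..<9]"
  by code_simp

text \<open>\<open>k\<close> is the number of pairs in the star and \<open>s = card I\<close>, so
  the order is \<open>k + s + 5\<close>. The two lines are the two cases of
  \<open>star_bound\<close>: 10 is 4 triples of \<open>abcd\<close>, 5 edges at the centre and one
  from \<open>A\<close>; in the other case 6 is 2 triples, 3 edges at the centre and the 1 in
  \<open>card A \<le> k + 1 + s\<close>.\<close>

lemma star_arith_small:
  "\<forall>k\<in>set [0..<8]. \<forall>s\<in>set [0..<8]. k \<ge> 2 \<and> k + s \<in> set [0..<8] \<longrightarrow>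
     10 + k + (if k = 2 then 1 else 0) + exP (s + 1) < bnd (k + s + 5) \<and>
     6 + 2 * k + s + (if k = 2 then 1 else 0) + exP (s + 1) < bnd (k + s + 5)"
  by code_simp

lemma star_arith:
  assumes "k \<ge> 2"
  shows "10 + k + (if k = 2 then 1 else 0) + exP (s + 1) < bnd (k + s + 5)"
    "6 + 2 * k + s + (if k = 2 then 1 else 0) + exP (s + 1) < bnd (k + s + 5)"
proof -
  have "10 + k + (if k = 2 then 1 else 0) + exP (s + 1) < bnd (k + s + 5) \<and>
    6 + 2 * k + s + (if k = 2 then 1 else 0) + exP (s + 1) < bnd (k + s + 5)"
  proof (cases "k + s \<ge> 8")
    case False
    then have "k \<in> set [0..<8]" "s \<in> set [0..<8]" "k + s \<in> set [0..<8]" by auto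
    then show ?thesis using star_arith_small assms by blast
  next
    case True
    define W where "W = k * s"
    have "bnd (k + s + 5) = 4 + ((k + s + 1) choose 2)" using True bnd_13[of "k + s + 5"] by simp
    also have "(k + s + 1) choose 2 = (k choose 2) + (s choose 2) + W + k + s"
      using choose2_add[of "k + s" 1] choose2_add[of k s] by (simp add: W_def choose_small)
    finally have b: "bnd (k + s + 5) = 4 + ((k choose 2) + (s choose 2) + W + k + s)" .
    show ?thesis
    proof (cases "s \<ge> 7")
      case True
      have "W \<ge> 7 * k" "W \<ge> 2 * s" using True assms by (simp_all add: W_def)
      then show ?thesis unfolding b exP_Suc_large[OF True] using True assms by auto
    next
      case False
      obtain j where j: "k = (8 - s) + j" using \<open>k + s \<ge> 8\<close> False le_Suc_ex by (metis le_diff_conv)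
      have "s = 0 \<or> s = 1 \<or> s = 2 \<or> s = 3 \<or> s = 4 \<or> s = 5 \<or> s = 6" using False by presburger
      moreover have "W = s * k" by (simp add: W_def)
      moreover have "k choose 2 = ((8 - s) choose 2) + (j choose 2) + (8 - s) * j"
        unfolding j by (rule choose2_add)
      ultimately show ?thesis unfolding b using j by (elim disjE) (auto simp: exP_small choose_small)
    qed
  qed
  then show "10 + k + (if k = 2 then 1 else 0) + exP (s + 1) < bnd (k + s + 5)"
    "6 + 2 * k + s + (if k = 2 then 1 else 0) + exP (s + 1) < bnd (k + s + 5)" by blast+
qed

lemma prs_insert: "x \<notin> S \<Longrightarrow> prs (insert x S) = (\<lambda>y. {x, y}) ` S \<union> prs S"
proof (intro equalityI subsetI)
  fix p assume x: "x \<notin> S" and p: "p \<in> prs (insert x S)"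
  then obtain u v where uv: "p = {u, v}" "u \<noteq> v" by (auto simp: card_2_iff)
  show "p \<in> (\<lambda>y. {x, y}) ` S \<union> prs S" using p uv x by auto
qed (auto simp: card_insert_if)

lemma triples_insert: "x \<notin> S \<Longrightarrow> triples (insert x S) = insert x ` prs S \<union> triples S"
proof (intro equalityI subsetI)
  fix e assume x: "x \<notin> S" and e: "e \<in> triples (insert x S)"
  have e': "e \<subseteq> insert x S" "card e = 3" "finite e" using e edge_finite[OF e] by (auto simp: triples_def)
  show "e \<in> insert x ` prs S \<union> triples S"
  proof (cases "x \<in> e")
    case True
    then have "e - {x} \<in> prs S" using e' by auto
    moreover have "e = insert x (e - {x})" using True by auto
    ultimately show ?thesis by blast
  next
    case False
    then show ?thesis using e' by (auto simp: triples_def)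
  qed
next
  fix e assume x: "x \<notin> S" and "e \<in> insert x ` prs S \<union> triples S"
  then consider p where "e = insert x p" "p \<subseteq> S" "card p = 2" | "e \<in> triples S" by auto
  then show "e \<in> triples (insert x S)"
  proof cases
    case 1
    then have "finite p" using card.infinite by fastforce
    moreover have "x \<notin> p" using 1 x by auto
    ultimately show ?thesis using 1 by (auto simp: triples_def)
  qed (auto simp: triples_def)
qed

lemma prs_empty: "{p. p = ({} :: nat set) \<and> card p = 2} = {}"
  by auto

lemma triples_empty: "triples {} = {}"
  by (auto simp: triples_def)

lemma triples4:
  assumes "distinct [w, x, y, z]"
  shows "triples {w, x, y, z} = {{x, y, z}, {w, y, z}, {w, x, y}, {w, x, z}}"
  using assms by (simp add: triples_insert prs_insert prs_empty triples_empty)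

section \<open>Bounds when the link of d has several pairs\<close>

context spike
begin

lemma nonstar_sum:
  assumes ns: "\<And>w. \<exists>p\<in>G. w \<notin> p"
    and IH: "\<And>W H'. \<lbrakk>finite W; card W < card V; H' \<subseteq> triples W; pfree H'\<rbrakk> \<Longrightarrow> card H' \<le> exP (card W)"
  shows "card H \<le> card (H \<inter> triples {a, b, c, d}) + card A + card G + card K + card (lk H I a)
    + card (H \<inter> triples I) + card TK + card T3"
    "card TK \<le> card K * card I"
    "card (lk H I a) + card (H \<inter> triples I) \<le> exP (card I + 1)"
proof -
  have fTK: "TK \<subseteq> K \<times> I" by (auto simp: TK_def)
  have finTK: "finite TK" by (rule finite_subset[OF fTK]) (use finQI in simp)
  have "card G1 \<le> card (K \<union> lk H I a)"
    by (rule card_mono[OF _ G1_split]) (use finQI finite_lk in simp)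
  then have g1: "card G1 \<le> card K + card (lk H I a)" using card_Un_le order_trans by blast
  have "card T \<le> card ((H \<inter> triples I) \<union> (\<lambda>(p, i). insert i p) ` TK \<union> T3)"
    by (rule card_mono[OF _ T_split]) (use finH finTK finT3 in simp)
  also have "\<dots> \<le> card (H \<inter> triples I) + card TK + card T3"
    by (intro order_trans[OF card_Un_le] add_mono order_refl card_image_le finTK)
  finally show "card H \<le> card (H \<inter> triples {a, b, c, d}) + card A + card G + card K + card (lk H I a)
    + card (H \<inter> triples I) + card TK + card T3"
    using nonstar_card[OF ns] g1 by linarith
  have "card TK \<le> card (K \<times> I)" by (rule card_mono[OF _ fTK]) (use finQI in simp)
  then show "card TK \<le> card K * card I" by (simp add: card_cartesian_product)
  show "card (lk H I a) + card (H \<inter> triples I) \<le> exP (card I + 1)"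
    by (rule isolated_part[OF _ IH]) (simp add: I_def)
qed

text \<open>Two adjacent pairs span three vertices of \<open>Q\<close>; without adjacent pairs
  \<open>G\<close> is a matching, and a single pair would have a common vertex.\<close>

lemma nonstar_QK:
  assumes ns: "\<And>w. \<exists>p\<in>G. w \<notin> p"
  shows "card Q \<ge> 3 \<or> card Q = 0 \<and> card K \<ge> 2"
proof (cases "Q = {}")
  case True
  then have "G = K" using G_sub by (auto simp: Q_def K_def)
  have "\<not> card K \<le> 1"
  proof
    assume "card K \<le> 1"
    then obtain p where "K \<subseteq> {p}"
      using finQI(3) by (metis One_nat_def card_le_Suc0_iff_eq insertI1 is_singletonI' is_singleton_def empty_subsetI subset_refl)
    then have *: "G \<subseteq> {p}" using \<open>G = K\<close> by simp
    obtain p0 where "p0 \<in> G" using ns by blast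
    then have p: "p \<in> G" using * by auto
    then obtain w where "w \<in> p" using G_sub by fastforce
    then show False using ns[of w] * by auto
  qed
  then show ?thesis using True by simp
next
  case False
  then show ?thesis using Q_cases by blast
qed

text \<open>By \<open>link_meets_A\<close> every pair through \<open>w\<close> meets every pair.
  Choosing a pair that avoids \<open>w\<close>, then one that avoids \<open>u\<close>, closes a
  triangle, and no fourth pair can meet what it has to.\<close>

lemma nonstar_triangle:
  assumes ns: "\<And>w. \<exists>p\<in>G. w \<notin> p" and w: "w \<in> A" "w \<in> \<Union>G"
  shows "K = {}" "card Q = 3"
proof -
  obtain p where p: "p \<in> G" "w \<in> p" using w by blast
  then obtain u where pu: "p = {w, u}" "u \<noteq> w" using G_sub[OF p(1)] by (auto simp: card_2_iff)
  obtain p' where p': "p' \<in> G" "w \<notin> p'" using ns by blast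
  have "u \<in> p'" using link_meets_A[OF p(1) w(1) p(2) p'(1)] pu p' by auto
  then obtain v where pv: "p' = {u, v}" "v \<noteq> u" "v \<noteq> w" using G_sub[OF p'(1)] p'(2) by (auto simp: card_2_iff)
  obtain p'' where p'': "p'' \<in> G" "u \<notin> p''" using ns by blast
  have wp'': "w \<in> p''" using link_meets_A[OF p(1) w(1) p(2) p''(1)] pu p'' by auto
  have "v \<in> p''" using link_meets_A[OF p''(1) w(1) wp'' p'(1)] pv p'' by auto
  then have pw: "p'' = {w, v}" using wp'' G_sub[OF p''(1)] pv by (auto simp: card_2_iff)
  have "h \<in> {p, p', p''}" if h: "h \<in> G" for h
  proof -
    obtain x y where xy: "h = {x, y}" "x \<noteq> y" using G_sub[OF h] by (auto simp: card_2_iff)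
    show ?thesis
    proof (cases "w \<in> h")
      case True
      have "h \<inter> p' \<noteq> {}" by (rule link_meets_A[OF h w(1) True p'(1)])
      then show ?thesis using True xy pu pv pw by auto
    next
      case False
      have "p \<inter> h \<noteq> {}" "p'' \<inter> h \<noteq> {}" using link_meets_A[OF p(1) w(1) p(2) h] link_meets_A[OF p''(1) w(1) wp'' h] by auto
      then show ?thesis using False xy pu pv pw by auto
    qed
  qed
  then have G: "G = {p, p', p''}" using p p' p'' by blast
  have "p \<noteq> p'" "p \<inter> p' \<noteq> {}" "p'' \<noteq> p" "p'' \<inter> p \<noteq> {}" using pu pv pw by auto
  then have ne: "p' \<noteq> p" "p' \<inter> p \<noteq> {}" "p \<inter> p' \<noteq> {}" "p \<noteq> p''" "p \<inter> p'' \<noteq> {}" by auto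
  show K: "K = {}"
  proof (rule equals0I)
    fix h assume "h \<in> K"
    then have h: "h = p \<or> h = p' \<or> h = p''" "p' = h \<or> p' \<inter> h = {}" "p = h \<or> p \<inter> h = {}"
      unfolding K_def G by simp_all
    then show False using ne by metis
  qed
  have "Q = {w, u, v}" unfolding Q_def K G using pu pv pw by auto
  then show "card Q = 3" using pu pv by simp
qed

text \<open>The general count gives 43 here, against a bound of 40. It is improved because a triple that
  extends a pair in \<open>K\<close> by \<open>i\<close> keeps \<open>i\<close> out of the link of \<open>a\<close>.\<close>

lemma nonstar_exceptional:
  assumes ns: "\<And>w. \<exists>p\<in>G. w \<notin> p"
    and IH: "\<And>W H'. \<lbrakk>finite W; card W < card V; H' \<subseteq> triples W; pfree H'\<rbrakk> \<Longrightarrow> card H' \<le> exP (card W)"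
    and c: "card Q = 0" "card K = 2" "card I = 5" "card A \<le> 5"
  shows "card H < 40"
proof -
  note sum = nonstar_sum[OF ns IH]
  have t3: "card T3 = 0" using card_T3 c by simp
  have "card (G - K) = 0" using card_GK_T3 c by (simp add: choose_small)
  then have g: "card G = 2" using card_G_split c by simp
  show ?thesis
  proof (cases "TK = {}")
    case True
    then show ?thesis using sum(1,3) t3 g c card_core by (simp add: exP_small)
  next
    case False
    then obtain p i where pi: "p \<in> K" "i \<in> I" "insert i p \<in> T" by (auto simp: TK_def)
    have p: "p \<in> G" "i \<notin> p" "insert i p \<in> H" using pi by (auto simp: K_def I_def T_def)
    have IR: "I \<subseteq> R" by (auto simp: I_def)
    have "i \<notin> q" if "q \<in> lk H I a" for q
    proof -
      have "q \<in> G1" using that IR by (auto simp: G1_def lk_def)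
      then show ?thesis using triple_avoids_link_a[OF p(1) _ _ p(2,3)] by blast
    qed
    then have "lk H I a \<subseteq> prs (I - {i})" by (auto simp: lk_def)
    then have "card (lk H I a) \<le> card (prs (I - {i}))" by (rule card_mono[rotated]) (use finQI in simp)
    also have "\<dots> = 6" using card_pairs[of "I - {i}"] finQI pi(2) c by (simp add: choose_small)
    finally have l: "card (lk H I a) \<le> 6" .
    have "card (H \<inter> triples I) \<le> card (triples I)"
      by (rule card_mono) (use finQI finite_triples in auto)
    then have "card (H \<inter> triples I) \<le> 10" using card_triples[OF finQI(2)] c by (simp add: choose_small)
    moreover have "card TK \<le> 10" using sum(2) c by simp
    \<comment> \<open>The total is 4 + 5 + 2 + 2 + 6 + 10 + 10 = 39.\<close>
    ultimately show ?thesis using sum(1) t3 g c l card_core by simp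
  qed
qed

text \<open>Equality survives only if \<open>G\<close> has neither isolated pairs nor isolated
  vertices. Then \<open>H\<close> is contained in a comet, and its size forces it to be the whole
  comet.\<close>

lemma nonstar_bound:
  assumes ns: "\<And>w. \<exists>p\<in>G. w \<notin> p"
    and IH: "\<And>W H'. \<lbrakk>finite W; card W < card V; H' \<subseteq> triples W; pfree H'\<rbrakk> \<Longrightarrow> card H' \<le> exP (card W)"
  shows "card H < bnd (card V) \<or> card H = bnd (card V) \<and> 13 \<le> card V \<and> H = triples {a, b, c, d} \<union> insert d ` prs R"
proof -
  note sum = nonstar_sum[OF ns IH]
  have Vc: "card V = card Q + 2 * card K + card I + 4" using cardV R_split by simp
  have q: "card Q \<ge> 3 \<or> card Q = 0 \<and> card K \<ge> 2" by (rule nonstar_QK[OF ns])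
  show ?thesis
  proof (cases "A \<inter> \<Union>G = {}")
    case False
    then obtain w where w: "w \<in> A" "w \<in> \<Union>G" by blast
    note tri = nonstar_triangle[OF ns w]
    have "card A \<le> card R" by (rule card_mono[OF finR]) (auto simp: A_def)
    then have "card A \<le> card I + 3" using R_split tri by simp
    then have "card H \<le> 11 + card I + exP (card I + 1)"
    proof -
      have "card K = 0" "card TK = 0" using tri(1) by (simp_all add: TK_def)
      moreover have "card (G - K) + card T3 \<le> 4" using card_GK_T3 unfolding tri(2) by (simp add: choose_small)
      ultimately show ?thesis
        using \<open>card A \<le> card I + 3\<close> sum(1,3) card_G_split card_core by linarith
    qed
    moreover have "card V = card I + 7" using Vc tri by simp
    ultimately show ?thesis using triangle_arith[of "card I"] by simp
  next
    case True
    then have "A \<subseteq> I" by (auto simp: A_def I_def)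
    then have A: "card A \<le> card I" by (rule card_mono[OF finQI(2)])
    \<comment> \<open>The case at order 13 where the general count exceeds the bound, the candidate
      for the comet, and all sizes for which the general inequality is strict.\<close>
    consider "card Q = 0" "card K = 2" "card I = 5" | "card Q \<ge> 4" "card K = 0" "card I = 0"
      | "\<not> (card Q = 0 \<and> card K = 2 \<and> card I = 5)" "card Q \<ge> 4 \<Longrightarrow> card K + card I > 0" by linarith
    then show ?thesis
    proof cases
      case 1
      then show ?thesis using nonstar_exceptional[OF ns IH] A Vc by (simp add: bnd_small)
    next
      case 3
      have "4 + (card Q choose 2) + (if card Q = 3 then 1 else 0) + card I + 2 * card K + card K * card I
          + exP (card I + 1) < bnd (card V)"
        unfolding Vc by (rule nonstar_arith[OF q 3(2,1)])
      then show ?thesis using sum A card_GK_T3 card_G_split card_core by linarith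
    next
      case 2
      have e: "K = {}" "I = {}" "A = {}" using 2 finQI A finA by simp_all
      have TK0: "TK = {}" by (auto simp: TK_def e)
      have s1: "card H \<le> card (H \<inter> triples {a, b, c, d}) + card (G - K) + card T3"
      proof -
        have "card (lk H I a) + card (H \<inter> triples I) = 0" using sum(3) 2(3) by (simp add: exP_small)
        moreover have "card A = 0" "card TK = 0" using e TK0 by simp_all
        ultimately show ?thesis using sum(1) card_G_split 2(2) by linarith
      qed
      show ?thesis
      proof (cases "card H < bnd (card V)")
        case False
        have "4 + (card Q choose 2) \<ge> card H"
          using s1 card_core card_GK_T3 2 by simp
        with False have b: "bnd (card Q + 4) \<le> 4 + (card Q choose 2)" using Vc 2 by simp
        have q9: "card Q \<ge> 9"
        proof (rule ccontr)
          assume "\<not> ?thesis"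
          then have "card Q \<in> set [0..<9]" "card Q \<in> set [2..<9]" using 2 by auto
          then show False using clique_arith_small b by (meson not_less)
        qed
        have beq: "bnd (card V) = 4 + (card R choose 2)" using bnd_13 Vc q9 cardV by simp
        have RQ: "card R = card Q" using R_split 2 by simp
        have "T3 = {}"
        proof (rule ccontr)
          assume "T3 \<noteq> {}"
          then have "card (G - K) + card T3 < card Q choose 2" by (rule card_GK_T3_strict) (use q9 in simp)
          then show False using False s1 card_core beq RQ by simp
        qed
        have I0: "triples I = {}" "lk H I a = {}" unfolding e(2) lk_def triples_def by auto
        have "T = {}"
          using T_split by (simp only: TK0 \<open>T3 = {}\<close> I0 image_empty Int_empty_right Un_empty_right subset_empty)
        moreover have "G1 = {}" using G1_split by (simp only: e(1) I0(2) Un_empty_right subset_empty)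
        ultimately have "H \<subseteq> (H \<inter> triples {a, b, c, d}) \<union> insert d ` G"
          using nonstar_decomp[OF ns] by (simp only: e image_empty Un_empty_right)
        moreover have "G \<subseteq> prs R" using G_sub by blast
        ultimately have sub: "H \<subseteq> triples {a, b, c, d} \<union> insert d ` prs R"
          by (rule order_trans[OF _ Un_mono[OF Int_lower2 image_mono]])
        have fin: "finite (triples {a, b, c, d} \<union> insert d ` prs R)"
          using finite_triples finR by simp
        have "card (triples {a, b, c, d} \<union> insert d ` prs R) \<le> card (triples {a, b, c, d}) + card (insert d ` prs R)"
          by (rule card_Un_le)
        also have "\<dots> \<le> 4 + card (prs R)"
        proof (rule add_mono)
          have "card {a, b, c, d} = 4" using neq by simp
          then show "card (triples {a, b, c, d}) \<le> 4" by (simp only: card_triples finite.intros choose_small order_refl)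
          show "card (insert d ` prs R) \<le> card (prs R)" by (rule card_image_le) (use finR in simp)
        qed
        also have "\<dots> = bnd (card V)" using beq card_pairs[OF finR] by simp
        finally have le: "card (triples {a, b, c, d} \<union> insert d ` prs R) \<le> bnd (card V)" .
        then have "H = triples {a, b, c, d} \<union> insert d ` prs R"
          by (intro card_seteq[OF fin sub]) (use False le in linarith)
        moreover have "card H \<le> bnd (card V)" using card_mono[OF fin sub] le by linarith
        then have "card H = bnd (card V)" using False by linarith
        ultimately show ?thesis using Vc q9 by simp
      qed simp
    qed
  qed
qed


lemma card_decomp:
  "card H \<le> card (H \<inter> triples {a, b, c, d}) + card (pr a b) + card (pr a c) + card (pr a d) + card A
    + card (pr b d) + card (pr c d) + card G + card G1 + card (lk H R b) + card (lk H R c) + card T"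
proof -
  let ?f = "\<lambda>i j. (\<lambda>w. {i, j, w}) ` pr i j"
  have "H \<subseteq> (H \<inter> triples {a, b, c, d}) \<union> ?f a b \<union> ?f a c \<union> ?f a d \<union> ?f b c \<union> ?f b d \<union> ?f c d
    \<union> insert d ` lk H R d \<union> insert a ` lk H R a \<union> insert b ` lk H R b \<union> insert c ` lk H R c \<union> T" (is "H \<subseteq> ?U")
  proof
    fix e assume "e \<in> H"
    have im: "{i, j, w} \<in> ?f i j" if "w \<in> pr i j" for i j w using that by (rule imageI)
    show "e \<in> ?U"
      using edge_types[OF \<open>e \<in> H\<close>]
      by (elim disjE bexE insertE emptyE) (auto simp: im)
  qed
  then have "card H \<le> card ?U" by (rule card_mono[rotated]) (use finH fin_pr finT finite_lk[OF finR] in simp)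
  also have "\<dots> \<le> card (H \<inter> triples {a, b, c, d}) + card (pr a b) + card (pr a c) + card (pr a d) + card (pr b c)
    + card (pr b d) + card (pr c d) + card (lk H R d) + card (lk H R a) + card (lk H R b) + card (lk H R c) + card T"
    by (intro order_trans[OF card_Un_le] add_mono order_refl card_image_le fin_pr finite_lk[OF finR])
  finally show ?thesis by (simp add: pr_bc G_def G1_def)
qed

text \<open>With two or more pairs through \<open>z\<close>, any vertex common to all pairs is
  \<open>z\<close>, so each pair of \<open>abcd\<close> other than \<open>bc\<close> has at most the
  one edge to \<open>z\<close>. Only \<open>A\<close> can be large, and a member of \<open>A\<close>
  other than \<open>z\<close> pays for this by excluding edges at \<open>a\<close>.\<close>

lemma star_bound:
  assumes z: "\<And>p. p \<in> G \<Longrightarrow> z \<in> p" and k2: "card G \<ge> 2"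
    and IH: "\<And>W H'. \<lbrakk>finite W; card W < card V; H' \<subseteq> triples W; pfree H'\<rbrakk> \<Longrightarrow> card H' \<le> exP (card W)"
  shows "card H < bnd (card V)"
proof -
  define X where "X = \<Union>G - {z}"
  define k where "k = card G"
  have GX: "G = (\<lambda>x. {z, x}) ` X"
  proof
    show "G \<subseteq> (\<lambda>x. {z, x}) ` X"
    proof
      fix p assume p: "p \<in> G"
      then obtain x where "p = {z, x}" "x \<noteq> z" using z[OF p] G_sub[OF p] by (auto simp: card_2_iff)
      then show "p \<in> (\<lambda>x. {z, x}) ` X" using p by (auto simp: X_def)
    qed
    show "(\<lambda>x. {z, x}) ` X \<subseteq> G"
    proof
      fix e assume "e \<in> (\<lambda>x. {z, x}) ` X"
      then obtain x p where x: "e = {z, x}" "x \<noteq> z" "p \<in> G" "x \<in> p" by (auto simp: X_def)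
      then have "p = {z, x}" using z[OF x(3)] G_sub[OF x(3)] by (auto simp: card_2_iff)
      then show "e \<in> G" using x by simp
    qed
  qed
  have zX: "z \<notin> X" by (simp add: X_def)
  have "inj_on (\<lambda>x. {z, x}) X" using zX by (auto simp: inj_on_def doubleton_eq_iff)
  then have cX: "card X = k" unfolding k_def GX by (simp add: card_image)
  have two: "\<exists>p'\<in>G. p' \<noteq> p" for p
  proof (rule ccontr)
    assume "\<not> ?thesis"
    then have "G \<subseteq> {p}" by blast
    then have "card G \<le> 1" using card_mono[of "{p}" G] by simp
    then show False using k2 by simp
  qed
  have K0: "K = {}"
  proof (rule equals0I)
    fix p assume p: "p \<in> K"
    obtain p' where "p' \<in> G" "p' \<noteq> p" using two by blast
    then show False using p z by (auto simp: K_def)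
  qed
  have "X \<noteq> {}" using cX k2 k_def by auto
  then have "Q = insert z X" unfolding Q_def K0 GX by auto
  moreover have "finite X" using cX k2 k_def by (metis card.infinite not_numeral_le_zero)
  ultimately have cQ: "card Q = k + 1" and Qz: "Q = insert z X" using zX cX by simp_all
  have Vc: "card V = k + card I + 5" using cardV R_split K0 cQ by simp
  have zall: "w = z" if "\<And>p. p \<in> G \<Longrightarrow> w \<in> p" for w
  proof -
    obtain p where p: "p \<in> G" using two by blast
    obtain p' where p': "p' \<in> G" "p' \<noteq> p" using two by blast
    then show ?thesis using that[OF p] that[OF p'(1)] p unfolding GX by auto
  qed
  have prz: "pr i j \<subseteq> {z}" if "(i, j) \<in> {(a, b), (a, c), (a, d), (b, d), (c, d)}" for i j
  proof
    fix w assume "w \<in> pr i j"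
    then have w: "w \<in> R" "{i, j, w} \<in> H" by (auto simp: pr_def)
    have "w \<in> p" if p: "p \<in> G" for p
      using \<open>(i, j) \<in> _\<close> pair_with_d[OF p w(1), of i] pair_with_a[OF p w(1), of j] w(2) by (auto simp: insert_commute)
    then show "w \<in> {z}" using zall by simp
  qed
  have pr1: "card (pr i j) \<le> 1" if "(i, j) \<in> {(a, b), (a, c), (a, d), (b, d), (c, d)}" for i j
    using card_mono[OF _ prz[OF that]] by simp
  have prs1: "card (pr a b) \<le> 1" "card (pr a c) \<le> 1" "card (pr a d) \<le> 1" "card (pr b d) \<le> 1" "card (pr c d) \<le> 1"
    by (rule pr1, simp)+
  have lk0: "lk H R i = {}" if "i \<in> {b, c}" for i
  proof (rule equals0I)
    fix q assume q: "q \<in> lk H R i"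
    obtain p where p: "p \<in> G" "p \<noteq> q" using two by blast
    then show False using links_bc[OF p(1) that q] by simp
  qed
  have lk00: "lk H R b = {}" "lk H R c = {}" by (rule lk0, simp)+
  have TK0: "TK = {}" by (simp add: TK_def K0)
  \<comment> \<open>A triple inside \<open>Q\<close> meets a pair, contains it and hence
    \<open>z\<close>, and so contains every pair of the star; it must be all of \<open>Q\<close>,
    which needs \<open>k = 2\<close>.\<close>
  have "T3 \<subseteq> {Q}"
  proof
    fix t assume t: "t \<in> T3"
    have t': "t \<in> T" "t \<subseteq> Q" "t \<noteq> {}" using t by (auto simp: T3_def T_def triples_def)
    then obtain w where w: "w \<in> t" by blast
    then obtain p where p: "p \<in> G" "w \<in> p" using t' by (auto simp: Q_def)
    then have "z \<in> t" using link_closed[OF p(1) t'(1)] w z[OF p(1)] by blast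
    then have "p' \<subseteq> t" if "p' \<in> G" for p' using link_closed[OF that t'(1)] z[OF that] by blast
    then show "t \<in> {Q}" using t'(2) by (auto simp: Q_def)
  qed
  moreover have "k = 2" if "Q \<in> T3"
  proof -
    have "card Q = 3" using that by (auto simp: T3_def T_def triples_def)
    then show ?thesis using cQ by simp
  qed
  ultimately have t3: "card T3 \<le> (if k = 2 then 1 else 0)"
    using card_mono[of "{Q}" T3] by (cases "T3 = {}") auto
  have "card T \<le> card ((H \<inter> triples I) \<union> T3)"
    by (rule card_mono) (use T_split TK0 finH finT3 in auto)
  then have cT: "card T \<le> card (H \<inter> triples I) + card T3" using card_Un_le order_trans by blast
  have cG1: "card G1 \<le> card (lk H I a)"
    by (rule card_mono) (use G1_split K0 finite_lk finQI in auto)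
  have iso: "card (lk H I a) + card (H \<inter> triples I) \<le> exP (card I + 1)"
    by (rule isolated_part[OF _ IH]) (simp add: I_def)
  have main: "card H \<le> card (H \<inter> triples {a, b, c, d}) + card (pr a b) + card (pr a c) + 3 + card A + k
     + (if k = 2 then 1 else 0) + exP (card I + 1)"
    using card_decomp lk00 prs1 t3 cT cG1 iso k_def by simp
  have kk: "k \<ge> 2" using k2 k_def by simp
  show ?thesis
  proof (cases "A \<subseteq> {z}")
    case True
    then have "card A \<le> 1" using card_mono[of "{z}" A] by simp
    then have "card H \<le> 10 + k + (if k = 2 then 1 else 0) + exP (card I + 1)"
      using main card_core prs1 by linarith
    then show ?thesis unfolding Vc using star_arith(1)[OF kk] by (rule le_less_trans)
  next
    case False
    then obtain w where w: "w \<in> A" "w \<noteq> z" by blast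
    \<comment> \<open>Two leaves exist, so one pair \<open>{z, x}\<close> avoids \<open>w\<close>
      and \<open>A_excludes\<close> applies to it.\<close>
    have "\<not> X \<subseteq> {w}" using cX kk card_mono[of "{w}" X] by auto
    then obtain x where x: "x \<in> X" "x \<noteq> w" by blast
    then have p: "{z, x} \<in> G" "w \<notin> {z, x}" using GX w by auto
    have kill: "{a, i, y} \<notin> H" if "i \<in> {b, c}" "y \<in> {d, z, x}" for i y
      using A_excludes[OF p(1) w(1) p(2) that(1)] that(2) by simp
    have "pr a i = {}" if i: "i \<in> {b, c}" for i
    proof -
      have "pr a i \<subseteq> {z}" using prz i by blast
      moreover have "z \<notin> pr a i" using kill[OF i, of z] by (simp add: pr_def)
      ultimately show ?thesis by blast
    qed
    then have p0: "pr a b = {}" "pr a c = {}" by auto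
    have "H \<inter> triples {a, b, c, d} \<subseteq> {{a, b, c}, {b, c, d}}"
      unfolding triples4[OF dist] using kill[of b d] kill[of c d] by auto
    then have "card (H \<inter> triples {a, b, c, d}) \<le> card {{a, b, c}, {b, c, d}}" by (intro card_mono) auto
    also have "\<dots> \<le> 2" by (simp add: card_insert_if)
    finally have core: "card (H \<inter> triples {a, b, c, d}) \<le> 2" .
    have "card A \<le> card R" by (rule card_mono[OF finR]) (auto simp: A_def)
    then have "card A \<le> k + 1 + card I" using R_split K0 cQ by simp
    then have "card H \<le> 6 + 2 * k + card I + (if k = 2 then 1 else 0) + exP (card I + 1)"
      using main core p0 by simp
    then show ?thesis unfolding Vc using star_arith(2)[OF kk] by (rule le_less_trans)
  qed
qed

end

section \<open>The twenty triples of a 6-set and the inequalities for a single pair\<close>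

lemma triples6:
  assumes "distinct [a, b, c, d, u, v]"
  shows "triples {a, b, c, d, u, v} = {{d, u, v}, {c, u, v}, {c, d, u}, {c, d, v}, {b, u, v}, {b, d, u}, {b, d, v},
    {b, c, d}, {b, c, u}, {b, c, v}, {a, u, v}, {a, d, u}, {a, d, v}, {a, c, d}, {a, c, u}, {a, c, v},
    {a, b, c}, {a, b, d}, {a, b, u}, {a, b, v}}"
  using assms by (simp add: triples_insert prs_insert prs_empty triples_empty image_Un Un_assoc)

text \<open>\<open>m\<close> is the number of vertices outside \<open>abcduv\<close>. The constants
  come from 14 or 8 remaining edges inside it and at most one edge from \<open>B\<close>; 6 is 8 + 1
  - 3, with the 3 from \<open>AF_le\<close>. At \<open>m = 7\<close> the last inequality is an
  equality, 40 = 40, and has to be excluded.\<close>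

lemma single_arith_small:
  "\<forall>m\<in>set [0..<8]. \<forall>x\<in>set [0..<8]. x \<le> m \<longrightarrow> 15 + x + exP (m - x) < bnd (m + 6)"
  "\<forall>m\<in>set [0..<8]. 9 + m + exP m < bnd (m + 6) \<and> 9 + 2 * m < bnd (m + 6)"
  "\<forall>m\<in>set [0..<8]. m \<noteq> 7 \<longrightarrow> 6 + 2 * m + exP m < bnd (m + 6)"
  by code_simp+

text \<open>From order 14 on, splitting off a 6-set loses: its at most 20 edges are fewer than
  \<open>4 + 3 * m\<close>.\<close>

lemma bnd_exP: "m \<ge> 8 \<Longrightarrow> bnd (m + 6) = 4 + exP m + 3 * m"
proof -
  assume m: "m \<ge> 8"
  have "bnd (m + 6) = 4 + (((m - 1) + 3) choose 2)" using m bnd_13[of "m + 6"] by (simp add: numeral_eq_Suc)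
  also have "\<dots> = 4 + exP m + 3 * m"
    using choose2_add[of "m - 1" 3] m by (simp add: exP_def choose_small)
  finally show ?thesis .
qed

lemma single_arith:
  "x \<le> m \<Longrightarrow> t \<le> exP (m - x) \<Longrightarrow> t \<le> exP m \<Longrightarrow> 15 + x + t < bnd (m + 6)"
  "9 + m + exP m < bnd (m + 6)" "9 + 2 * m < bnd (m + 6)"
  "m \<noteq> 7 \<Longrightarrow> 6 + 2 * m + exP m < bnd (m + 6)"
proof -
  have m: "m \<ge> 8 \<or> m \<in> set [0..<8]" by auto
  show "9 + m + exP m < bnd (m + 6)" "9 + 2 * m < bnd (m + 6)" "m \<noteq> 7 \<Longrightarrow> 6 + 2 * m + exP m < bnd (m + 6)"
    using m single_arith_small bnd_exP[of m] by auto
  assume x: "x \<le> m" "t \<le> exP (m - x)" "t \<le> exP m"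
  show "15 + x + t < bnd (m + 6)"
  proof (cases "m \<ge> 8")
    case True
    then show ?thesis using x bnd_exP[of m] by simp
  next
    case False
    then have "m \<in> set [0..<8]" "x \<in> set [0..<8]" using x by auto
    then have "15 + x + exP (m - x) < bnd (m + 6)" using single_arith_small(1) x by blast
    then show ?thesis using x by linarith
  qed
qed

section \<open>Links with a single pair\<close>

locale single_spike = spike +
  fixes u v :: nat
  assumes uv: "u \<noteq> v" "G = {{u, v}}" and G1_le: "card G1 \<le> 1"
    and IH: "\<And>W H'. \<lbrakk>finite W; card W < card V; H' \<subseteq> triples W; pfree H'\<rbrakk> \<Longrightarrow> card H' \<le> exP (card W)"
begin

lemma uvG: "{u, v} \<in> G" using uv by simp

lemma duv: "{d, u, v} \<in> H" "u \<in> R" "v \<in> R"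
  using uvG uv unfolding G_def lk_doubleton_iff by auto

lemma dist6: "distinct [a, b, c, d, u, v]"
  using dist uv RD[OF duv(2)] RD[OF duv(3)] by auto

definition C where "C = {a, b, c, d, u, v}"
definition W where "W = R - {u, v}"
text \<open>\<open>A'\<close>, \<open>B\<close>, \<open>F\<close> index the only edges crossing
  between \<open>C\<close> and \<open>W\<close>: \<open>bcw\<close>, \<open>a\<close> with a pair of
  \<open>W\<close>, and \<open>uvw\<close>.\<close>

definition A' where "A' = A \<inter> W"
definition B where "B = {q\<in>G1. q \<subseteq> W}"
definition F where "F = {w\<in>W. {u, v, w} \<in> H}"

lemma W_eq: "W = V - C" by (auto simp: W_def C_def R_def)

lemma C_props: "C \<subseteq> V" "card C = 6"
  using inV duv RD dist6 by (auto simp: C_def)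

lemma cardW: "card V = card W + 6"
proof -
  have "finite C" by (simp add: C_def)
  then show ?thesis
    unfolding W_eq using C_props card_mono[OF finV C_props(1)] by (simp add: card_Diff_subset)
qed

lemma finW: "finite W" using finR by (simp add: W_def)

lemma WD: "w \<in> W \<Longrightarrow> w \<noteq> a \<and> w \<noteq> b \<and> w \<noteq> c \<and> w \<noteq> d \<and> w \<noteq> u \<and> w \<noteq> v \<and> w \<in> R"
  by (auto simp: W_def R_def)

lemma fins: "finite A'" "finite B" "finite F" "finite (H \<inter> triples W)"
  using finA finG finW finH by (simp_all add: A'_def B_def F_def)

lemma coreI: "e \<in> H \<Longrightarrow> e \<subseteq> C \<Longrightarrow> e \<in> H \<inter> triples C"
  using edge_props(2)[OF HV] by (simp add: triples_def)

text \<open>A vertex of \<open>W\<close> is not in the pair \<open>uv\<close>, so it can be joined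
  to no pair of \<open>abcd\<close> but \<open>bc\<close>; a triple in \<open>R\<close> contains or
  avoids \<open>uv\<close>; and a link pair other than \<open>uv\<close> can belong to
  \<open>a\<close> alone and then lies in \<open>W\<close>.\<close>

lemma single_decomp:
  "H \<subseteq> (H \<inter> triples C) \<union> (\<lambda>w. {b, c, w}) ` A' \<union> insert a ` B \<union> (\<lambda>w. {u, v, w}) ` F \<union> (H \<inter> triples W)" (is "H \<subseteq> ?U")
proof
  fix e assume e: "e \<in> H"
  consider "e \<in> triples {a, b, c, d}"
    | i j w where "(i, j) \<in> {(a, b), (a, c), (a, d), (b, c), (b, d), (c, d)}" "w \<in> pr i j" "e = {i, j, w}"
    | i p where "i \<in> {a, b, c, d}" "p \<in> lk H R i" "e = insert i p" | "e \<in> T"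
    using edge_types[OF e] by (elim disjE bexE) auto
  then show "e \<in> ?U"
  proof cases
    case 1
    then have "e \<subseteq> C" by (auto simp: triples_def C_def)
    then show ?thesis using coreI[OF e] by simp
  next
    case 2
    have w: "w \<in> R" "{i, j, w} \<in> H" using 2 by (auto simp: pr_def)
    have ij: "i \<in> C" "j \<in> C" using 2(1) by (auto simp: C_def)
    show ?thesis
    proof (cases "w \<in> {u, v}")
      case True
      then have "e \<subseteq> C" using ij 2(3) by (auto simp: C_def)
      then show ?thesis using coreI[OF e] by simp
    next
      case False
      have "(i, j) = (b, c)"
        using 2(1) False pair_with_d[OF uvG w(1), of i] pair_with_a[OF uvG w(1), of j] w(2) by (auto simp: insert_commute)
      then have "w \<in> A'" using w False by (auto simp: A'_def A_def W_def)
      then show ?thesis using \<open>(i, j) = (b, c)\<close> 2(3) by blast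
    qed
  next
    case 3
    show ?thesis
    proof (cases "p = {u, v}")
      case True
      then have "e \<subseteq> C" using 3 by (auto simp: C_def)
      then show ?thesis using coreI[OF e] by simp
    next
      case False
      have "i \<noteq> d" using 3 False uv(2) by (auto simp: G_def)
      moreover have "i \<noteq> b" "i \<noteq> c" using links_bc[OF uvG, of i p] 3 False by auto
      ultimately have i: "i = a" using 3 by auto
      then have p: "p \<in> G1" using 3 by (simp add: G1_def)
      then have "p \<inter> {u, v} = {}" using links_a_d[OF uvG p] False by blast
      then have "p \<in> B" using p by (auto simp: B_def W_def G1_def lk_def)
      then show ?thesis using 3(3) i by blast
    qed
  next
    case 4
    then have t: "e \<subseteq> R" "card e = 3" by (auto simp: T_def triples_def)
    show ?thesis
    proof (cases "{u, v} \<subseteq> e")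
      case True
      then have "card (e - {u, v}) = 1" using t uv by (simp add: card_Diff_subset)
      then obtain w where w: "e - {u, v} = {w}" by (auto simp: card_1_singleton_iff)
      then have ew: "e = {u, v, w}" using True by auto
      have "w \<in> F" using w t ew e by (auto simp: F_def W_def)
      then show ?thesis using ew by blast
    next
      case False
      then have "e \<inter> {u, v} = {}" using link_closed[OF uvG 4] by blast
      then have "e \<subseteq> W" using t by (auto simp: W_def)
      then show ?thesis using e t by (simp add: triples_def)
    qed
  qed
qed

lemma single_card:
  "card H \<le> card (H \<inter> triples C) + card A' + card B + card F + card (H \<inter> triples W)"
proof -
  have "finite (H \<inter> triples C)" using finH by simp
  then have "card H \<le> card ((H \<inter> triples C) \<union> (\<lambda>w. {b, c, w}) ` A' \<union> insert a ` B \<union> (\<lambda>w. {u, v, w}) ` F \<union> (H \<inter> triples W))"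
    by (intro card_mono[OF _ single_decomp]) (use fins in simp)
  also have "\<dots> \<le> card (H \<inter> triples C) + card A' + card B + card F + card (H \<inter> triples W)"
    by (intro order_trans[OF card_Un_le] add_mono order_refl card_image_le fins)
  finally show ?thesis .
qed

lemma core_le:
  assumes "H \<inter> triples C \<subseteq> set xs"
  shows "card (H \<inter> triples C) \<le> length xs"
  using card_mono[OF _ assms] card_length[of xs] by simp

lemma core_cases:
  assumes "e \<in> H \<inter> triples C"
  shows "e \<in> H" "e \<in> {{d, u, v}, {c, u, v}, {c, d, u}, {c, d, v}, {b, u, v}, {b, d, u}, {b, d, v},
    {b, c, d}, {b, c, u}, {b, c, v}, {a, u, v}, {a, d, u}, {a, d, v}, {a, c, d}, {a, c, u}, {a, c, v},
    {a, b, c}, {a, b, d}, {a, b, u}, {a, b, v}}"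
  using assms unfolding C_def triples6[OF dist6] by simp_all

text \<open>Either kind of crossing edge excludes the same six edges \<open>aiy\<close>, with
  \<open>i\<close> in \<open>bc\<close> and \<open>y\<close> in \<open>duv\<close>, as the middle of
  a path ending in \<open>duv\<close>.\<close>

lemma kill_AB:
  assumes "A' \<noteq> {} \<or> B \<noteq> {}"
  shows "{a, b, d} \<notin> H" "{a, b, u} \<notin> H" "{a, b, v} \<notin> H" "{a, c, d} \<notin> H" "{a, c, u} \<notin> H" "{a, c, v} \<notin> H"
proof -
  have *: "{a, i, y} \<notin> H" if iy: "i \<in> {b, c}" "y \<in> {d, u, v}" for i y
  proof (cases "A' = {}")
    case False
    then obtain w where "w \<in> A" "w \<notin> {u, v}" using WD by (auto simp: A'_def)
    then show ?thesis using A_excludes[OF uvG _ _ iy(1), of w y] iy(2) by simp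
  next
    case True
    then obtain q where "q \<in> G1" "q \<subseteq> W" using assms by (auto simp: B_def)
    then have "q \<inter> {u, v} = {}" using WD by blast
    then show ?thesis using link_a_excludes[OF uvG \<open>q \<in> G1\<close> _ iy(1), of y] iy(2) by simp
  qed
  show "{a, b, d} \<notin> H" "{a, b, u} \<notin> H" "{a, b, v} \<notin> H" "{a, c, d} \<notin> H" "{a, c, u} \<notin> H" "{a, c, v} \<notin> H"
    by (rule *; simp)+
qed

text \<open>The edge \<open>idy\<close> would be the middle of the path \<open>uvw\<close>,
  \<open>idy\<close>, \<open>abc\<close>. These six edges are disjoint as a set from the six of
  \<open>kill_AB\<close>, so both together leave 8 of 20.\<close>

lemma kill_F:
  assumes "F \<noteq> {}"
  shows "{a, d, u} \<notin> H" "{b, d, u} \<notin> H" "{c, d, u} \<notin> H" "{a, d, v} \<notin> H" "{b, d, v} \<notin> H" "{c, d, v} \<notin> H"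
proof -
  obtain w where w: "w \<in> W" "{u, v, w} \<in> H" using assms by (auto simp: F_def)
  have *: "{i, d, y} \<notin> H" if iy: "i \<in> {a, b, c}" "y \<in> {u, v}" for i y
  proof
    assume "{i, d, y} \<in> H"
    then show False
      by (rule pfreeD[OF pf w(2) _ abc, of _ y i]) (use iy dist6 WD[OF w(1)] in auto)
  qed
  show "{a, d, u} \<notin> H" "{b, d, u} \<notin> H" "{c, d, u} \<notin> H" "{a, d, v} \<notin> H" "{b, d, v} \<notin> H" "{c, d, v} \<notin> H"
    by (rule *; simp)+
qed

lemma core_AB:
  assumes "A' \<noteq> {} \<or> B \<noteq> {}"
  shows "card (H \<inter> triples C) \<le> 14"
proof -
  have "H \<inter> triples C \<subseteq> set [{a, b, c}, {a, d, u}, {a, d, v}, {a, u, v}, {b, c, d}, {b, c, u}, {b, c, v}, {b, d, u}, {b, d, v},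
    {b, u, v}, {c, d, u}, {c, d, v}, {c, u, v}, {d, u, v}]"
  proof
    fix e assume "e \<in> H \<inter> triples C"
    from core_cases(2)[OF this] core_cases(1)[OF this]
    show "e \<in> set [{a, b, c}, {a, d, u}, {a, d, v}, {a, u, v}, {b, c, d}, {b, c, u}, {b, c, v}, {b, d, u}, {b, d, v},
      {b, u, v}, {c, d, u}, {c, d, v}, {c, u, v}, {d, u, v}]"
      by (elim insertE emptyE) (simp_all add: kill_AB[OF assms])
  qed
  from core_le[OF this] show ?thesis by simp
qed

lemma core_F:
  assumes "F \<noteq> {}"
  shows "card (H \<inter> triples C) \<le> 14"
proof -
  have "H \<inter> triples C \<subseteq> set [{a, b, c}, {a, b, d}, {a, b, u}, {a, b, v}, {a, c, d}, {a, c, u},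
    {a, c, v}, {a, u, v}, {b, c, d}, {b, c, u}, {b, c, v}, {b, u, v}, {c, u, v}, {d, u, v}]"
  proof
    fix e assume "e \<in> H \<inter> triples C"
    from core_cases(2)[OF this] core_cases(1)[OF this]
    show "e \<in> set [{a, b, c}, {a, b, d}, {a, b, u}, {a, b, v}, {a, c, d}, {a, c, u},
      {a, c, v}, {a, u, v}, {b, c, d}, {b, c, u}, {b, c, v}, {b, u, v}, {c, u, v}, {d, u, v}]"
      by (elim insertE emptyE) (simp_all add: kill_F[OF assms])
  qed
  from core_le[OF this] show ?thesis by simp
qed

lemma core_ABF:
  assumes "A' \<noteq> {} \<or> B \<noteq> {}" "F \<noteq> {}"
  shows "card (H \<inter> triples C) \<le> 8"
proof -
  have "H \<inter> triples C \<subseteq> set [{a, b, c}, {a, u, v}, {b, c, d}, {b, c, u}, {b, c, v}, {b, u, v}, {c, u, v}, {d, u, v}]"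
  proof
    fix e assume "e \<in> H \<inter> triples C"
    from core_cases(2)[OF this] core_cases(1)[OF this]
    show "e \<in> set [{a, b, c}, {a, u, v}, {b, c, d}, {b, c, u}, {b, c, v}, {b, u, v}, {c, u, v}, {d, u, v}]"
      by (elim insertE emptyE) (simp_all add: kill_AB[OF assms(1)] kill_F[OF assms(2)])
  qed
  from core_le[OF this] show ?thesis by simp
qed

text \<open>Here \<open>bcw\<close> is the middle of the path \<open>t\<close>, \<open>bcw\<close>,
  \<open>e\<close> for every edge \<open>e\<close> inside \<open>C\<close> with exactly one of
  \<open>b\<close>, \<open>c\<close>. There are 12 such triples among the 20.\<close>

lemma core_touch_A:
  assumes "w \<in> A'" "t \<in> H \<inter> triples W" "w \<in> t"
  shows "card (H \<inter> triples C) \<le> 8"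
proof -
  have t: "t \<in> H" "t \<subseteq> W" using assms(2) by (auto simp: triples_def)
  have nt: "a \<notin> t" "b \<notin> t" "c \<notin> t" "d \<notin> t" "u \<notin> t" "v \<notin> t" using t WD by blast+
  have w: "{b, c, w} \<in> H" "w \<in> W" using assms(1) by (auto simp: A'_def A_def)
  have *: "e \<notin> H" if "e \<inter> {b, c} = {i}" "e \<subseteq> C" for e i
  proof
    assume "e \<in> H"
    then show False
      by (rule pfreeD[OF pf t(1) w(1), of _ w i])
         (use that nt WD[OF w(2)] assms(3) in \<open>auto simp: C_def\<close>)
  qed
  have k: "{a, b, d} \<notin> H" "{a, b, u} \<notin> H" "{a, b, v} \<notin> H" "{b, d, u} \<notin> H" "{b, d, v} \<notin> H" "{b, u, v} \<notin> H"
    by (rule *[of _ b]; use dist6 in \<open>auto simp: C_def\<close>)+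
  have k': "{a, c, d} \<notin> H" "{a, c, u} \<notin> H" "{a, c, v} \<notin> H" "{c, d, u} \<notin> H" "{c, d, v} \<notin> H" "{c, u, v} \<notin> H"
    by (rule *[of _ c]; use dist6 in \<open>auto simp: C_def\<close>)+
  have "H \<inter> triples C \<subseteq> set [{a, b, c}, {a, d, u}, {a, d, v}, {a, u, v}, {b, c, d}, {b, c, u}, {b, c, v}, {d, u, v}]"
  proof
    fix e assume "e \<in> H \<inter> triples C"
    from core_cases(2)[OF this] core_cases(1)[OF this]
    show "e \<in> set [{a, b, c}, {a, d, u}, {a, d, v}, {a, u, v}, {b, c, d}, {b, c, u}, {b, c, v}, {d, u, v}]"
      by (elim insertE emptyE) (simp_all add: k k')
  qed
  from core_le[OF this] show ?thesis by simp
qed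

text \<open>The same with \<open>uvw\<close> as the middle edge, excluding the 12 triples with
  exactly one of \<open>u\<close>, \<open>v\<close>.\<close>

lemma core_touch_F:
  assumes "w \<in> F" "t \<in> H \<inter> triples W" "w \<in> t"
  shows "card (H \<inter> triples C) \<le> 8"
proof -
  have t: "t \<in> H" "t \<subseteq> W" using assms(2) by (auto simp: triples_def)
  have nt: "a \<notin> t" "b \<notin> t" "c \<notin> t" "d \<notin> t" "u \<notin> t" "v \<notin> t" using t WD by blast+
  have w: "{u, v, w} \<in> H" "w \<in> W" using assms(1) by (auto simp: F_def)
  have *: "e \<notin> H" if "e \<inter> {u, v} = {i}" "e \<subseteq> C" for e i
  proof
    assume "e \<in> H"
    then show False
      by (rule pfreeD[OF pf t(1) w(1), of _ w i])
         (use that nt WD[OF w(2)] assms(3) in \<open>auto simp: C_def\<close>)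
  qed
  have k: "{a, b, u} \<notin> H" "{a, c, u} \<notin> H" "{a, d, u} \<notin> H" "{b, c, u} \<notin> H" "{b, d, u} \<notin> H" "{c, d, u} \<notin> H"
    by (rule *[of _ u]; use dist6 in \<open>auto simp: C_def\<close>)+
  have k': "{a, b, v} \<notin> H" "{a, c, v} \<notin> H" "{a, d, v} \<notin> H" "{b, c, v} \<notin> H" "{b, d, v} \<notin> H" "{c, d, v} \<notin> H"
    by (rule *[of _ v]; use dist6 in \<open>auto simp: C_def\<close>)+
  have "H \<inter> triples C \<subseteq> set [{a, b, c}, {a, b, d}, {a, c, d}, {b, c, d}, {a, u, v}, {b, u, v}, {c, u, v}, {d, u, v}]"
  proof
    fix e assume "e \<in> H \<inter> triples C"
    from core_cases(2)[OF this] core_cases(1)[OF this]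
    show "e \<in> set [{a, b, c}, {a, b, d}, {a, c, d}, {b, c, d}, {a, u, v}, {b, u, v}, {c, u, v}, {d, u, v}]"
      by (elim insertE emptyE) (simp_all add: k k')
  qed
  from core_le[OF this] show ?thesis by simp
qed

text \<open>Otherwise \<open>uvx\<close>, \<open>t\<close>, \<open>bcx'\<close> is a copy of
  \<open>P\<close>.\<close>

lemma touch_both:
  assumes "x \<in> F" "x' \<in> A'" "t \<in> H \<inter> triples W" "x \<in> t" "x' \<in> t"
  shows "x = x'"
proof (rule ccontr)
  assume ne: "x \<noteq> x'"
  have t: "t \<in> H" "t \<subseteq> W" using assms(3) by (auto simp: triples_def)
  have nt: "b \<notin> t" "c \<notin> t" "u \<notin> t" "v \<notin> t" using t WD by blast+
  have x: "{u, v, x} \<in> H" "x \<in> W" using assms(1) by (auto simp: F_def)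
  have x': "{b, c, x'} \<in> H" "x' \<in> W" using assms(2) by (auto simp: A'_def A_def)
  show False
    by (rule pfreeD[OF pf x(1) t(1) x'(1), of x x'])
       (use ne nt WD[OF x(2)] WD[OF x'(2)] assms(4,5) dist6 in auto)
qed

text \<open>On the three vertices of \<open>t\<close> the sets \<open>A'\<close> and
  \<open>F\<close> have at most three incidences: if both meet \<open>t\<close>, they do so in one
  common vertex. Off \<open>t\<close> each has at most \<open>card W - 3\<close> elements.\<close>

lemma AF_le:
  assumes "t \<in> H \<inter> triples W"
  shows "card A' + card F + 3 \<le> 2 * card W"
proof -
  have t: "t \<subseteq> W" "card t = 3" "finite t" using assms edge_finite[of t W] by (auto simp: triples_def)
  have sum: "card (A' \<inter> t) + card (F \<inter> t) \<le> 3"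
  proof (cases "A' \<inter> t = {} \<or> F \<inter> t = {}")
    case True
    have "card (A' \<inter> t) \<le> 3" "card (F \<inter> t) \<le> 3" using card_mono[OF t(3), of "_ \<inter> t"] t(2) by auto
    then show ?thesis using True by auto
  next
    case False
    then obtain x where x: "x \<in> F" "x \<in> t" by blast
    then have "A' \<inter> t \<subseteq> {x}" using touch_both[OF _ _ assms] by blast
    moreover have "F \<inter> t \<subseteq> {x}"
    proof -
      obtain x' where "x' \<in> A'" "x' \<in> t" using False by blast
      then show ?thesis using touch_both[OF _ _ assms] x by blast
    qed
    ultimately show ?thesis using card_mono[of "{x}" "A' \<inter> t"] card_mono[of "{x}" "F \<inter> t"] by simp
  qed
  have part: "card S \<le> card (S \<inter> t) + (card W - 3)" if S: "S \<subseteq> W" for S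
  proof -
    have "S \<subseteq> (S \<inter> t) \<union> (W - t)" using S by blast
    then have "card S \<le> card ((S \<inter> t) \<union> (W - t))" by (rule card_mono[rotated]) (use finW t in simp)
    also have "\<dots> \<le> card (S \<inter> t) + card (W - t)" by (rule card_Un_le)
    also have "card (W - t) = card W - 3" using t by (simp add: card_Diff_subset)
    finally show ?thesis .
  qed
  have "card A' \<le> card (A' \<inter> t) + (card W - 3)" "card F \<le> card (F \<inter> t) + (card W - 3)"
    by (rule part, auto simp: A'_def F_def)+
  moreover have "card W \<ge> 3" using card_mono[OF finW t(1)] t(2) by simp
  ultimately show ?thesis using sum by linarith
qed

lemma TW_avoid:
  assumes "S \<subseteq> W" "\<And>t. t \<in> H \<inter> triples W \<Longrightarrow> t \<inter> S = {}"
  shows "card (H \<inter> triples W) \<le> exP (card W - card S)"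
proof -
  have "card (H \<inter> triples W) \<le> exP (card (W - S))"
  proof (rule IH)
    have "card (W - S) \<le> card W" by (rule card_mono[OF finW]) auto
    then show "card (W - S) < card V" using cardW by simp
    show "H \<inter> triples W \<subseteq> triples (W - S)"
      using assms(2) by (auto simp: triples_def)
  qed (use finW pfree_subset[OF pf] in auto)
  then show ?thesis using card_Diff_subset[OF finite_subset[OF assms(1) finW] assms(1)] by simp
qed

lemma TW_le: "card (H \<inter> triples W) \<le> exP (card W)"
  using TW_avoid[of "{}"] by simp

lemma link_a_closed:
  assumes "q \<in> G1" "t \<in> T"
  shows "q \<subseteq> t \<or> q \<inter> t = {}"
proof -
  interpret s: spike V H d b c a by (rule swap)
  have "s.R = R" by (auto simp: s.R_def R_def)
  then have "q \<in> s.G" "t \<in> s.T" using assms by (simp_all add: s.G_def s.T_def G1_def T_def)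
  then show ?thesis by (rule s.link_closed)
qed

text \<open>Every triple in \<open>W\<close> contains or avoids the pair \<open>q\<close> joined to
  \<open>a\<close>: at most 5 of the first kind and 10 of the second. This improves the Turan number
  20 in the tight case.\<close>

lemma TW_le_B:
  assumes "B \<noteq> {}" "card W = 7"
  shows "card (H \<inter> triples W) \<le> 15"
proof -
  obtain q where q: "q \<in> G1" "q \<subseteq> W" using assms by (auto simp: B_def)
  have cq: "card q = 2" "finite q" using q finW finite_subset by (auto simp: G1_def lk_def)
  have "H \<inter> triples W \<subseteq> (\<lambda>i. insert i q) ` (W - q) \<union> triples (W - q)"
  proof
    fix t assume "t \<in> H \<inter> triples W"
    then have t: "t \<in> T" "t \<subseteq> W" "card t = 3" by (auto simp: T_def triples_def W_def)
    show "t \<in> (\<lambda>i. insert i q) ` (W - q) \<union> triples (W - q)"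
    proof (cases "q \<subseteq> t")
      case True
      then have "card (t - q) = 1" using t cq by (simp add: card_Diff_subset)
      then obtain i where i: "t - q = {i}" by (auto simp: card_1_singleton_iff)
      then have "t = insert i q" "i \<in> W - q" using True t by auto
      then show ?thesis by blast
    next
      case False
      then have "q \<inter> t = {}" using link_a_closed[OF q(1) t(1)] by blast
      then show ?thesis using t by (auto simp: triples_def)
    qed
  qed
  then have "card (H \<inter> triples W) \<le> card ((\<lambda>i. insert i q) ` (W - q) \<union> triples (W - q))"
    by (rule card_mono[rotated]) (use finW finite_triples in simp)
  also have "\<dots> \<le> card (W - q) + card (triples (W - q))"
    by (intro order_trans[OF card_Un_le] add_mono order_refl card_image_le) (use finW in simp)
  also have "\<dots> = 15"
    using card_triples[of "W - q"] finW card_Diff_subset[OF cq(2) q(2)] assms(2) cq(1) by (simp add: choose_small)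
  finally show ?thesis .
qed

text \<open>Without crossing edges \<open>C\<close> is separated. Otherwise either a triple in
  \<open>W\<close> touches a crossing edge, which reduces the edges in \<open>C\<close> to 8, or the
  touched vertices are lost for triples in \<open>W\<close>.\<close>

lemma single_bound:
  "card H < bnd (card V) \<or> H \<subseteq> triples C \<union> triples (V - C)"
proof -
  have AW: "card A' \<le> card W" "card F \<le> card W"
    by (rule card_mono[OF finW], auto simp: A'_def F_def)+
  have B1: "card B \<le> 1"
    using card_mono[OF finG(2), of B] G1_le by (auto simp: B_def)
  consider (none) "A' = {}" "B = {}" "F = {}" | (AB) "A' \<noteq> {} \<or> B \<noteq> {}" "F = {}"
    | (F) "A' = {}" "B = {}" "F \<noteq> {}" | (both) "A' \<noteq> {} \<or> B \<noteq> {}" "F \<noteq> {}" by blast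
  then show ?thesis
  proof cases
    case none
    then show ?thesis using single_decomp unfolding W_eq by auto
  next
    case AB
    have "card H < bnd (card W + 6)"
    proof (cases "\<exists>t\<in>H \<inter> triples W. t \<inter> A' \<noteq> {}")
      case True
      then have "card (H \<inter> triples C) \<le> 8" using core_touch_A by blast
      then have "card H \<le> 9 + card W + exP (card W)"
        using single_card AB(2) AW B1 TW_le by simp
      then show ?thesis using single_arith(2)[of "card W"] by linarith
    next
      case False
      then have "card (H \<inter> triples W) \<le> exP (card W - card A')"
        by (intro TW_avoid) (auto simp: A'_def)
      then have "15 + card A' + card (H \<inter> triples W) < bnd (card W + 6)"
        by (intro single_arith(1) AW TW_le)
      then show ?thesis using single_card AB(2) core_AB[OF AB(1)] B1 by simp
    qed
    then show ?thesis using cardW by simp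
  next
    case F
    have "card H < bnd (card W + 6)"
    proof (cases "\<exists>t\<in>H \<inter> triples W. t \<inter> F \<noteq> {}")
      case True
      then have "card (H \<inter> triples C) \<le> 8" using core_touch_F by blast
      then have "card H \<le> 9 + card W + exP (card W)"
        using single_card F(1,2) AW TW_le by simp
      then show ?thesis using single_arith(2)[of "card W"] by linarith
    next
      case False
      then have "card (H \<inter> triples W) \<le> exP (card W - card F)"
        by (intro TW_avoid) (auto simp: F_def)
      then have "15 + card F + card (H \<inter> triples W) < bnd (card W + 6)"
        by (intro single_arith(1) AW TW_le)
      then show ?thesis using single_card F(1,2) core_F[OF F(3)] by simp
    qed
    then show ?thesis using cardW by simp
  next
    case both
    note core = core_ABF[OF both]
    have "card H < bnd (card W + 6)"
    proof (cases "H \<inter> triples W = {}")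
      case True
      then have "card (H \<inter> triples W) = 0" by simp
      then have "card H \<le> 9 + 2 * card W" using single_card core AW B1 by linarith
      then show ?thesis using single_arith(3)[of "card W"] by linarith
    next
      case False
      then obtain t where "t \<in> H \<inter> triples W" by blast
      note AF = AF_le[OF this]
      show ?thesis
      \<comment> \<open>At 7 outer vertices the general count gives 40, the bound itself. Without
        \<open>B\<close> the count is 8 + 11 + 20 = 39; with \<open>B\<close> the 20 drops to
        15.\<close>
      proof (cases "card W = 7")
        case False
        have "card H \<le> 6 + 2 * card W + exP (card W)" using single_card core AF B1 TW_le by linarith
        then show ?thesis using single_arith(4)[OF False] by linarith
      next
        case True
        have "card H \<le> 39"
        proof (cases "B = {}")
          case B: True
          have "card (H \<inter> triples W) \<le> 20" using TW_le True by (simp add: exP_small)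
          moreover have "card B = 0" using B by simp
          ultimately show ?thesis using single_card core AF True by linarith
        next
          case B: False
          then show ?thesis using single_card core AF TW_le_B[OF B True] B1 True by linarith
        qed
        then show ?thesis using True by (simp add: bnd_small)
      qed
    qed
    then show ?thesis using cardW by simp
  qed
qed

end

section \<open>The Turan number and its conditional version\<close>

definition split_clique :: "nat set \<Rightarrow> nat set set \<Rightarrow> bool" where
  "split_clique V H \<longleftrightarrow> (\<exists>C\<subseteq>V. card C = 6 \<and> H = triples C \<union> triples (V - C))"

definition two_cliques :: "nat set \<Rightarrow> nat set set \<Rightarrow> bool" where
  "two_cliques V H \<longleftrightarrow> (\<exists>C C'. C \<subseteq> V \<and> C' \<subseteq> V \<and> C \<inter> C' = {} \<and> card C = 6 \<and> card C' = 6 \<and> H = triples C \<union> triples C')"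

text \<open>Here \<open>d\<close> is the centre and \<open>a\<close>, \<open>b\<close>,
  \<open>c\<close> are the three special vertices, as the comet arises from the link of
  \<open>d\<close>.\<close>

definition comet_on :: "nat set \<Rightarrow> nat set set \<Rightarrow> bool" where
  "comet_on V H \<longleftrightarrow> (\<exists>a b c d. distinct [a, b, c, d] \<and> {a, b, c, d} \<subseteq> V \<and>
     H = triples {a, b, c, d} \<union> insert d ` prs (V - {a, b, c, d}))"

definition extremal :: "nat set \<Rightarrow> nat set set \<Rightarrow> bool" where
  "extremal V H \<longleftrightarrow> card V \<le> 12 \<and> split_clique V H \<or> card V = 13 \<and> two_cliques V H \<or> 13 \<le> card V \<and> comet_on V H"

lemma card_separated:
  assumes "finite V" "C \<subseteq> V" "card C = 6" "H \<subseteq> triples C \<union> triples (V - C)"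
  shows "card H \<le> card (H \<inter> triples C) + card (H \<inter> triples (V - C))" "card (H \<inter> triples C) \<le> 20"
    "card V = card (V - C) + 6"
proof -
  have finC: "finite C" using assms(1,2) finite_subset by blast
  have "H = (H \<inter> triples C) \<union> (H \<inter> triples (V - C))" using assms(4) by blast
  then show "card H \<le> card (H \<inter> triples C) + card (H \<inter> triples (V - C))" by (metis card_Un_le)
  show "card (H \<inter> triples C) \<le> 20"
    using card_mono[OF finite_triples[OF finC], of "H \<inter> triples C"] card_triples[OF finC] assms(3)
    by (simp add: choose_small)
  show "card V = card (V - C) + 6"
    using card_Diff_subset[OF finC assms(2)] card_mono[OF assms(1,2)] assms(3) by simp
qed

text \<open>Up to order 12 both parts may be complete. At 13 the outer part has 7 vertices and at
  most 20 edges, and \<open>IH7\<close> identifies equality. From 14 on \<open>bnd_exP\<close> makes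
  the inequality strict.\<close>

lemma separated_bound:
  assumes V: "finite V" "C \<subseteq> V" "card C = 6" "H \<subseteq> triples C \<union> triples (V - C)" "pfree H"
    and IH: "\<And>W H'. \<lbrakk>finite W; card W < card V; H' \<subseteq> triples W; pfree H'\<rbrakk> \<Longrightarrow> card H' \<le> exP (card W)"
    and IH7: "\<And>W H'. \<lbrakk>finite W; card W < card V; H' \<subseteq> triples W; pfree H'; card W = 7; card H' = 20\<rbrakk> \<Longrightarrow> split_clique W H'"
  shows "card H < bnd (card V) \<or> card H = bnd (card V) \<and> extremal V H"
proof -
  note sep = card_separated[OF V(1-4)]
  have finC: "finite C" "finite (V - C)" using V(1,2) finite_subset by auto
  have W: "card (V - C) < card V" using sep(3) by simp
  have HW: "card (H \<inter> triples (V - C)) \<le> exP (card (V - C))"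
    by (rule IH[OF finC(2) W]) (use pfree_subset[OF V(5)] in auto)
  consider "card V \<le> 12" | "card V = 13" | "card V \<ge> 14" by linarith
  then show ?thesis
  proof cases
    case 1
    have fin: "finite (triples C \<union> triples (V - C))" using finC finite_triples by simp
    have "triples C \<inter> triples (V - C) = {}" by (auto simp: triples_Int) (auto simp: triples_def)
    then have c: "card (triples C \<union> triples (V - C)) = bnd (card V)"
      using card_Un_disjoint[of "triples C" "triples (V - C)"] finC finite_triples card_triples V(3) sep(3) 1
      by (simp add: bnd_def choose_small)
    show ?thesis
    proof (cases "card H < bnd (card V)")
      case False
      then have "H = triples C \<union> triples (V - C)" using c by (intro card_seteq[OF fin V(4)]) simp
      moreover then have "split_clique V H" unfolding split_clique_def using V(2,3) by blast
      ultimately show ?thesis using c 1 by (simp add: extremal_def)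
    qed simp
  next
    case 2
    then have 7: "card (V - C) = 7" using sep(3) by simp
    show ?thesis
    proof (cases "card H < bnd (card V)")
      case False
      then have eq: "card H \<ge> 40" using 2 by (simp add: bnd_small)
      have "card (H \<inter> triples (V - C)) \<le> 20" using HW 7 by (simp add: exP_small)
      then have 20: "card (H \<inter> triples (V - C)) = 20" "card (H \<inter> triples C) = 20" and H40: "card H = 40"
        using sep eq by linarith+
      have "H \<inter> triples C = triples C"
        by (rule card_subset_eq[OF finite_triples[OF finC(1)]]) (use 20 card_triples finC V(3) in \<open>simp_all add: choose_small\<close>)
      moreover have "split_clique (V - C) (H \<inter> triples (V - C))"
        by (rule IH7[OF finC(2) W _ _ 7 20(1)]) (use pfree_subset[OF V(5)] in auto)
      then obtain S where S: "S \<subseteq> V - C" "card S = 6" "H \<inter> triples (V - C) = triples S \<union> triples (V - C - S)"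
        unfolding split_clique_def by blast
      have "card (V - C - S) = 1"
        using card_Diff_subset[OF finite_subset[OF S(1) finC(2)] S(1)] S(2) 7 by simp
      \<comment> \<open>The seventh outer vertex is isolated, so only the second \<open>K6\<close>
        remains.\<close>
      then have "triples (V - C - S) = {}"
        by (auto simp: card_1_singleton_iff triples_def dest!: card_mono[rotated])
      then have "H \<inter> triples (V - C) = triples S" using S(3) by simp
      ultimately have "H = triples C \<union> triples S" using V(4) by blast
      moreover have "S \<subseteq> V" "C \<inter> S = {}" using S(1) by blast+
      ultimately have "two_cliques V H" unfolding two_cliques_def using V(2,3) S(2) by blast
      then show ?thesis using 2 H40 by (simp add: bnd_small extremal_def)
    qed simp
  next
    case 3
    then have m: "card (V - C) \<ge> 8" using sep(3) by simp
    have "bnd (card V) = 4 + exP (card (V - C)) + 3 * card (V - C)" unfolding sep(3) by (rule bnd_exP[OF m])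
    then show ?thesis using sep(1,2) HW m by linarith
  qed
qed

lemma (in spike) two_link_bound:
  assumes "card G \<ge> 2"
    and IH: "\<And>W H'. \<lbrakk>finite W; card W < card V; H' \<subseteq> triples W; pfree H'\<rbrakk> \<Longrightarrow> card H' \<le> exP (card W)"
  shows "card H < bnd (card V) \<or> card H = bnd (card V) \<and> extremal V H"
proof (cases "\<exists>z. \<forall>p\<in>G. z \<in> p")
  case True
  then show ?thesis using star_bound[OF _ assms(1) IH] by blast
next
  case False
  then have ns: "\<exists>p\<in>G. w \<notin> p" for w by blast
  have "comet_on V H" if "H = triples {a, b, c, d} \<union> insert d ` prs R"
    unfolding comet_on_def using that dist inV unfolding R_def by blast
  then show ?thesis using nonstar_bound[OF ns IH] by (auto simp: extremal_def)
qed

text \<open>If only \<open>G1\<close> has two pairs, the argument runs with \<open>a\<close> and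
  \<open>d\<close> exchanged, where \<open>G1\<close> takes the place of \<open>G\<close>.\<close>

lemma (in spike) spike_bound:
  assumes "G \<noteq> {}"
    and IH: "\<And>W H'. \<lbrakk>finite W; card W < card V; H' \<subseteq> triples W; pfree H'\<rbrakk> \<Longrightarrow> card H' \<le> exP (card W)"
    and IH7: "\<And>W H'. \<lbrakk>finite W; card W < card V; H' \<subseteq> triples W; pfree H'; card W = 7; card H' = 20\<rbrakk> \<Longrightarrow> split_clique W H'"
  shows "card H < bnd (card V) \<or> card H = bnd (card V) \<and> extremal V H"
proof -
  consider "card G \<ge> 2" | "card G1 \<ge> 2" | "card G = 1" "card G1 \<le> 1"
    using assms(1) finG by (metis One_nat_def card_0_eq le_SucE le_zero_eq not_less_eq_eq numeral_2_eq_2)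
  then show ?thesis
  proof cases
    case 1
    then show ?thesis by (rule two_link_bound[OF _ IH])
  next
    case 2
    interpret s: spike V H d b c a by (rule swap)
    have "s.R = R" by (auto simp: s.R_def R_def)
    then have "s.G = G1" by (simp add: s.G_def G1_def)
    then show ?thesis using s.two_link_bound[OF _ IH] 2 by simp
  next
    case 3
    then obtain p where p: "G = {p}" by (auto simp: card_1_singleton_iff)
    then obtain u v where uv: "p = {u, v}" "u \<noteq> v" using G_sub[of p] by (auto simp: card_2_iff)
    interpret s: single_spike V H a b c d u v
      by unfold_locales (use uv p 3 IH in auto)
    show ?thesis
      using s.single_bound separated_bound[OF finV s.C_props _ pf IH IH7] by blast
  qed
qed

lemma core_bound:
  assumes V: "finite V" "H \<subseteq> triples V" "pfree H"
    and efg: "e \<in> H" "f \<in> H" "g \<in> H" "e \<inter> f = {}" "card (g \<inter> e) = 2" "g \<inter> f \<noteq> {}"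
    and IH: "\<And>W H'. \<lbrakk>finite W; card W < card V; H' \<subseteq> triples W; pfree H'\<rbrakk> \<Longrightarrow> card H' \<le> exP (card W)"
    and IH7: "\<And>W H'. \<lbrakk>finite W; card W < card V; H' \<subseteq> triples W; pfree H'; card W = 7; card H' = 20\<rbrakk> \<Longrightarrow> split_clique W H'"
  shows "card H < bnd (card V) \<or> card H = bnd (card V) \<and> extremal V H"
proof -
  note e = edge_props[OF V(2) efg(1)] and f = edge_props[OF V(2) efg(2)] and g = edge_props[OF V(2) efg(3)]
  obtain b c where bc: "g \<inter> e = {b, c}" "b \<noteq> c" using efg(5) by (auto simp: card_2_iff)
  obtain d where d: "d \<in> g" "d \<in> f" using efg(6) by blast
  have de: "d \<notin> e" using d efg(4) by blast
  have "g = {b, c, d}"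
  proof (rule card_subset_eq[symmetric, OF g(4)])
    show "{b, c, d} \<subseteq> g" using bc d by blast
    show "card {b, c, d} = card g" using bc de g by auto
  qed
  have "card (e - {b, c}) = 1" using bc e by (subst card_Diff_subset) auto
  then obtain a where a: "e - {b, c} = {a}" by (auto simp: card_1_singleton_iff)
  then have ea: "e = {a, b, c}" "a \<noteq> b" "a \<noteq> c" using bc by auto
  have "card (f - {d}) = 2" using f d by simp
  then obtain u v where uv: "f - {d} = {u, v}" "u \<noteq> v" by (auto simp: card_2_iff)
  then have fd: "f = {d, u, v}" "u \<noteq> d" "v \<noteq> d" using d by auto
  interpret spike V H a b c d
    by unfold_locales (use V ea bc(2) de efg(1,3) \<open>g = {b, c, d}\<close> in auto)
  have "{u, v} \<in> G"
  proof -
    have uvf: "u \<in> f" "v \<in> f" using fd(1) by simp_all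
    then have "u \<notin> e" "v \<notin> e" using efg(4) by blast+
    then have "u \<in> R" "v \<in> R" using uvf f(3) fd(2,3) unfolding ea(1) R_def by auto
    then show ?thesis unfolding G_def lk_doubleton_iff using uv(2) efg(2) fd(1) by simp
  qed
  then show ?thesis using spike_bound[OF _ IH IH7] by blast
qed

text \<open>The middle edge of a core splits its three vertices between \<open>e\<close> and
  \<open>f\<close>. Meeting both in one vertex would be a copy of \<open>P\<close>, so it meets one
  of them in two, which is the configuration of \<open>core_bound\<close>.\<close>

lemma disjoint_edges_bound:
  assumes V: "finite V" "H \<subseteq> triples V" "pfree H"
    and ef: "e \<in> H" "f \<in> H" "e \<inter> f = {}"
    and IH: "\<And>W H'. \<lbrakk>finite W; card W < card V; H' \<subseteq> triples W; pfree H'\<rbrakk> \<Longrightarrow> card H' \<le> exP (card W)"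
    and IH7: "\<And>W H'. \<lbrakk>finite W; card W < card V; H' \<subseteq> triples W; pfree H'; card W = 7; card H' = 20\<rbrakk> \<Longrightarrow> split_clique W H'"
  shows "card H < bnd (card V) \<or> card H = bnd (card V) \<and> extremal V H"
proof (cases "nocore H")
  case True
  then show ?thesis using nocore_less_bnd[OF V(1,2) True ef] by simp
next
  case False
  then obtain e f g where efg: "e \<in> H" "f \<in> H" "g \<in> H" "e \<inter> f = {}" "e \<inter> g \<noteq> {}" "g \<inter> f \<noteq> {}"
    unfolding nocore_def by blast
  have g: "finite g" "card g = 3" using edge_props[OF V(2) efg(3)] by simp_all
  have "card ((g \<inter> e) \<union> (g \<inter> f)) \<le> 3" using card_mono[OF g(1), of "(g \<inter> e) \<union> (g \<inter> f)"] g(2) by auto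
  moreover have "card ((g \<inter> e) \<union> (g \<inter> f)) = card (g \<inter> e) + card (g \<inter> f)"
    by (rule card_Un_disjoint) (use g efg(4) in auto)
  moreover have "card (g \<inter> e) \<noteq> 0" "card (g \<inter> f) \<noteq> 0" using efg(5,6) g(1) by auto
  moreover have "\<not> (card (g \<inter> e) = 1 \<and> card (g \<inter> f) = 1)"
  proof
    assume "card (g \<inter> e) = 1 \<and> card (g \<inter> f) = 1"
    then obtain x y where "g \<inter> e = {x}" "g \<inter> f = {y}" by (auto simp: card_1_singleton_iff)
    then show False using pfreeD[OF V(3) efg(1,3,2,4), of x y] by (simp add: Int_commute)
  qed
  ultimately consider "card (g \<inter> e) = 2" | "card (g \<inter> f) = 2" by linarith
  then show ?thesis
  proof cases
    case 1
    then show ?thesis using core_bound[OF V efg(1-4) _ efg(6) IH IH7] by blast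
  next
    case 2
    have "f \<inter> e = {}" "g \<inter> e \<noteq> {}" using efg by blast+
    then show ?thesis using core_bound[OF V efg(2,1,3) _ 2 _ IH IH7] by blast
  qed
qed

lemma bnd_le_exP: "n \<ge> 7 \<Longrightarrow> bnd n \<le> exP n"
proof -
  assume n: "n \<ge> 7"
  have small: "\<forall>m\<in>set [7..<13]. bnd m \<le> exP m" by code_simp
  show ?thesis
  proof (cases "n \<ge> 13")
    case True
    have "((n - 4) choose 2) + (n - 4) = ((n - 4) + 1) choose 2"
      using choose2_add[of "n - 4" 1] by (simp only: choose_small add_0_right mult_1_right)
    moreover have "((n - 4) + 1) choose 2 \<le> (n - 1) choose 2" by (rule choose2_mono) (use True in simp)
    ultimately show ?thesis using True bnd_13[OF True] by (simp add: exP_def)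
  next
    case False
    then have "n \<in> set [7..<13]" using n by (simp only: set_upt atLeastLessThan_iff not_le)
    then show ?thesis using small by blast
  qed
qed

text \<open>At order 7 an intersecting family has at most 15 edges, so 20 edges force two disjoint
  ones; as \<open>bnd 7 = 20\<close>, the family is then extremal, which at this order means a
  \<open>K6\<close> and an isolated vertex.\<close>

lemma turan:
  assumes "finite V" "H \<subseteq> triples V" "pfree H"
  shows "card H \<le> exP (card V) \<and> (card V = 7 \<and> card H = 20 \<longrightarrow> split_clique V H)"
  using assms
proof (induction "card V" arbitrary: V H rule: less_induct)
  case less
  note V = less.prems
  consider "card V \<le> 6" | "card V \<ge> 7" "isect H" | "card V \<ge> 7" "\<not> isect H" by linarith
  then show ?case
  proof cases
    case 1
    then show ?thesis
      using card_mono[OF finite_triples[OF V(1)] V(2)] card_triples[OF V(1)] by (simp add: exP_def)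
  next
    case 2
    then have b: "card H \<le> (card V - 1) choose 2" using isect_bound[OF V(1) _ V(2)] by simp
    show ?thesis
    proof (cases "card V = 7")
      case True
      then have "card H \<le> 15" using b by (simp add: choose_small)
      then show ?thesis using True by (simp add: exP_small)
    next
      case False
      then show ?thesis using b 2 by (simp add: exP_def)
    qed
  next
    case 3
    then obtain e f where ef: "e \<in> H" "f \<in> H" "e \<inter> f = {}" by (auto simp: isect_def)
    have "card H < bnd (card V) \<or> card H = bnd (card V) \<and> extremal V H"
      by (rule disjoint_edges_bound[OF V ef]) (use less.hyps in blast)+
    then show ?thesis
      using bnd_le_exP[OF 3(1)] by (auto simp: extremal_def bnd_small)
  qed
qed

lemma conditional_turan:
  assumes "finite V" "H \<subseteq> triples V" "pfree H" "e \<in> H" "f \<in> H" "e \<inter> f = {}"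
  shows "card H \<le> bnd (card V)" "card H = bnd (card V) \<Longrightarrow> extremal V H"
proof -
  have "card H < bnd (card V) \<or> card H = bnd (card V) \<and> extremal V H"
    by (rule disjoint_edges_bound[OF assms]) (use turan in blast)+
  then show "card H \<le> bnd (card V)" "card H = bnd (card V) \<Longrightarrow> extremal V H" by auto
qed

section \<open>Copies and isomorphisms\<close>

lemma is_3graph_iff: "fst H = {..<n} \<Longrightarrow> is_3graph H \<longleftrightarrow> snd H \<subseteq> triples {..<n}"
  by (auto simp: is_3graph_def triples_def)

lemma contains_M2_iff:
  assumes "fst H = V" "snd H \<subseteq> triples V"
  shows "contains H M2 \<longleftrightarrow> (\<exists>e\<in>snd H. \<exists>f\<in>snd H. e \<inter> f = {})"
proof
  assume "contains H M2"
  then obtain f :: "nat \<Rightarrow> nat" where f: "inj_on f {0..5}" "f ` {0, 1, 2} \<in> snd H" "f ` {3, 4, 5} \<in> snd H"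
    by (auto simp: contains_def M2_def)
  have "f ` {0, 1, 2} \<inter> f ` {3, 4, 5} = f ` ({0, 1, 2} \<inter> {3, 4, 5})"
    by (rule inj_on_image_Int[OF f(1), symmetric]) auto
  also have "\<dots> = {}" by simp
  finally show "\<exists>e\<in>snd H. \<exists>f\<in>snd H. e \<inter> f = {}" using f(2,3) by blast
next
  assume "\<exists>e\<in>snd H. \<exists>f\<in>snd H. e \<inter> f = {}"
  then obtain e f where ef: "e \<in> snd H" "f \<in> snd H" "e \<inter> f = {}" by blast
  obtain x y z where e: "e = {x, y, z}" "x \<noteq> y" "x \<noteq> z" "y \<noteq> z"
    using ef(1) assms(2) by (blast elim: triplesE)
  obtain p q r where f: "f = {p, q, r}" "p \<noteq> q" "p \<noteq> r" "q \<noteq> r"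
    using ef(2) assms(2) by (blast elim: triplesE)
  define xs where "xs = [x, y, z, p, q, r]"
  have "distinct xs" using e f ef(3) by (auto simp: xs_def)
  moreover have ran: "{0..5::nat} = {0, 1, 2, 3, 4, 5}" by auto
  ultimately have "inj_on ((!) xs) {0..5}" by (intro inj_on_nth) (auto simp: xs_def)
  moreover have "set xs \<subseteq> V" using edge_props(3)[OF assms(2) ef(1)] edge_props(3)[OF assms(2) ef(2)] e f by (auto simp: xs_def)
  then have "(!) xs ` {0..5} \<subseteq> V" unfolding ran by (simp add: xs_def)
  moreover have "(!) xs ` {0, 1, 2} = e" "(!) xs ` {3, 4, 5} = f" by (simp_all add: xs_def e f)
  ultimately show "contains H M2"
    unfolding contains_def M2_def using ef assms(1) by (intro exI[of _ "(!) xs"]) auto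
qed

lemma contains_P3_iff:
  assumes "fst H = V" "snd H \<subseteq> triples V"
  shows "contains H P3 \<longleftrightarrow> \<not> pfree (snd H)"
proof
  assume "contains H P3"
  then obtain f :: "nat \<Rightarrow> nat" where f: "inj_on f {0..6}" "f ` {0, 1, 2} \<in> snd H" "f ` {2, 3, 4} \<in> snd H" "f ` {4, 5, 6} \<in> snd H"
    by (auto simp: contains_def P3_def)
  have int: "f ` S \<inter> f ` S' = f ` (S \<inter> S')" if "S \<subseteq> {0..6}" "S' \<subseteq> {0..6}" for S S'
    by (rule inj_on_image_Int[OF f(1) that, symmetric])
  have i1: "f ` {0, 1, 2} \<inter> f ` {4, 5, 6} = {}" using int[of "{0, 1, 2}" "{4, 5, 6}"] by simp
  have i2: "f ` {0, 1, 2} \<inter> f ` {2, 3, 4} = {f 2}" using int[of "{0, 1, 2}" "{2, 3, 4}"] by simp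
  have i3: "f ` {2, 3, 4} \<inter> f ` {4, 5, 6} = {f 4}" using int[of "{2, 3, 4}" "{4, 5, 6}"] by simp
  show "\<not> pfree (snd H)" by (rule notI) (rule pfreeD[OF _ f(2,3,4) i1 i2 i3])
next
  assume "\<not> pfree (snd H)"
  then obtain e g f x y where efg: "e \<in> snd H" "g \<in> snd H" "f \<in> snd H" "e \<inter> f = {}" "e \<inter> g = {x}" "g \<inter> f = {y}"
    unfolding pfree_def not_not by (elim bexE conjE exE) (rule that)
  note E = edge_props[OF assms(2) efg(1)] edge_props[OF assms(2) efg(2)] edge_props[OF assms(2) efg(3)]
  have xy: "x \<in> e" "x \<in> g" "y \<in> g" "y \<in> f" "x \<noteq> y" using efg(4-6) by auto
  have "card (e - {x}) = 2" "card (f - {y}) = 2" "card (g - {x, y}) = 1"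
    using E xy by (simp_all add: card_Diff_subset)
  then obtain p q r s t where pq: "e - {x} = {p, q}" "p \<noteq> q" "f - {y} = {s, t}" "s \<noteq> t" "g - {x, y} = {r}"
    by (auto simp: card_2_iff card_1_singleton_iff)
  have e: "e = {p, q, x}" and f: "f = {y, s, t}" and g: "g = {x, r, y}" using pq xy by auto
  have d: "p \<noteq> x" "q \<noteq> x" "s \<noteq> y" "t \<noteq> y" "r \<noteq> x" "r \<noteq> y" using pq by auto
  have "r \<notin> e" "r \<notin> f" "y \<notin> e" "x \<notin> f" "p \<notin> f" "q \<notin> f" "s \<notin> e" "t \<notin> e"
  proof -
    have "p \<in> e" "q \<in> e" "s \<in> f" "t \<in> f" "r \<in> g" using e f g by simp_all
    moreover have "z \<notin> f" if "z \<in> e" for z using efg(4) that by blast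
    moreover have "z = x" if "z \<in> e" "z \<in> g" for z using efg(5) that by blast
    moreover have "z = y" if "z \<in> g" "z \<in> f" for z using efg(6) that by blast
    ultimately show "r \<notin> e" "r \<notin> f" "y \<notin> e" "x \<notin> f" "p \<notin> f" "q \<notin> f" "s \<notin> e" "t \<notin> e"
      using d(5,6) xy(1,4) by metis+
  qed
  then have "distinct [p, q, x, r, y, s, t]" using d pq(2,4) xy(5) e f by auto
  \<comment> \<open>The vertices in the order of the path, so that indexing into the list embeds
    \<open>P3\<close>.\<close>
  moreover define xs where "xs = [p, q, x, r, y, s, t]"
  moreover have ran: "{0..6::nat} = {0, 1, 2, 3, 4, 5, 6}" by auto
  ultimately have "inj_on ((!) xs) {0..6}" by (intro inj_on_nth) auto
  moreover have "set xs \<subseteq> V" using E(3,7,11) e f g by (auto simp: xs_def)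
  then have "(!) xs ` {0..6} \<subseteq> V" unfolding ran by (simp add: xs_def)
  moreover have "(!) xs ` {0, 1, 2} = e" "(!) xs ` {2, 3, 4} = g" "(!) xs ` {4, 5, 6} = f"
    by (simp_all add: xs_def e f g)
  ultimately show "contains H P3"
    unfolding contains_def P3_def using efg assms(1) by (intro exI[of _ "(!) xs"]) auto
qed

lemma admissible_iff:
  "admissible n {P3} {M2} H \<longleftrightarrow>
    fst H = {..<n} \<and> snd H \<subseteq> triples {..<n} \<and> pfree (snd H) \<and> (\<exists>e\<in>snd H. \<exists>f\<in>snd H. e \<inter> f = {})"
  unfolding admissible_def free_def
  using is_3graph_iff[of H n] contains_P3_iff[of H "{..<n}"] contains_M2_iff[of H "{..<n}"] by auto

lemma admissible_bound:
  assumes "admissible n {P3} {M2} H"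
  shows "card (snd H) \<le> bnd n" "card (snd H) = bnd n \<Longrightarrow> extremal {..<n} (snd H)"
proof -
  obtain e f where "e \<in> snd H" "f \<in> snd H" "e \<inter> f = {}" "snd H \<subseteq> triples {..<n}" "pfree (snd H)"
    using assms unfolding admissible_iff by blast
  then show "card (snd H) \<le> bnd n" "card (snd H) = bnd n \<Longrightarrow> extremal {..<n} (snd H)"
    using conditional_turan[of "{..<n}" "snd H" e f] by simp_all
qed

lemma ex3_eq:
  assumes "admissible n {P3} {M2} X" "card (snd X) = bnd n"
  shows "ex3 n {P3} {M2} = bnd n"
  unfolding ex3_def
proof (rule Max_eqI)
  show "finite {card (snd H) |H. admissible n {P3} {M2} H}"
    by (rule finite_subset[of _ "{..bnd n}"]) (use admissible_bound(1) in auto)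
  show "\<And>y. y \<in> {card (snd H) |H. admissible n {P3} {M2} H} \<Longrightarrow> y \<le> bnd n"
    using admissible_bound(1) by auto
  show "bnd n \<in> {card (snd H) |H. admissible n {P3} {M2} H}"
    by (rule CollectI, intro exI[of _ X]) (use assms in simp)
qed

lemma iso_admissible:
  assumes "iso H X" "fst H = {..<n}" "is_3graph H" "admissible n {P3} {M2} X"
  shows "admissible n {P3} {M2} H" "card (snd H) = card (snd X)"
proof -
  obtain f where f: "bij_betw f {..<n} (fst X)" "(\<lambda>e. f ` e) ` snd H = snd X"
    using assms(1,2) unfolding iso_def by auto
  have inj: "inj_on f {..<n}" using f(1) by (rule bij_betw_imp_inj_on)
  have H: "snd H \<subseteq> triples {..<n}" using assms(2,3) is_3graph_iff by blast
  have sub: "e \<subseteq> {..<n}" if "e \<in> snd H" for e using edge_props(3)[OF H that] .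
  have X: "pfree (snd X)" "\<exists>e\<in>snd X. \<exists>f\<in>snd X. e \<inter> f = {}" using assms(4) by (auto simp: admissible_iff)
  have int: "f ` e \<inter> f ` g = f ` (e \<inter> g)" if "e \<in> snd H" "g \<in> snd H" for e g
    by (rule inj_on_image_Int[OF inj sub[OF that(1)] sub[OF that(2)], symmetric])
  have mem: "f ` e \<in> snd X" if "e \<in> snd H" for e using f(2) that by blast
  have "pfree (snd H)"
    unfolding pfree_def
  proof (intro notI, elim bexE conjE exE)
    fix e g h x y
    assume "e \<in> snd H" "g \<in> snd H" "h \<in> snd H" "e \<inter> h = {}" "e \<inter> g = {x}" "g \<inter> h = {y}"
    then show False using pfreeD[OF X(1) mem mem mem, of e g h "f x" "f y"] by (simp add: int)
  qed
  moreover obtain e g where eg: "e \<in> snd H" "g \<in> snd H" "f ` e \<inter> f ` g = {}"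
    using X(2) unfolding f(2)[symmetric] bex_simps by (elim bexE) (rule that)
  then have "e \<inter> g = {}" using int[OF eg(1,2)] by simp
  ultimately show "admissible n {P3} {M2} H" unfolding admissible_iff using assms(2) H eg(1,2) by blast
  have "inj_on (\<lambda>e. f ` e) (snd H)"
    by (rule inj_onI) (metis inj inj_on_image_eq_iff sub)
  then show "card (snd H) = card (snd X)" using f(2) card_image by metis
qed

section \<open>Isomorphisms onto the model graphs\<close>

text \<open>Each extremal graph is determined by a partition into at most three blocks: two cliques
  and an empty block, two cliques and a vertex, or centre, special vertices and remainder.\<close>

lemma parts_bij:
  fixes A1 A2 A3 B1 B2 B3 :: "nat set"
  assumes "finite A1" "finite A2" "finite A3" "finite B1" "finite B2" "finite B3"
    "card A1 = card B1" "card A2 = card B2" "card A3 = card B3"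
    "A1 \<inter> A2 = {}" "A1 \<inter> A3 = {}" "A2 \<inter> A3 = {}" "B1 \<inter> B2 = {}" "B1 \<inter> B3 = {}" "B2 \<inter> B3 = {}"
  obtains f where "bij_betw f (A1 \<union> A2 \<union> A3) (B1 \<union> B2 \<union> B3)" "f ` A1 = B1" "f ` A2 = B2" "f ` A3 = B3"
proof -
  obtain f1 f2 f3 where f: "bij_betw f1 A1 B1" "bij_betw f2 A2 B2" "bij_betw f3 A3 B3"
    using assms(1-9) finite_same_card_bij by metis
  define f where "f x = (if x \<in> A1 then f1 x else if x \<in> A2 then f2 x else f3 x)" for x
  have g: "bij_betw f A1 B1" "bij_betw f A2 B2" "bij_betw f A3 B3"
    using f assms(10-12) by (auto simp: f_def cong: bij_betw_cong elim!: bij_betw_cong[THEN iffD1, rotated])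
  have "bij_betw f (A1 \<union> A2) (B1 \<union> B2)" by (rule bij_betw_combine[OF g(1,2) assms(13)])
  then have "bij_betw f (A1 \<union> A2 \<union> A3) (B1 \<union> B2 \<union> B3)"
    by (rule bij_betw_combine[OF _ g(3)]) (use assms(14,15) in blast)
  then show thesis using that g by (simp add: bij_betw_imp_surj_on)
qed

lemma image_triples:
  assumes "inj_on f S"
  shows "(\<lambda>e. f ` e) ` triples S = triples (f ` S)"
proof (intro equalityI subsetI)
  fix e assume "e \<in> triples (f ` S)"
  then have e: "e \<subseteq> f ` S" "card e = 3" by (auto simp: triples_def)
  then obtain p where p: "p \<subseteq> S" "e = f ` p" by (auto simp: subset_image_iff)
  then have "card p = 3" using e(2) card_image[OF inj_on_subset[OF assms p(1)]] by simp
  then show "e \<in> (\<lambda>e. f ` e) ` triples S" using p by (auto simp: triples_def)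
next
  fix e assume "e \<in> (\<lambda>e. f ` e) ` triples S"
  then obtain p where p: "e = f ` p" "p \<subseteq> S" "card p = 3" by (auto simp: triples_def)
  then show "e \<in> triples (f ` S)" using card_image[OF inj_on_subset[OF assms p(2)]] by (auto simp: triples_def)
qed

lemma image_prs:
  assumes "inj_on f S"
  shows "(\<lambda>e. f ` e) ` prs S = prs (f ` S)"
proof (intro equalityI subsetI)
  fix e assume "e \<in> prs (f ` S)"
  then have e: "e \<subseteq> f ` S" "card e = 2" by auto
  then obtain p where p: "p \<subseteq> S" "e = f ` p" by (auto simp: subset_image_iff)
  then have "card p = 2" using e(2) card_image[OF inj_on_subset[OF assms p(1)]] by simp
  then show "e \<in> (\<lambda>e. f ` e) ` prs S" using p by auto
next
  fix e assume "e \<in> (\<lambda>e. f ` e) ` prs S"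
  then obtain p where p: "e = f ` p" "p \<subseteq> S" "card p = 2" by auto
  then show "e \<in> prs (f ` S)" using card_image[OF inj_on_subset[OF assms p(2)]] by auto
qed

lemma comet_edges: "snd (comet n) = triples {0..<4} \<union> insert 0 ` prs {4..<n}"
proof -
  have "{{0, u, v} |u v. u \<in> {4..<n} \<and> v \<in> {4..<n} \<and> u \<noteq> v} = insert 0 ` prs {4..<n}"
  proof (intro equalityI subsetI)
    fix e assume "e \<in> insert 0 ` prs {4..<n}"
    then obtain p where p: "e = insert 0 p" "p \<subseteq> {4..<n}" "card p = 2" by auto
    then obtain u v where "p = {u, v}" "u \<noteq> v" by (auto simp: card_2_iff)
    then show "e \<in> {{0, u, v} |u v. u \<in> {4..<n} \<and> v \<in> {4..<n} \<and> u \<noteq> v}" using p by auto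
  next
    fix e assume "e \<in> {{0, u, v} |u v. u \<in> {4..<n} \<and> v \<in> {4..<n} \<and> u \<noteq> v}"
    then obtain u v where "e = insert 0 {u, v}" "u \<in> {4..<n}" "v \<in> {4..<n}" "u \<noteq> v" by auto
    moreover then have "{u, v} \<in> prs {4..<n}" by (auto simp: card_insert_if)
    ultimately show "e \<in> insert 0 ` prs {4..<n}" by blast
  qed
  then show ?thesis by (simp add: comet_def)
qed

lemma split_clique_iso:
  assumes "6 \<le> n" "fst H = {..<n}" "split_clique {..<n} (snd H)"
  shows "iso H (K6_Kn6 n)"
proof -
  obtain S where S: "S \<subseteq> {..<n}" "card S = 6" "snd H = triples S \<union> triples ({..<n} - S)"
    using assms(3) unfolding split_clique_def by blast
  have fin: "finite S" using S(1) finite_subset by blast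
  have "card ({..<n} - S) = n - 6" using S fin by (simp add: card_Diff_subset)
  then obtain f :: "nat \<Rightarrow> nat" where f: "bij_betw f (S \<union> ({..<n} - S) \<union> {}) ({0..<6} \<union> {6..<n} \<union> {})"
      "f ` S = {0..<6}" "f ` ({..<n} - S) = {6..<n}"
    using parts_bij[of S "{..<n} - S" "{}" "{0..<6}" "{6..<n}" "{}"] S fin by auto
  have V: "S \<union> ({..<n} - S) \<union> {} = {..<n}" "{0..<6} \<union> {6..<n} \<union> {} = {..<n}" using S(1) assms(1) by auto
  have inj: "inj_on f {..<n}" using f(1) V by (simp add: bij_betw_def)
  have "(\<lambda>e. f ` e) ` snd H = triples {0..<6} \<union> triples {6..<n}"
    unfolding S(3) image_Un
    using image_triples[OF inj_on_subset[OF inj S(1)]] image_triples[OF inj_on_subset[OF inj Diff_subset], of S] f(2,3)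
    by simp
  then show ?thesis unfolding iso_def K6_Kn6_def using f(1) V assms(2) by (intro exI[of _ f]) simp
qed

lemma two_cliques_iso:
  assumes "fst H = {..<13}" "two_cliques {..<13} (snd H)"
  shows "iso H K6_K6_K1"
proof -
  obtain S S' where S: "S \<subseteq> {..<13}" "S' \<subseteq> {..<13}" "S \<inter> S' = {}" "card S = 6" "card S' = 6"
    "snd H = triples S \<union> triples S'"
    using assms(2) unfolding two_cliques_def by blast
  have fin: "finite S" "finite S'" using S(1,2) finite_subset by blast+
  define Z where "Z = {..<13} - (S \<union> S')"
  have Z: "card Z = 1" "finite Z" "S \<inter> Z = {}" "S' \<inter> Z = {}" "S \<union> S' \<union> Z = {..<13}"
    using S fin card_Diff_subset[of "S \<union> S'" "{..<13}"] by (auto simp: Z_def card_Un_disjoint)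
  obtain f :: "nat \<Rightarrow> nat" where f: "bij_betw f (S \<union> S' \<union> Z) ({0..<6} \<union> {6..<12} \<union> {12})"
      "f ` S = {0..<6}" "f ` S' = {6..<12}"
    by (rule parts_bij[of S S' Z "{0..<6}" "{6..<12}" "{12}"]) (use S(3-5) fin Z(1-4) in auto)
  note V = Z(5)
  have V': "{0..<6} \<union> {6..<12} \<union> {12} = {..<13::nat}" by auto
  have inj: "inj_on f {..<13}" using f(1) unfolding V by (simp add: bij_betw_def)
  have "(\<lambda>e. f ` e) ` snd H = triples {0..<6} \<union> triples {6..<12}"
    unfolding S(6) image_Un
    using image_triples[OF inj_on_subset[OF inj S(1)]] image_triples[OF inj_on_subset[OF inj S(2)]] f(2,3)
    by simp
  then show ?thesis unfolding iso_def K6_K6_K1_def using f(1) V V' assms(1) by (intro exI[of _ f]) simp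
qed

lemma comet_iso:
  assumes "6 \<le> n" "fst H = {..<n}" "comet_on {..<n} (snd H)"
  shows "iso H (comet n)"
proof -
  obtain a b c d where d: "distinct [a, b, c, d]" "{a, b, c, d} \<subseteq> {..<n}"
    "snd H = triples {a, b, c, d} \<union> insert d ` prs ({..<n} - {a, b, c, d})"
    using assms(3) unfolding comet_on_def by (elim exE conjE) (rule that)
  define S where "S = {a, b, c, d}"
  have S: "card S = 4" "finite S" "S \<subseteq> {..<n}" using d(1,2) by (auto simp: S_def)
  have cs: "card {a, b, c} = 3" using d(1) by simp
  define Z where "Z = {..<n} - S"
  have Z: "card Z = n - 4" "finite Z" "{d} \<inter> Z = {}" "{a, b, c} \<inter> Z = {}" "{d} \<union> {a, b, c} \<union> Z = {..<n}"
    using card_Diff_subset[OF S(2,3)] S by (auto simp: Z_def S_def)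
  obtain f :: "nat \<Rightarrow> nat" where f: "bij_betw f ({d} \<union> {a, b, c} \<union> Z) ({0} \<union> {1, 2, 3} \<union> {4..<n})"
      "f ` {d} = {0}" "f ` {a, b, c} = {1, 2, 3}" "f ` Z = {4..<n}"
    by (rule parts_bij[of "{d}" "{a, b, c}" Z "{0}" "{1, 2, 3}" "{4..<n}"]) (use cs d(1) Z(1-4) in auto)
  note V = Z(5)
  have V': "{0} \<union> {1, 2, 3} \<union> {4..<n} = {..<n}" using assms(1) by auto
  have inj: "inj_on f {..<n}" using f(1) unfolding V by (simp add: bij_betw_def)
  have fd: "f d = 0" using f(2) by simp
  have "S = insert d {a, b, c}" by (auto simp: S_def)
  then have "f ` S = insert (f d) (f ` {a, b, c})" by (simp only: image_insert)
  also have "\<dots> = insert 0 {1, 2, 3}" by (simp only: fd f(3))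
  also have "\<dots> = {0..<4}" by auto
  finally have fS: "f ` S = {0..<4}" .
  have ZV: "Z \<subseteq> {..<n}" by (auto simp: Z_def)
  have "(\<lambda>e. f ` e) ` snd H = (\<lambda>e. f ` e) ` triples S \<union> insert 0 ` ((\<lambda>e. f ` e) ` prs Z)"
    unfolding d(3) S_def[symmetric] Z_def[symmetric] image_Un image_image by (simp add: fd)
  also have "\<dots> = snd (comet n)"
    unfolding image_triples[OF inj_on_subset[OF inj S(3)]] image_prs[OF inj_on_subset[OF inj ZV]]
    unfolding comet_edges fS f(4) ..
  finally show ?thesis unfolding iso_def using f(1) V V' assms(2) by (intro exI[of _ f]) (simp add: comet_def)
qed

section \<open>The model graphs are admissible\<close>

text \<open>Two disjoint edges fill the at most six vertices, so the middle edge would consist of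
  its two intersection vertices only.\<close>

lemma pfree_triples:
  assumes "finite S" "card S \<le> 6"
  shows "pfree (triples S)"
  unfolding pfree_def
proof (intro notI, elim bexE conjE exE)
  fix e g f x y
  assume h: "e \<in> triples S" "g \<in> triples S" "f \<in> triples S" "e \<inter> f = {}" "e \<inter> g = {x}" "g \<inter> f = {y}"
  have c: "card e = 3" "card f = 3" "card g = 3" "e \<subseteq> S" "f \<subseteq> S" "g \<subseteq> S" using h(1-3) by (auto simp: triples_def)
  have fin: "finite e" "finite f" using edge_finite[OF h(1)] edge_finite[OF h(3)] by simp_all
  have "card (e \<union> f) = 6" using card_Un_disjoint[OF fin h(4)] c by simp
  then have "e \<union> f = S" using card_seteq[OF assms(1), of "e \<union> f"] c assms(2) by simp
  then have "g \<subseteq> {x, y}" using c(6) h(5,6) by blast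
  then have "card g \<le> card {x, y}" by (intro card_mono) auto
  also have "\<dots> \<le> 2" by (simp add: card_insert_if)
  finally show False using c(3) by simp
qed

text \<open>Both end edges of a path meet the middle one, so all three lie in the same part.\<close>

lemma pfree_disjoint_Un:
  assumes "pfree H" "pfree H'" "H \<subseteq> triples S" "H' \<subseteq> triples S'" "S \<inter> S' = {}"
  shows "pfree (H \<union> H')"
proof -
  have dj: "e \<inter> f = {}" if "e \<in> H" "f \<in> H'" for e f
    using edge_props(3)[OF assms(3) that(1)] edge_props(3)[OF assms(4) that(2)] assms(5) by blast
  show ?thesis
    unfolding pfree_def
  proof (intro notI, elim bexE conjE exE)
    fix e g f x y
    assume h: "e \<in> H \<union> H'" "g \<in> H \<union> H'" "f \<in> H \<union> H'" "e \<inter> f = {}" "e \<inter> g = {x}" "g \<inter> f = {y}"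
    show False
    proof (cases "g \<in> H")
      case True
      then have "e \<in> H" "f \<in> H" using h dj[OF True, of e] dj[OF True, of f] by auto
      then show False using pfreeD[OF assms(1) _ True _ h(4-6)] by blast
    next
      case False
      then have g: "g \<in> H'" using h by blast
      then have "e \<in> H'" "f \<in> H'" using h dj[OF _ g, of e] dj[OF _ g, of f] by auto
      then show False using pfreeD[OF assms(2) _ g _ h(4-6)] by blast
    qed
  qed
qed

lemma cliques_admissible:
  assumes "S \<union> S' \<subseteq> {..<n}" "S \<inter> S' = {}" "card S = 6" "card S' \<le> 6"
  shows "admissible n {P3} {M2} ({..<n}, triples S \<union> triples S')"
    "card (triples S \<union> triples S') = 20 + (card S' choose 3)"
proof -
  have fin: "finite S" "finite S'" using assms(1) finite_subset by auto
  have "triples S \<inter> triples S' = {}" using assms(2) by (auto simp: triples_Int) (auto simp: triples_def)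
  then show "card (triples S \<union> triples S') = 20 + (card S' choose 3)"
    using card_Un_disjoint[OF finite_triples[OF fin(1)] finite_triples[OF fin(2)]] card_triples fin assms(3)
    by (simp add: choose_small)
  have "pfree (triples S \<union> triples S')"
    by (rule pfree_disjoint_Un[OF pfree_triples pfree_triples _ _ assms(2)]) (use fin assms in auto)
  \<comment> \<open>Both disjoint edges are taken inside the first \<open>K6\<close>, because
    \<open>S'\<close> may be too small to contain an edge.\<close>
  moreover obtain e where e: "e \<subseteq> S" "card e = 3" using obtain_subset_with_card_n[of 3 S] assms(3) by auto
  then have "S - e \<subseteq> S" "card (S - e) = 3"
    using card_Diff_subset[OF finite_subset[OF e(1) fin(1)] e(1)] assms(3) by auto
  then have "e \<in> triples S" "S - e \<in> triples S" using e by (auto simp: triples_def)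
  then have "\<exists>e\<in>triples S \<union> triples S'. \<exists>f\<in>triples S \<union> triples S'. e \<inter> f = {}"
    by (intro bexI[of _ e] bexI[of _ "S - e"]) simp_all
  moreover have "triples S \<union> triples S' \<subseteq> triples {..<n}"
    using triples_mono[of S "{..<n}"] triples_mono[of S' "{..<n}"] assms(1) by blast
  ultimately show "admissible n {P3} {M2} ({..<n}, triples S \<union> triples S')"
    unfolding admissible_iff by simp
qed

text \<open>Two disjoint edges cannot both contain 0, so one of them is \<open>{1, 2, 3}\<close>;
  but no edge meets that one in exactly one vertex.\<close>

lemma comet_admissible:
  assumes "6 \<le> n"
  shows "admissible n {P3} {M2} (comet n)" "card (snd (comet n)) = 4 + ((n - 4) choose 2)"
proof -
  have sub: "snd (comet n) \<subseteq> triples {..<n}"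
  proof
    fix e assume "e \<in> snd (comet n)"
    then consider "e \<in> triples {0..<4}" | p where "e = insert 0 p" "p \<subseteq> {4..<n}" "card p = 2"
      unfolding comet_edges by auto
    then show "e \<in> triples {..<n}"
    proof cases
      case 1
      moreover have "{0..<4} \<subseteq> {..<n}" using assms by auto
      ultimately show ?thesis using triples_mono by blast
    next
      case 2
      then have "finite p" "0 \<notin> p" using finite_subset by auto
      then show ?thesis using 2 assms by (auto simp: triples_def)
    qed
  qed
  have dj: "triples {0..<4} \<inter> insert 0 ` prs {4..<n} = {}"
  proof (rule equals0I)
    fix e assume e: "e \<in> triples {0..<4} \<inter> insert 0 ` prs {4..<n}"
    then obtain p where p: "e = insert 0 p" "p \<subseteq> {4..<n}" "card p = 2" by auto
    then have "p \<subseteq> {0..<4}" using e by (auto simp: triples_def)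
    then have "p \<subseteq> {0..<4} \<inter> {4..<n}" using p(2) by blast
    also have "{0..<4} \<inter> {4..<n} = {}" by auto
    finally show False using p(3) by simp
  qed
  have "card (insert 0 ` prs {4..<n}) = card (prs {4..<n})"
    by (rule card_insert_image) auto
  then have "card (insert 0 ` prs {4..<n}) = (n - 4) choose 2"
    using card_pairs[of "{4..<n}"] by simp
  then show "card (snd (comet n)) = 4 + ((n - 4) choose 2)"
    unfolding comet_edges using card_Un_disjoint[OF _ _ dj] card_triples[of "{0..<4}"]
    by (simp add: finite_triples choose_small)
  have set4: "{0..<4} = {0, 1, 2, 3::nat}" by auto
  have avoid: "e = {1, 2, 3}" if e: "e \<in> snd (comet n)" "0 \<notin> e" for e
  proof -
    have "e \<in> triples {0..<4}" using e unfolding comet_edges by auto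
    then have "e \<subseteq> {0, 1, 2, 3}" "card e = 3" by (simp_all add: triples_def set4)
    then have "e \<subseteq> {1, 2, 3}" "card e = card {1, 2, 3::nat}" using e(2) by auto
    then show ?thesis by (intro card_subset_eq) simp_all
  qed
  have meet: "card (g \<inter> {1, 2, 3}) \<noteq> 1" if g: "g \<in> snd (comet n)" for g
  proof
    assume c: "card (g \<inter> {1, 2, 3}) = 1"
    then obtain x where x: "g \<inter> {1, 2, 3} = {x}" by (auto simp: card_1_singleton_iff)
    have "g \<in> triples {0..<4}"
    proof (rule ccontr)
      assume "g \<notin> triples {0..<4}"
      then obtain p where "g = insert 0 p" "p \<subseteq> {4..<n}" using g unfolding comet_edges by auto
      then have "g \<inter> {1, 2, 3} \<subseteq> {4..<n} \<inter> {1, 2, 3}" by auto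
      also have "{4..<n} \<inter> {1, 2, 3} = {}" by auto
      finally show False using x by simp
    qed
    then have "g \<subseteq> {0, 1, 2, 3}" "card g = 3" by (simp_all add: triples_def set4)
    then have "g \<subseteq> {0} \<union> (g \<inter> {1, 2, 3})" by blast
    then have "card g \<le> card {0, x}" using x by (intro card_mono) auto
    also have "\<dots> \<le> 2" by (simp add: card_insert_if)
    finally show False using \<open>card g = 3\<close> by simp
  qed
  have "pfree (snd (comet n))"
    unfolding pfree_def
  proof (intro notI, elim bexE conjE exE)
    fix e g f x y
    assume h: "e \<in> snd (comet n)" "g \<in> snd (comet n)" "f \<in> snd (comet n)" "e \<inter> f = {}" "e \<inter> g = {x}" "g \<inter> f = {y}"
    have "0 \<notin> e \<or> 0 \<notin> f" using h(4) by blast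
    then have "e = {1, 2, 3} \<or> f = {1, 2, 3}" using avoid h by blast
    moreover have "card (g \<inter> e) = 1" "card (g \<inter> f) = 1" using h(5,6) by (simp_all add: Int_commute)
    ultimately show False using meet[OF h(2)] by blast
  qed
  moreover have "{1, 2, 3} \<in> snd (comet n)" by (simp add: comet_edges triples_def)
  moreover have "{0, 4, 5} \<in> snd (comet n)"
    unfolding comet_edges by (rule UnI2, rule image_eqI[of _ _ "{4, 5}"]) (use assms in auto)
  moreover have "{1, 2, 3} \<inter> {0, 4, 5::nat} = {}" by simp
  ultimately show "admissible n {P3} {M2} (comet n)"
    unfolding admissible_iff using sub by (intro conjI) (simp add: comet_def, assumption+, blast)
qed

text \<open>\<open>X\<close> shows that the maximum is attained, and \<open>\<Y>\<close> is the list
  of model graphs; a set is used because order 13 has two of them.\<close>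

lemma Ex3_iff:
  assumes "admissible n {P3} {M2} X" "card (snd X) = bnd n" "fst H = {..<n}" "is_3graph H"
    "\<And>H. \<lbrakk>fst H = {..<n}; extremal {..<n} (snd H)\<rbrakk> \<Longrightarrow> \<exists>Y\<in>\<Y>. iso H Y"
    "\<And>Y. Y \<in> \<Y> \<Longrightarrow> admissible n {P3} {M2} Y \<and> card (snd Y) = bnd n"
  shows "H \<in> Ex3 n {P3} {M2} \<longleftrightarrow> (\<exists>Y\<in>\<Y>. iso H Y)"
proof
  assume "H \<in> Ex3 n {P3} {M2}"
  then have "admissible n {P3} {M2} H" "card (snd H) = bnd n"
    unfolding Ex3_def ex3_eq[OF assms(1,2)] by simp_all
  then show "\<exists>Y\<in>\<Y>. iso H Y" using assms(5)[OF assms(3)] admissible_bound(2) by blast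
next
  assume "\<exists>Y\<in>\<Y>. iso H Y"
  then obtain Y where Y: "Y \<in> \<Y>" "iso H Y" by blast
  note adm = assms(6)[OF Y(1)]
  have "admissible n {P3} {M2} H" "card (snd H) = card (snd Y)"
    using iso_admissible[OF Y(2) assms(3,4)] adm by blast+
  then show "H \<in> Ex3 n {P3} {M2}" unfolding Ex3_def ex3_eq[OF assms(1,2)] using adm by simp
qed

theorem mainTheorem5:
  shows "(\<forall>n::nat. 6 \<le> n \<and> n \<le> 12 \<longrightarrow>
            ex3 n {P3} {M2} = 20 + (n - 6 choose 3) \<and>
            (\<forall>H. fst H = {..<n} \<and> is_3graph H \<longrightarrow> (H \<in> Ex3 n {P3} {M2} \<longleftrightarrow> iso H (K6_Kn6 n))))
       \<and> (ex3 13 {P3} {M2} = 40 \<and>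
            (\<forall>H. fst H = {..<13} \<and> is_3graph H \<longrightarrow>
               (H \<in> Ex3 13 {P3} {M2} \<longleftrightarrow> iso H K6_K6_K1 \<or> iso H (comet 13))))
       \<and> (\<forall>n::nat. 14 \<le> n \<longrightarrow>
            ex3 n {P3} {M2} = 4 + (n - 4 choose 2) \<and>
            (\<forall>H. fst H = {..<n} \<and> is_3graph H \<longrightarrow> (H \<in> Ex3 n {P3} {M2} \<longleftrightarrow> iso H (comet n))))"
proof (intro conjI allI impI)
  fix n :: nat
  assume n: "6 \<le> n \<and> n \<le> 12"
  have "{0..<6} \<union> {6..<n} \<subseteq> {..<n}" using n by auto
  note adm = cliques_admissible[OF this]
  have X: "admissible n {P3} {M2} (K6_Kn6 n)" "card (snd (K6_Kn6 n)) = bnd n"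
  proof -
    have "n - 6 \<le> 6" using n by linarith
    then show "admissible n {P3} {M2} (K6_Kn6 n)" "card (snd (K6_Kn6 n)) = bnd n"
      using adm n by (simp_all add: K6_Kn6_def bnd_def)
  qed
  show "ex3 n {P3} {M2} = 20 + (n - 6 choose 3)" using ex3_eq[OF X] n by (simp add: bnd_def)
  fix H assume H: "fst H = {..<n} \<and> is_3graph H"
  have "H \<in> Ex3 n {P3} {M2} \<longleftrightarrow> (\<exists>Y\<in>{K6_Kn6 n}. iso H Y)"
  proof (rule Ex3_iff[OF X])
    fix H' :: hg assume H': "fst H' = {..<n}" "extremal {..<n} (snd H')"
    then have "split_clique {..<n} (snd H')" using n by (simp add: extremal_def)
    then show "\<exists>Y\<in>{K6_Kn6 n}. iso H' Y" using split_clique_iso H'(1) n by simp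
  qed (use H X in auto)
  then show "H \<in> Ex3 n {P3} {M2} \<longleftrightarrow> iso H (K6_Kn6 n)" by simp
next
  have "{0..<6} \<union> {6..<12} \<subseteq> {..<13::nat}" by auto
  note adm = cliques_admissible[OF this]
  have X: "admissible 13 {P3} {M2} K6_K6_K1" "card (snd K6_K6_K1) = bnd 13"
    using adm by (simp_all add: K6_K6_K1_def bnd_small choose_small)
  have Y: "admissible 13 {P3} {M2} (comet 13)" "card (snd (comet 13)) = bnd 13"
    using comet_admissible[of 13] by (simp_all add: bnd_small choose_small)
  show "ex3 13 {P3} {M2} = 40" using ex3_eq[OF X] by (simp add: bnd_small)
  fix H assume H: "fst H = {..<13} \<and> is_3graph H"
  have "H \<in> Ex3 13 {P3} {M2} \<longleftrightarrow> (\<exists>Y\<in>{K6_K6_K1, comet 13}. iso H Y)"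
  proof (rule Ex3_iff[OF X])
    fix H' :: hg assume H': "fst H' = {..<13}" "extremal {..<13} (snd H')"
    then have "two_cliques {..<13} (snd H') \<or> comet_on {..<13} (snd H')" by (simp add: extremal_def)
    then show "\<exists>Y\<in>{K6_K6_K1, comet 13}. iso H' Y" using two_cliques_iso[OF H'(1)] comet_iso[OF _ H'(1)] by auto
  next
    fix Y' :: hg assume "Y' \<in> {K6_K6_K1, comet 13}"
    then show "admissible 13 {P3} {M2} Y' \<and> card (snd Y') = bnd 13"
      by (elim insertE emptyE) (simp_all only: X Y simp_thms)
  qed (simp_all only: H)
  then show "H \<in> Ex3 13 {P3} {M2} \<longleftrightarrow> iso H K6_K6_K1 \<or> iso H (comet 13)" by simp
next
  fix n :: nat
  assume n: "14 \<le> n"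
  have X: "admissible n {P3} {M2} (comet n)" "card (snd (comet n)) = bnd n"
    using comet_admissible[of n] n by (simp_all add: bnd_def)
  show "ex3 n {P3} {M2} = 4 + (n - 4 choose 2)" using ex3_eq[OF X] n by (simp add: bnd_def)
  fix H assume H: "fst H = {..<n} \<and> is_3graph H"
  have "H \<in> Ex3 n {P3} {M2} \<longleftrightarrow> (\<exists>Y\<in>{comet n}. iso H Y)"
  proof (rule Ex3_iff[OF X])
    fix H' :: hg assume H': "fst H' = {..<n}" "extremal {..<n} (snd H')"
    then have "comet_on {..<n} (snd H')" using n by (simp add: extremal_def)
    then show "\<exists>Y\<in>{comet n}. iso H' Y" using comet_iso H'(1) n by simp
  qed (use H X in auto)
  then show "H \<in> Ex3 n {P3} {M2} \<longleftrightarrow> iso H (comet n)" by simp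
qed

end
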